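(* Let $B, C, D$ be unital C*-algebras, let $\delta : B\to D$ and $\gamma : C\to D$ be unital $\ast$-homomorphisms such that either $\gamma$ or $\delta$ is surjective, and let $A := \{(b,c)\in B\oplus C : \delta(b) = \gamma(c)\}$ be the pullback. Then $$gsr(A) \leq \max\{csr(B),csr(C),gsr(C(\mathbb{T})\otimes D)\},$$ $$csr(A) \leq \max\{csr(B),csr(C), csr(C(\mathbb{T})\otimes D)\}.$$ Furthermore, if $K_1(D) = 0$, then $$gsr(A)\leq \max\{gsr(B),gsr(C),gsr(C(\mathbb{T})\otimes D)\}.$$
   Context: $\mathbb{T}$ is the circle. For a unital C*-algebra $A$ and $n\ge 1$, $Lg_n(A)$ is the set of left unimodular vectors, i.e. $(a_1,\dots,a_n)\in A^n$ with $Aa_1+\dots+Aa_n=A$, topologized as a subspace of $A^n$. $GL_n(A)$ is the group of invertible elements of $M_n(A)$, acting on $Lg_n(A)$ by left multiplication; $GL_n^0(A)$ is the connected component of the identity. The general stable rank $gsr(A)$ is the least $n\ge 1$ such that $GL_m(A)$ acts transitively on $Lg_m(A)$ for all $m\ge n$ (equivalently: for all $m\ge n$, every projective right $A$-module $P$ with $P\oplus A\cong A^m$ satisfies $P\cong A^{m-1}$). The connected stable rank $csr(A)$ is the least $n\ge 1$ such that $GL_m^0(A)$ acts transitively on $Lg_m(A)$ for all $m\ge n$ (equivalently, $Lg_m(A)$ is connected for all $m\ge n$). Each is $+\infty$ if no such $n$ exists. *)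

theory Defs
  imports "HOL-Analysis.Analysis" "HOL-Algebra.Algebra" "HOL-Library.Extended_Nat"
begin

section \<open>Unital C*-algebras\<close>

text \<open>A carrier-based rendering is used, because pullbacks depend on the two homomorphisms.
  The zero algebra (in which \<open>\<one> = \<zero>\<close>) is a unital C*-algebra here, as usual.\<close>

definition complex_ring :: "complex ring" where
  "complex_ring = \<lparr>carrier = UNIV, monoid.mult = (*), one = 1, ring.zero = 0, add = (+)\<rparr>"

record 'a cstar_alg = "(complex, 'a) module" +
  adj :: "'a \<Rightarrow> 'a"
  nrm :: "'a \<Rightarrow> real"

text \<open>The value \<open>0\<close> off the carrier is only there because \<^locale>\<open>Metric_space\<close> asks for a total
  symmetric nonnegative function.\<close>

definition cstar_dist :: "('a, 'm) cstar_alg_scheme \<Rightarrow> 'a \<Rightarrow> 'a \<Rightarrow> real" where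
  "cstar_dist A x y =
     (if x \<in> carrier A \<and> y \<in> carrier A then nrm A (x \<ominus>\<^bsub>A\<^esub> y) else 0)"

locale unital_cstar_algebra = Module.module complex_ring A + ring A
  for A :: "('a, 'm) cstar_alg_scheme" (structure) +
  assumes smult_mult_left:
      "\<lbrakk>x \<in> carrier A; y \<in> carrier A\<rbrakk> \<Longrightarrow> (c \<odot> x) \<otimes> y = c \<odot> (x \<otimes> y)"
    and smult_mult_right:
      "\<lbrakk>x \<in> carrier A; y \<in> carrier A\<rbrakk> \<Longrightarrow> x \<otimes> (c \<odot> y) = c \<odot> (x \<otimes> y)"
    and adj_closed: "x \<in> carrier A \<Longrightarrow> adj A x \<in> carrier A"
    and adj_adj: "x \<in> carrier A \<Longrightarrow> adj A (adj A x) = x"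
    and adj_add:
      "\<lbrakk>x \<in> carrier A; y \<in> carrier A\<rbrakk> \<Longrightarrow> adj A (x \<oplus> y) = adj A x \<oplus> adj A y"
    and adj_smult: "x \<in> carrier A \<Longrightarrow> adj A (c \<odot> x) = cnj c \<odot> adj A x"
    and adj_mult:
      "\<lbrakk>x \<in> carrier A; y \<in> carrier A\<rbrakk> \<Longrightarrow> adj A (x \<otimes> y) = adj A y \<otimes> adj A x"
    and nrm_nonneg: "x \<in> carrier A \<Longrightarrow> 0 \<le> nrm A x"
    and nrm_eq_0: "x \<in> carrier A \<Longrightarrow> nrm A x = 0 \<longleftrightarrow> x = \<zero>"
    and nrm_add:
      "\<lbrakk>x \<in> carrier A; y \<in> carrier A\<rbrakk> \<Longrightarrow> nrm A (x \<oplus> y) \<le> nrm A x + nrm A y"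
    and nrm_smult: "x \<in> carrier A \<Longrightarrow> nrm A (c \<odot> x) = cmod c * nrm A x"
    and nrm_mult:
      "\<lbrakk>x \<in> carrier A; y \<in> carrier A\<rbrakk> \<Longrightarrow> nrm A (x \<otimes> y) \<le> nrm A x * nrm A y"
    and nrm_adj_mult: "x \<in> carrier A \<Longrightarrow> nrm A (adj A x \<otimes> x) = (nrm A x)\<^sup>2"
    and complete: "Metric_space.mcomplete (carrier A) (cstar_dist A)"

definition cstar_topology :: "('a, 'm) cstar_alg_scheme \<Rightarrow> 'a topology" where
  "cstar_topology A = Metric_space.mtopology (carrier A) (cstar_dist A)"

definition cstar_hom ::
    "('a, 'm) cstar_alg_scheme \<Rightarrow> ('b, 'n) cstar_alg_scheme \<Rightarrow> ('a \<Rightarrow> 'b) set" where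
  "cstar_hom A B = {h \<in> ring_hom A B.
     (\<forall>c. \<forall>x \<in> carrier A. h (c \<odot>\<^bsub>A\<^esub> x) = c \<odot>\<^bsub>B\<^esub> h x) \<and>
     (\<forall>x \<in> carrier A. h (adj A x) = adj B (h x))}"

definition cstar_sum ::
    "('b, 'm) cstar_alg_scheme \<Rightarrow> ('c, 'n) cstar_alg_scheme \<Rightarrow> ('b \<times> 'c) cstar_alg" where
  "cstar_sum B C =
     \<lparr>carrier = carrier B \<times> carrier C,
      monoid.mult = (\<lambda>(b, c) (b', c'). (b \<otimes>\<^bsub>B\<^esub> b', c \<otimes>\<^bsub>C\<^esub> c')),
      one = (\<one>\<^bsub>B\<^esub>, \<one>\<^bsub>C\<^esub>),
      ring.zero = (\<zero>\<^bsub>B\<^esub>, \<zero>\<^bsub>C\<^esub>),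
      add = (\<lambda>(b, c) (b', c'). (b \<oplus>\<^bsub>B\<^esub> b', c \<oplus>\<^bsub>C\<^esub> c')),
      smult = (\<lambda>s (b, c). (s \<odot>\<^bsub>B\<^esub> b, s \<odot>\<^bsub>C\<^esub> c)),
      adj = (\<lambda>(b, c). (adj B b, adj C c)),
      nrm = (\<lambda>(b, c). max (nrm B b) (nrm C c))\<rparr>"

definition cstar_pullback ::
    "('b, 'm) cstar_alg_scheme \<Rightarrow> ('c, 'n) cstar_alg_scheme \<Rightarrow>
     ('b \<Rightarrow> 'd) \<Rightarrow> ('c \<Rightarrow> 'd) \<Rightarrow> ('b \<times> 'c) cstar_alg" where
  "cstar_pullback B C \<delta> \<gamma> =
     (cstar_sum B C)\<lparr>carrier := {(b, c) \<in> carrier B \<times> carrier C. \<delta> b = \<gamma> c}\<rparr>"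


section \<open>The tensor product of \<open>C(\<T>)\<close> with a C*-algebra\<close>

text \<open>An elementary tensor \<open>f \<otimes> d\<close> acts as the function \<open>z \<mapsto> f(z) d\<close> on the circle. Representing
  \<open>C(\<T>)\<close> by multiplication operators on \<open>\<ell>\<^sup>2(\<T>)\<close> and \<open>D\<close> faithfully on a Hilbert space \<open>H\<close>, the
  spatial norm of a sum of elementary tensors on \<open>\<ell>\<^sup>2(\<T>) \<otimes> H\<close> (the direct sum of copies of \<open>H\<close>
  indexed by \<open>\<T>\<close>) is the supremum norm of the corresponding function; it is the only C*-norm
  because \<open>C(\<T>)\<close> is nuclear. So the tensor product is the closure in the supremum norm of the
  functions \<open>\<Sum>\<^sub>i f\<^sub>i \<otimes> d\<^sub>i\<close>. Functions are extensional, i.e. \<open>undefined\<close> off the circle.\<close>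

abbreviation circle :: "complex set" where
  "circle \<equiv> sphere 0 1"

definition circle_tensors :: "('d, 'm) cstar_alg_scheme \<Rightarrow> (complex \<Rightarrow> 'd) set" where
  "circle_tensors D =
     {(\<lambda>z\<in>circle. \<Oplus>\<^bsub>D\<^esub>i\<in>{..<n}. f i z \<odot>\<^bsub>D\<^esub> d i) | (n::nat) f d.
        (\<forall>i<n. continuous_on circle (f i :: complex \<Rightarrow> complex)) \<and> d \<in> {..<n} \<rightarrow> carrier D}"

definition circle_tensor :: "('d, 'm) cstar_alg_scheme \<Rightarrow> (complex \<Rightarrow> 'd) cstar_alg" where
  "circle_tensor D =
     \<lparr>carrier = {g \<in> circle \<rightarrow>\<^sub>E carrier D.
        \<forall>\<epsilon>>0. \<exists>h \<in> circle_tensors D. \<forall>z\<in>circle. nrm D (g z \<ominus>\<^bsub>D\<^esub> h z) < \<epsilon>},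
      monoid.mult = (\<lambda>g h. \<lambda>z\<in>circle. g z \<otimes>\<^bsub>D\<^esub> h z),
      one = (\<lambda>z\<in>circle. \<one>\<^bsub>D\<^esub>),
      ring.zero = (\<lambda>z\<in>circle. \<zero>\<^bsub>D\<^esub>),
      add = (\<lambda>g h. \<lambda>z\<in>circle. g z \<oplus>\<^bsub>D\<^esub> h z),
      smult = (\<lambda>c g. \<lambda>z\<in>circle. c \<odot>\<^bsub>D\<^esub> g z),
      adj = (\<lambda>g. \<lambda>z\<in>circle. adj D (g z)),
      nrm = (\<lambda>g. SUP z\<in>circle. nrm D (g z))\<rparr>"


section \<open>Unimodular vectors and invertible matrices\<close>

text \<open>Vectors of length \<open>n\<close> are extensional functions on \<open>{..<n}\<close>, and \<open>n \<times> n\<close> matrices are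
  extensional functions on \<open>{..<n} \<times> {..<n}\<close>. The C*-norm topology of \<open>M\<^sub>n(A)\<close> is the topology of
  entrywise convergence.\<close>

definition lin_comb :: "('a, 'm) cstar_alg_scheme \<Rightarrow> nat \<Rightarrow> (nat \<Rightarrow> 'a) \<Rightarrow> (nat \<Rightarrow> 'a) \<Rightarrow> 'a" where
  "lin_comb A n b a = (\<Oplus>\<^bsub>A\<^esub>i\<in>{..<n}. b i \<otimes>\<^bsub>A\<^esub> a i)"

definition Lg :: "('a, 'm) cstar_alg_scheme \<Rightarrow> nat \<Rightarrow> (nat \<Rightarrow> 'a) set" where
  "Lg A n = {a \<in> {..<n} \<rightarrow>\<^sub>E carrier A.
     {lin_comb A n b a | b. b \<in> {..<n} \<rightarrow>\<^sub>E carrier A} = carrier A}"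

definition mat_monoid :: "('a, 'm) cstar_alg_scheme \<Rightarrow> nat \<Rightarrow> (nat \<times> nat \<Rightarrow> 'a) monoid" where
  "mat_monoid A n =
     \<lparr>carrier = {..<n} \<times> {..<n} \<rightarrow>\<^sub>E carrier A,
      monoid.mult = (\<lambda>x y. \<lambda>(i, j)\<in>{..<n} \<times> {..<n}. lin_comb A n (\<lambda>k. x (i, k)) (\<lambda>k. y (k, j))),
      one = (\<lambda>(i, j)\<in>{..<n} \<times> {..<n}. if i = j then \<one>\<^bsub>A\<^esub> else \<zero>\<^bsub>A\<^esub>)\<rparr>"

definition GL :: "('a, 'm) cstar_alg_scheme \<Rightarrow> nat \<Rightarrow> (nat \<times> nat \<Rightarrow> 'a) set" where
  "GL A n = Units (mat_monoid A n)"

definition GL_topology :: "('a, 'm) cstar_alg_scheme \<Rightarrow> nat \<Rightarrow> (nat \<times> nat \<Rightarrow> 'a) topology" where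
  "GL_topology A n =
     subtopology (product_topology (\<lambda>_. cstar_topology A) ({..<n} \<times> {..<n})) (GL A n)"

definition GL0 :: "('a, 'm) cstar_alg_scheme \<Rightarrow> nat \<Rightarrow> (nat \<times> nat \<Rightarrow> 'a) set" where
  "GL0 A n = connected_component_of_set (GL_topology A n) \<one>\<^bsub>mat_monoid A n\<^esub>"

definition mat_vec ::
    "('a, 'm) cstar_alg_scheme \<Rightarrow> nat \<Rightarrow> (nat \<times> nat \<Rightarrow> 'a) \<Rightarrow> (nat \<Rightarrow> 'a) \<Rightarrow> nat \<Rightarrow> 'a" where
  "mat_vec A n g v = (\<lambda>i\<in>{..<n}. lin_comb A n (\<lambda>k. g (i, k)) v)"


section \<open>Stable ranks\<close>

definition transitive_on_Lg ::
    "('a, 'm) cstar_alg_scheme \<Rightarrow> nat \<Rightarrow> (nat \<times> nat \<Rightarrow> 'a) set \<Rightarrow> bool" where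
  "transitive_on_Lg A m H \<longleftrightarrow> (\<forall>v \<in> Lg A m. \<forall>w \<in> Lg A m. \<exists>g \<in> H. mat_vec A m g v = w)"

text \<open>The infimum of the empty set is \<open>\<infinity>\<close> in \<^typ>\<open>enat\<close>.\<close>

definition gsr :: "('a, 'm) cstar_alg_scheme \<Rightarrow> enat" where
  "gsr A = Inf {enat n | n. n \<ge> 1 \<and> (\<forall>m\<ge>n. transitive_on_Lg A m (GL A m))}"

definition csr :: "('a, 'm) cstar_alg_scheme \<Rightarrow> enat" where
  "csr A = Inf {enat n | n. n \<ge> 1 \<and> (\<forall>m\<ge>n. transitive_on_Lg A m (GL0 A m))}"


section \<open>The group \<open>K\<^sub>1\<close>\<close>

text \<open>\<open>K\<^sub>1(A) = GL\<^sub>\<infinity>(A) / GL\<^sub>\<infinity>\<^sup>0(A)\<close>, where \<open>GL\<^sub>\<infinity>(A)\<close> is the union of the groups \<open>GL\<^sub>n(A)\<close> along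
  \<open>x \<mapsto> diag(x, 1)\<close>, realised by infinite matrices that agree with the identity matrix outside
  a finite block. The index set of the sum in the product is finite for such matrices.\<close>

definition stabilize :: "('a, 'm) cstar_alg_scheme \<Rightarrow> nat \<Rightarrow> (nat \<times> nat \<Rightarrow> 'a) \<Rightarrow> nat \<times> nat \<Rightarrow> 'a" where
  "stabilize A n x = (\<lambda>(i, j). if i < n \<and> j < n then x (i, j)
     else if i = j then \<one>\<^bsub>A\<^esub> else \<zero>\<^bsub>A\<^esub>)"

definition GL_inf :: "('a, 'm) cstar_alg_scheme \<Rightarrow> (nat \<times> nat \<Rightarrow> 'a) monoid" where
  "GL_inf A =
     \<lparr>carrier = (\<Union>n\<in>{1..}. stabilize A n ` GL A n),
      monoid.mult = (\<lambda>x y (i, j). \<Oplus>\<^bsub>A\<^esub>k\<in>{k. x (i, k) \<noteq> \<zero>\<^bsub>A\<^esub>}. x (i, k) \<otimes>\<^bsub>A\<^esub> y (k, j)),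
      one = (\<lambda>(i, j). if i = j then \<one>\<^bsub>A\<^esub> else \<zero>\<^bsub>A\<^esub>)\<rparr>"

definition GL_inf0 :: "('a, 'm) cstar_alg_scheme \<Rightarrow> (nat \<times> nat \<Rightarrow> 'a) set" where
  "GL_inf0 A = (\<Union>n\<in>{1..}. stabilize A n ` GL0 A n)"

definition K1 :: "('a, 'm) cstar_alg_scheme \<Rightarrow> (nat \<times> nat \<Rightarrow> 'a) set monoid" where
  "K1 A = GL_inf A Mod GL_inf0 A"


section \<open>\<open>C(\<T>) \<otimes> D\<close> is the C*-algebra of continuous functions from the circle to \<open>D\<close>\<close>

text \<open>The facts \<open>carrier_circle_tensor\<close> and \<open>unital_cstar_algebra_circle_tensor\<close> below justify the
  definition of \<^const>\<open>circle_tensor\<close>.\<close>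

lemma complex_ring_simps [simp]:
  "carrier complex_ring = UNIV" "x \<otimes>\<^bsub>complex_ring\<^esub> y = x * y" "x \<oplus>\<^bsub>complex_ring\<^esub> y = x + y"
  "\<one>\<^bsub>complex_ring\<^esub> = 1" "\<zero>\<^bsub>complex_ring\<^esub> = 0"
  by (simp_all add: complex_ring_def)

lemma cring_complex_ring: "cring complex_ring"
proof (rule cringI)
  show "abelian_group complex_ring"
    by (rule abelian_groupI) (auto simp: algebra_simps intro: exI[of _ "- _"])
  show "comm_monoid complex_ring"
    by (rule comm_monoidI) (auto simp: algebra_simps)
qed (auto simp: algebra_simps)

interpretation complex_ring: cring complex_ring by (rule cring_complex_ring)

lemma complex_ring_minus [simp]: "\<ominus>\<^bsub>complex_ring\<^esub> x = - x"
  by (rule complex_ring.minus_equality) simp_all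

context unital_cstar_algebra
begin

lemma smult_1 [simp]: "x \<in> carrier A \<Longrightarrow> 1 \<odot> x = x"
  using smult_one[of x] by simp

lemma smult_add_left: "x \<in> carrier A \<Longrightarrow> (c + d) \<odot> x = c \<odot> x \<oplus> d \<odot> x"
  using smult_l_distr[of c d x] by simp

lemma smult_smult: "x \<in> carrier A \<Longrightarrow> (c * d) \<odot> x = c \<odot> (d \<odot> x)"
  using smult_assoc1[of c d x] by simp

lemma smult_minus_right:
  "\<lbrakk>x \<in> carrier A; y \<in> carrier A\<rbrakk> \<Longrightarrow> c \<odot> (x \<ominus> y) = c \<odot> x \<ominus> c \<odot> y"
  using smult_r_distr[of c x "\<ominus> y"] smult_r_minus[of c y] by (simp add: a_minus_def)

lemma smult_minus_left: "x \<in> carrier A \<Longrightarrow> (c - d) \<odot> x = c \<odot> x \<ominus> d \<odot> x"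
  using smult_add_left[of x c "-d"] smult_l_minus[of d x] by (simp add: a_minus_def)

lemma smult_m1: "x \<in> carrier A \<Longrightarrow> (-1) \<odot> x = \<ominus> x"
  using smult_l_minus[of 1 x] by simp

lemma nrm_uminus: assumes "x \<in> carrier A" shows "nrm A (\<ominus> x) = nrm A x"
  using nrm_smult[of x "-1"] assms by (simp add: smult_m1)

lemma nrm_zero [simp]: "nrm A \<zero> = 0"
  using nrm_eq_0[of \<zero>] by simp

lemma nrm_minus_commute:
  assumes "x \<in> carrier A" "y \<in> carrier A" shows "nrm A (x \<ominus> y) = nrm A (y \<ominus> x)"
proof -
  have "\<ominus> (x \<ominus> y) = \<ominus> x \<oplus> \<ominus> (\<ominus> y)"
    unfolding a_minus_def using assms by (intro minus_add) auto
  then have "\<ominus> (x \<ominus> y) = y \<ominus> x"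
    using assms a_comm[of "\<ominus> x" y] by (simp add: a_minus_def)
  then show ?thesis using nrm_uminus[of "x \<ominus> y"] assms by simp
qed

lemma nrm_minus_triangle:
  assumes "x \<in> carrier A" "y \<in> carrier A" "z \<in> carrier A"
  shows "nrm A (x \<ominus> z) \<le> nrm A (x \<ominus> y) + nrm A (y \<ominus> z)"
proof -
  have "x \<ominus> z = (x \<ominus> y) \<oplus> (y \<ominus> z)"
    using assms by (simp add: a_minus_def a_assoc r_neg1)
  then show ?thesis using nrm_add assms by simp
qed

lemma nrm_minus_eq_0:
  assumes "x \<in> carrier A" "y \<in> carrier A" shows "nrm A (x \<ominus> y) = 0 \<longleftrightarrow> x = y"
  using assms nrm_eq_0[of "x \<ominus> y"] by (simp add: r_right_minus_eq)

sublocale metric: Metric_space "carrier A" "cstar_dist A"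
  by unfold_locales
    (auto simp: cstar_dist_def nrm_nonneg nrm_minus_eq_0 intro: nrm_minus_commute nrm_minus_triangle)


lemma nrm_diff_triangle:
  assumes "x \<in> carrier A" "y \<in> carrier A"
  shows "\<bar>nrm A x - nrm A y\<bar> \<le> nrm A (x \<ominus> y)"
proof -
  have z: "x \<ominus> \<zero> = x" "y \<ominus> \<zero> = y" using assms by (simp_all add: a_minus_def)
  show ?thesis
    using nrm_minus_triangle[of x y \<zero>] nrm_minus_triangle[of y x \<zero>]
      nrm_minus_commute[of x y] assms by (simp add: z)
qed

lemma nrm_add_diff:
  assumes "x \<in> carrier A" "y \<in> carrier A" "x' \<in> carrier A" "y' \<in> carrier A"
  shows "nrm A ((x \<oplus> y) \<ominus> (x' \<oplus> y')) \<le> nrm A (x \<ominus> x') + nrm A (y \<ominus> y')"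
proof -
  have "(x \<oplus> y) \<ominus> (x' \<oplus> y') = (x \<ominus> x') \<oplus> (y \<ominus> y')"
    using assms by (simp add: a_minus_def minus_add a_ac)
  then show ?thesis using nrm_add assms by simp
qed

lemma nrm_mult_diff:
  assumes "x \<in> carrier A" "y \<in> carrier A" "x' \<in> carrier A" "y' \<in> carrier A"
  shows "nrm A ((x \<otimes> y) \<ominus> (x' \<otimes> y'))
    \<le> nrm A (x \<ominus> x') * (nrm A (y \<ominus> y') + nrm A y') + nrm A x' * nrm A (y \<ominus> y')"
proof -
  have "nrm A ((x \<otimes> y) \<ominus> (x' \<otimes> y')) \<le> nrm A ((x \<otimes> y) \<ominus> (x' \<otimes> y)) + nrm A ((x' \<otimes> y) \<ominus> (x' \<otimes> y'))"
    by (rule nrm_minus_triangle) (use assms in auto)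
  moreover have "(x \<otimes> y) \<ominus> (x' \<otimes> y) = (x \<ominus> x') \<otimes> y"
    using assms by (simp add: a_minus_def l_distr l_minus)
  moreover have "(x' \<otimes> y) \<ominus> (x' \<otimes> y') = x' \<otimes> (y \<ominus> y')"
    using assms by (simp add: a_minus_def r_distr r_minus)
  moreover have "nrm A y \<le> nrm A (y \<ominus> y') + nrm A y'"
    using nrm_diff_triangle[of y y'] assms by simp
  moreover have "nrm A ((x \<ominus> x') \<otimes> y) \<le> nrm A (x \<ominus> x') * nrm A y"
    by (rule nrm_mult) (use assms in auto)
  moreover have "nrm A (x' \<otimes> (y \<ominus> y')) \<le> nrm A x' * nrm A (y \<ominus> y')"
    by (rule nrm_mult) (use assms in auto)
  moreover have "nrm A (x \<ominus> x') * nrm A y \<le> nrm A (x \<ominus> x') * (nrm A (y \<ominus> y') + nrm A y')"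
    by (rule mult_left_mono) (use calculation(4) nrm_nonneg assms in auto)
  ultimately show ?thesis by simp
qed

lemma nrm_adj: assumes "x \<in> carrier A" shows "nrm A (adj A x) = nrm A x"
proof -
  have *: "nrm A y \<le> nrm A (adj A y)" if y: "y \<in> carrier A" for y
  proof (cases "nrm A y = 0")
    case True then show ?thesis using nrm_nonneg adj_closed y by simp
  next
    case False
    have "nrm A y * nrm A y \<le> nrm A (adj A y) * nrm A y"
      using nrm_adj_mult[OF y] nrm_mult[of "adj A y" y] adj_closed y by (simp add: power2_eq_square)
    moreover have "nrm A y > 0" using False nrm_nonneg[OF y] by simp
    ultimately show ?thesis by simp
  qed
  show ?thesis using *[OF assms] *[of "adj A x"] adj_adj adj_closed assms by auto
qed

lemma adj_uminus: assumes "x \<in> carrier A" shows "adj A (\<ominus> x) = \<ominus> adj A x"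
proof -
  show ?thesis using adj_smult[of x "-1"] assms adj_closed by (simp add: smult_m1)
qed

lemma nrm_adj_diff:
  assumes "x \<in> carrier A" "y \<in> carrier A"
  shows "nrm A (adj A x \<ominus> adj A y) = nrm A (x \<ominus> y)"
proof -
  have "adj A x \<ominus> adj A y = adj A (x \<ominus> y)"
    using assms by (simp add: a_minus_def adj_add adj_uminus)
  then show ?thesis using nrm_adj assms by simp
qed

lemma nrm_finsum:
  assumes "finite I" "x \<in> I \<rightarrow> carrier A"
  shows "nrm A (\<Oplus>i\<in>I. x i) \<le> (\<Sum>i\<in>I. nrm A (x i))"
  using assms
proof (induction I)
  case (insert i I)
  then have "nrm A (x i \<oplus> (\<Oplus>i\<in>I. x i)) \<le> nrm A (x i) + nrm A (\<Oplus>i\<in>I. x i)"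
    by (intro nrm_add finsum_closed) auto
  with insert show ?case by (subst finsum_insert) auto
qed simp

lemma smult_sum_left:
  assumes "finite I" "x \<in> carrier A"
  shows "(\<Sum>i\<in>I. c i) \<odot> x = (\<Oplus>i\<in>I. c i \<odot> x)"
  using assms(1)
proof (induction I)
  case empty
  then show ?case using smult_l_null[OF assms(2)] by simp
next
  case (insert i I)
  then show ?case using assms(2) by (subst finsum_insert) (auto simp: smult_add_left)
qed

lemma nrm_finsum_diff:
  assumes "finite I" "x \<in> I \<rightarrow> carrier A" "y \<in> I \<rightarrow> carrier A"
  shows "nrm A ((\<Oplus>i\<in>I. x i) \<ominus> (\<Oplus>i\<in>I. y i)) \<le> (\<Sum>i\<in>I. nrm A (x i \<ominus> y i))"
  using assms
proof (induction I)
  case empty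
  then show ?case by (simp add: a_minus_def)
next
  case (insert i I)
  have "nrm A ((x i \<oplus> (\<Oplus>i\<in>I. x i)) \<ominus> (y i \<oplus> (\<Oplus>i\<in>I. y i)))
     \<le> nrm A (x i \<ominus> y i) + nrm A ((\<Oplus>i\<in>I. x i) \<ominus> (\<Oplus>i\<in>I. y i))"
    using insert.prems by (intro nrm_add_diff finsum_closed) auto
  with insert show ?case by (subst (1 2) finsum_insert) auto
qed

text \<open>Continuous functions from the circle to the algebra, in metric terms.\<close>

definition ccont :: "(complex \<Rightarrow> 'a) \<Rightarrow> bool" where
  "ccont g \<longleftrightarrow> g \<in> circle \<rightarrow>\<^sub>E carrier A \<and>
     (\<forall>z\<in>circle. ((\<lambda>w. nrm A (g w \<ominus> g z)) \<longlongrightarrow> 0) (at z within circle))"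

lemma ccontD: "ccont g \<Longrightarrow> z \<in> circle \<Longrightarrow> g z \<in> carrier A"
  by (auto simp: ccont_def)

lemma ccontI:
  assumes "g \<in> circle \<rightarrow>\<^sub>E carrier A"
    and "\<And>z. z \<in> circle \<Longrightarrow> (f z \<longlongrightarrow> 0) (at z within circle)"
    and "\<And>z w. \<lbrakk>z \<in> circle; w \<in> circle\<rbrakk> \<Longrightarrow> nrm A (g w \<ominus> g z) \<le> f z w"
  shows "ccont g"
  unfolding ccont_def
proof (intro conjI assms(1) ballI)
  fix z assume z: "z \<in> circle"
  show "((\<lambda>w. nrm A (g w \<ominus> g z)) \<longlongrightarrow> 0) (at z within circle)"
  proof (rule Lim_null_comparison[OF _ assms(2)[OF z]])
    show "\<forall>\<^sub>F w in at z within circle. norm (nrm A (g w \<ominus> g z)) \<le> f z w"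
      using assms(1,3) z
      by (auto simp: eventually_at_filter PiE_iff nrm_nonneg intro!: always_eventually)
  qed
qed

lemma ccont_lim: "ccont g \<Longrightarrow> z \<in> circle \<Longrightarrow> ((\<lambda>w. nrm A (g w \<ominus> g z)) \<longlongrightarrow> 0) (at z within circle)"
  by (simp add: ccont_def)

lemma ccont_uniform_limit:
  assumes g: "g \<in> circle \<rightarrow>\<^sub>E carrier A"
    and "\<And>e. e > 0 \<Longrightarrow> \<exists>h. ccont h \<and> (\<forall>z\<in>circle. nrm A (g z \<ominus> h z) < e)"
  shows "ccont g"
  unfolding ccont_def
proof (intro conjI assms(1) ballI tendstoI)
  fix z :: complex and e :: real assume z: "z \<in> circle" and "e > 0"
  obtain h where h: "ccont h" "\<And>z. z \<in> circle \<Longrightarrow> nrm A (g z \<ominus> h z) < e/3"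
    using assms(2)[of "e/3"] \<open>e > 0\<close> by auto
  have "\<forall>\<^sub>F w in at z within circle. nrm A (h w \<ominus> h z) < e/3"
    using order_tendstoD(2)[OF ccont_lim[OF h(1) z], of "e/3"] \<open>e > 0\<close> by simp
  moreover have "\<forall>\<^sub>F w in at z within circle. w \<in> circle"
    by (simp add: eventually_at_filter)
  ultimately show "\<forall>\<^sub>F w in at z within circle. dist (nrm A (g w \<ominus> g z)) 0 < e"
  proof eventually_elim
    case (elim w)
    have c: "g w \<in> carrier A" "g z \<in> carrier A" "h w \<in> carrier A" "h z \<in> carrier A"
      using g z elim ccontD[OF h(1)] by auto
    have "nrm A (g w \<ominus> g z) \<le> nrm A (g w \<ominus> h w) + (nrm A (h w \<ominus> h z) + nrm A (h z \<ominus> g z))"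
      using nrm_minus_triangle[of "g w" "h w" "g z"] nrm_minus_triangle[of "h w" "h z" "g z"] c by simp
    moreover have "nrm A (h z \<ominus> g z) < e/3" using h(2)[OF z] nrm_minus_commute c by simp
    moreover note elim h(2)[OF elim(2)] nrm_nonneg[of "g w \<ominus> g z"] c
    ultimately show ?case by simp
  qed
qed

lemma ccont_tensors: assumes "h \<in> circle_tensors A" shows "ccont h"
proof -
  obtain n :: nat and f d where h: "h = (\<lambda>z\<in>circle. \<Oplus>i\<in>{..<n}. f i z \<odot> d i)"
    and f: "\<And>i. i < n \<Longrightarrow> continuous_on circle (f i)" and d: "d \<in> {..<n} \<rightarrow> carrier A"
    using assms by (auto simp: circle_tensors_def)
  have dc: "f i z \<odot> d i \<in> carrier A" if "i < n" for i z using d that by auto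
  have d': "d i \<in> carrier A" if "i < n" for i using d that by auto
  show ?thesis
  proof (rule ccontI)
    show "h \<in> circle \<rightarrow>\<^sub>E carrier A" using dc by (auto simp: h intro!: finsum_closed)
    show "((\<lambda>w. \<Sum>i<n. cmod (f i w - f i z) * nrm A (d i)) \<longlongrightarrow> 0) (at z within circle)"
      if "z \<in> circle" for z
    proof -
      have "((\<lambda>w. \<Sum>i<n. cmod (f i w - f i z) * nrm A (d i)) \<longlongrightarrow> (\<Sum>i<n. cmod (f i z - f i z) * nrm A (d i)))
         (at z within circle)"
        by (intro tendsto_intros) (use f that in \<open>auto simp: continuous_on_def\<close>)
      then show ?thesis by simp
    qed
    show "nrm A (h w \<ominus> h z) \<le> (\<Sum>i<n. cmod (f i w - f i z) * nrm A (d i))"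
      if "z \<in> circle" "w \<in> circle" for z w
    proof -
      have e: "h u = (\<Oplus>i\<in>{..<n}. f i u \<odot> d i)" if "u \<in> circle" for u
        unfolding h by (rule restrict_apply'[OF that])
      have "nrm A (h w \<ominus> h z) \<le> (\<Sum>i<n. nrm A (f i w \<odot> d i \<ominus> f i z \<odot> d i))"
        unfolding e[OF that(1)] e[OF that(2)] by (rule nrm_finsum_diff) (use dc in auto)
      also have "\<dots> = (\<Sum>i<n. cmod (f i w - f i z) * nrm A (d i))"
        by (intro sum.cong refl) (simp add: d' smult_minus_left[symmetric] nrm_smult)
      finally show ?thesis .
    qed
  qed
qed

lemma ccont_nrm_diff:
  assumes g: "ccont g" and a: "a \<in> carrier A"
  shows "continuous_on circle (\<lambda>w. nrm A (g w \<ominus> a))"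
  unfolding continuous_on_def
proof
  fix w :: complex assume w: "w \<in> circle"
  have gc: "g z \<in> carrier A" if "z \<in> circle" for z using ccontD[OF g that] .
  show "((\<lambda>w. nrm A (g w \<ominus> a)) \<longlongrightarrow> nrm A (g w \<ominus> a)) (at w within circle)"
  proof (rule LIM_zero_cancel, rule Lim_transform_bound[OF _ ccont_lim[OF g w]])
    have "\<bar>nrm A (g u \<ominus> a) - nrm A (g w \<ominus> a)\<bar> \<le> \<bar>nrm A (g u \<ominus> g w)\<bar>" if u: "u \<in> circle" for u
      using nrm_minus_triangle[OF gc[OF u] gc[OF w] a] nrm_minus_triangle[OF gc[OF w] gc[OF u] a]
        nrm_minus_commute[OF gc[OF u] gc[OF w]] by linarith
    then show "\<forall>\<^sub>F u in at w within circle.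
        norm (nrm A (g u \<ominus> a) - nrm A (g w \<ominus> a)) \<le> norm (nrm A (g u \<ominus> g w))"
      by (auto simp: eventually_at_filter intro!: always_eventually)
  qed
qed

lemma ccont_approx:
  assumes g: "ccont g" and e: "e > 0"
  shows "\<exists>h\<in>circle_tensors A. \<forall>z\<in>circle. nrm A (g z \<ominus> h z) < e"
proof -
  have gc: "g z \<in> carrier A" if "z \<in> circle" for z using ccontD[OF g that] .
  define q where "q z w = max 0 (e/2 - nrm A (g w \<ominus> g z))" for z w
  have q0: "0 \<le> q z w" for z w by (simp add: q_def)
  have qcont: "continuous_on circle (q z)" if "z \<in> circle" for z
    unfolding q_def by (intro continuous_intros ccont_nrm_diff[OF g gc[OF that]])
  have "\<exists>U. open U \<and> U \<inter> circle = q z -` {0<..} \<inter> circle" if "z \<in> circle" for z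
    using continuous_on_open_invariant[THEN iffD1, OF qcont[OF that]] by auto
  then obtain U where U: "\<And>z. z \<in> circle \<Longrightarrow> open (U z)"
      "\<And>z. z \<in> circle \<Longrightarrow> U z \<inter> circle = q z -` {0<..} \<inter> circle"
    by metis
  have zU: "z \<in> U z" if "z \<in> circle" for z
  proof -
    have "q z z > 0" using e nrm_minus_eq_0[OF gc[OF that] gc[OF that]] by (simp add: q_def)
    then show ?thesis using U(2)[OF that] that by blast
  qed
  have "compact circle" by simp
  then obtain Z where Z: "Z \<subseteq> circle" "finite Z" "circle \<subseteq> (\<Union>z\<in>Z. U z)"
    using compactE_image[of circle circle U] U(1) zU by (metis UN_I subsetI)
  obtain zs :: "nat \<Rightarrow> complex" and n where zs: "Z = zs ` {i. i < n}"
    using finite_imp_nat_seg_image_inj_on[OF Z(2)] by blast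
  then have zc: "zs i \<in> circle" if "i < n" for i using that Z(1) by auto
  define s where "s w = (\<Sum>i<n. q (zs i) w)" for w
  have spos: "s w > 0" if w: "w \<in> circle" for w
  proof -
    obtain i where i: "i < n" "w \<in> U (zs i)" using Z(3) w zs by auto
    then have "q (zs i) w > 0" using U(2)[OF zc[OF i(1)]] w by blast
    then show ?thesis unfolding s_def using i q0 by (intro sum_pos2[of _ i]) auto
  qed
  define r where "r i w = q (zs i) w / s w" for i w
  have rsum: "(\<Sum>i<n. r i w) = 1" if "w \<in> circle" for w
    using spos[OF that] by (simp add: r_def sum_divide_distrib[symmetric]) (simp add: s_def)
  have r0: "0 \<le> r i w" if "w \<in> circle" for i w
    using spos[OF that] q0 by (simp add: r_def)
  have rcont: "continuous_on circle (\<lambda>w. complex_of_real (r i w))" if "i < n" for i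
    unfolding r_def s_def using spos that zc
    by (intro continuous_intros qcont) (auto simp: s_def less_le)
  define h where "h = (\<lambda>w\<in>circle. \<Oplus>i\<in>{..<n}. complex_of_real (r i w) \<odot> g (zs i))"
  have "h \<in> circle_tensors A"
    unfolding circle_tensors_def h_def using rcont zc gc
    by (intro CollectI exI[of _ n] exI[of _ "\<lambda>i w. complex_of_real (r i w)"] exI[of _ "\<lambda>i. g (zs i)"]) auto
  moreover have "nrm A (g w \<ominus> h w) < e" if w: "w \<in> circle" for w
  proof -
    have "g w = (\<Sum>i<n. complex_of_real (r i w)) \<odot> g w"
      using rsum[OF w] gc[OF w] by (simp flip: of_real_sum)
    also have "\<dots> = (\<Oplus>i\<in>{..<n}. complex_of_real (r i w) \<odot> g w)"
      using gc[OF w] by (intro smult_sum_left) auto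
    finally have "nrm A (g w \<ominus> h w) = nrm A ((\<Oplus>i\<in>{..<n}. complex_of_real (r i w) \<odot> g w) \<ominus>
        (\<Oplus>i\<in>{..<n}. complex_of_real (r i w) \<odot> g (zs i)))"
      using w by (simp add: h_def)
    also have "\<dots> \<le> (\<Sum>i<n. nrm A (complex_of_real (r i w) \<odot> g w \<ominus> complex_of_real (r i w) \<odot> g (zs i)))"
      using gc w zc by (intro nrm_finsum_diff) auto
    also have "\<dots> \<le> (\<Sum>i<n. r i w * (e/2))"
    proof (rule sum_mono)
      fix i assume "i \<in> {..<n}"
      then have i: "g (zs i) \<in> carrier A" using zc gc by auto
      have "nrm A (complex_of_real (r i w) \<odot> g w \<ominus> complex_of_real (r i w) \<odot> g (zs i))
          = r i w * nrm A (g w \<ominus> g (zs i))"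
        using i gc[OF w] r0[OF w] by (simp flip: smult_minus_right add: nrm_smult)
      also have "\<dots> \<le> r i w * (e/2)"
      proof (cases "r i w = 0")
        case False
        then have "q (zs i) w \<noteq> 0" by (auto simp: r_def)
        then have "nrm A (g w \<ominus> g (zs i)) \<le> e/2" by (auto simp: q_def max_def split: if_splits)
        then show ?thesis using r0[OF w] by (intro mult_left_mono)
      qed simp
      finally show "nrm A (complex_of_real (r i w) \<odot> g w \<ominus> complex_of_real (r i w) \<odot> g (zs i)) \<le> r i w * (e/2)" .
    qed
    also have "\<dots> = e/2" using rsum[OF w] by (simp flip: sum_distrib_right sum_divide_distrib)
    finally show ?thesis using e by simp
  qed
  ultimately show ?thesis by blast
qed

lemma carrier_circle_tensor_ccont: "carrier (circle_tensor A) = {g. ccont g}"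
proof (intro equalityI subsetI)
  fix g assume "g \<in> carrier (circle_tensor A)"
  then have "ccont g"
    by (intro ccont_uniform_limit) (auto simp: circle_tensor_def dest: ccont_tensors simp del: mem_sphere_0, meson ccont_tensors)
  then show "g \<in> {g. ccont g}" by simp
next
  fix g assume "g \<in> {g. ccont g}"
  then show "g \<in> carrier (circle_tensor A)"
    using ccont_approx by (auto simp: circle_tensor_def ccont_def)
qed

lemma carrier_circle_tensor:
  "carrier (circle_tensor A) =
     {g \<in> extensional circle. continuous_map (top_of_set circle) (cstar_topology A) g}"
proof -
  have "ccont g \<longleftrightarrow> continuous_map (top_of_set circle) (cstar_topology A) g" if "g \<in> extensional circle" for g
  proof -
    have "continuous_map (top_of_set circle) (cstar_topology A) g \<longleftrightarrow>
        (\<forall>z\<in>circle. limitin metric.mtopology g (g z) (at z within circle))"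
    proof -
      have "atin_within euclidean z circle = at z within circle" for z :: complex
        by (auto simp: filter_eq_iff eventually_atin_within eventually_at_topological)
      then show ?thesis
        unfolding cstar_topology_def continuous_map_atin
        by (simp add: atin_subtopology_within del: mem_sphere_0)
    qed
    also have "\<dots> \<longleftrightarrow> (\<forall>z\<in>circle. g z \<in> carrier A \<and> (\<forall>e>0. \<forall>\<^sub>F w in at z within circle.
        g w \<in> carrier A \<and> cstar_dist A (g w) (g z) < e))"
      by (simp add: metric.limitin_metric)
    also have "\<dots> \<longleftrightarrow> ccont g"
    proof -
      have "(\<forall>e>0. \<forall>\<^sub>F w in at z within circle. g w \<in> carrier A \<and> cstar_dist A (g w) (g z) < e) \<longleftrightarrow>
          ((\<lambda>w. nrm A (g w \<ominus> g z)) \<longlongrightarrow> 0) (at z within circle)"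
        if "g \<in> circle \<rightarrow> carrier A" "z \<in> circle" for z
      proof -
        have "(\<forall>\<^sub>F w in at z within circle. g w \<in> carrier A \<and> cstar_dist A (g w) (g z) < e) \<longleftrightarrow>
            (\<forall>\<^sub>F w in at z within circle. dist (nrm A (g w \<ominus> g z)) 0 < e)" for e
        proof (rule eventually_cong)
          show "\<forall>\<^sub>F w in at z within circle. w \<in> circle" by (simp add: eventually_at_filter)
          show "(g w \<in> carrier A \<and> cstar_dist A (g w) (g z) < e) = (dist (nrm A (g w \<ominus> g z)) 0 < e)"
            if "w \<in> circle" for w
            using \<open>g \<in> circle \<rightarrow> carrier A\<close> \<open>z \<in> circle\<close> that
            by (auto simp: cstar_dist_def Pi_iff nrm_nonneg simp del: mem_sphere_0)
        qed
        then show ?thesis by (simp add: tendsto_iff)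
      qed
      then show ?thesis using \<open>g \<in> extensional circle\<close>
        by (auto simp: ccont_def PiE_def Pi_iff)
    qed
    finally show ?thesis by blast
  qed
  then have "ccont g \<longleftrightarrow> g \<in> extensional circle \<and> continuous_map (top_of_set circle) (cstar_topology A) g" for g
    by (metis ccont_def PiE_iff)
  then show ?thesis unfolding carrier_circle_tensor_ccont by blast
qed

lemma ccont_ops:
  assumes "ccont g" "ccont h"
  shows "ccont (\<lambda>z\<in>circle. g z \<oplus> h z)" "ccont (\<lambda>z\<in>circle. g z \<otimes> h z)"
    "ccont (\<lambda>z\<in>circle. c \<odot> g z)" "ccont (\<lambda>z\<in>circle. adj A (g z))"
proof -
  note c = ccontD[OF assms(1)] ccontD[OF assms(2)]
  note l = ccont_lim[OF assms(1)] ccont_lim[OF assms(2)]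
  show "ccont (\<lambda>z\<in>circle. g z \<oplus> h z)"
  proof (rule ccontI[where f = "\<lambda>z w. nrm A (g w \<ominus> g z) + nrm A (h w \<ominus> h z)"])
    show "((\<lambda>w. nrm A (g w \<ominus> g z) + nrm A (h w \<ominus> h z)) \<longlongrightarrow> 0) (at z within circle)" if "z \<in> circle" for z
      using tendsto_add[OF l(1)[OF that] l(2)[OF that]] by simp
  qed (use c in \<open>auto simp del: mem_sphere_0 intro: nrm_add_diff\<close>)
  show "ccont (\<lambda>z\<in>circle. g z \<otimes> h z)"
  proof (rule ccontI[where f = "\<lambda>z w. nrm A (g w \<ominus> g z) * (nrm A (h w \<ominus> h z) + nrm A (h z))
      + nrm A (g z) * nrm A (h w \<ominus> h z)"])
    show "((\<lambda>w. nrm A (g w \<ominus> g z) * (nrm A (h w \<ominus> h z) + nrm A (h z))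
      + nrm A (g z) * nrm A (h w \<ominus> h z)) \<longlongrightarrow> 0) (at z within circle)" if "z \<in> circle" for z
    proof -
      have "((\<lambda>w. nrm A (g w \<ominus> g z) * (nrm A (h w \<ominus> h z) + nrm A (h z))
        + nrm A (g z) * nrm A (h w \<ominus> h z)) \<longlongrightarrow> 0 * (0 + nrm A (h z)) + nrm A (g z) * 0) (at z within circle)"
        by (intro tendsto_add tendsto_mult tendsto_const l that)
      then show ?thesis by simp
    qed
  qed (use c in \<open>auto simp del: mem_sphere_0 intro: nrm_mult_diff\<close>)
  show "ccont (\<lambda>z\<in>circle. c \<odot> g z)"
  proof (rule ccontI[where f = "\<lambda>z w. cmod c * nrm A (g w \<ominus> g z)"])
    show "((\<lambda>w. cmod c * nrm A (g w \<ominus> g z)) \<longlongrightarrow> 0) (at z within circle)" if "z \<in> circle" for z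
      using tendsto_mult_right[OF l(1)[OF that], of "cmod c"] by (simp add: mult.commute)
  qed (use c in \<open>auto simp del: mem_sphere_0 simp: smult_minus_right[symmetric] nrm_smult\<close>)
  show "ccont (\<lambda>z\<in>circle. adj A (g z))"
    by (rule ccontI[where f = "\<lambda>z w. nrm A (g w \<ominus> g z)"])
      (use c l in \<open>auto simp del: mem_sphere_0 simp: nrm_adj_diff adj_closed\<close>)
qed

lemma ccont_const: "a \<in> carrier A \<Longrightarrow> ccont (\<lambda>z\<in>circle. a)"
  by (rule ccontI[where f = "\<lambda>z w. 0"]) (auto simp: nrm_minus_eq_0 intro: eq_refl)

lemma ccont_bdd:
  assumes "ccont g" shows "bdd_above ((\<lambda>z. nrm A (g z)) ` circle)"
proof -
  have "continuous_on circle (\<lambda>w. nrm A (g w \<ominus> \<zero>))" by (rule ccont_nrm_diff[OF assms]) simp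
  then have "compact ((\<lambda>w. nrm A (g w \<ominus> \<zero>)) ` circle)"
    by (intro compact_continuous_image) auto
  then have "bdd_above ((\<lambda>w. nrm A (g w \<ominus> \<zero>)) ` circle)"
    by (intro bounded_imp_bdd_above compact_imp_bounded)
  moreover have "(\<lambda>w. nrm A (g w \<ominus> \<zero>)) ` circle = (\<lambda>w. nrm A (g w)) ` circle"
    by (intro image_cong refl) (use ccontD[OF assms] in \<open>auto simp: a_minus_def simp del: mem_sphere_0\<close>)
  ultimately show ?thesis by simp
qed

abbreviation "CT \<equiv> circle_tensor A"

lemma CT_simps:
  "carrier CT = {g. ccont g}"
  "g \<otimes>\<^bsub>CT\<^esub> h = (\<lambda>z\<in>circle. g z \<otimes> h z)"
  "g \<oplus>\<^bsub>CT\<^esub> h = (\<lambda>z\<in>circle. g z \<oplus> h z)"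
  "\<one>\<^bsub>CT\<^esub> = (\<lambda>z\<in>circle. \<one>)" "\<zero>\<^bsub>CT\<^esub> = (\<lambda>z\<in>circle. \<zero>)"
  "c \<odot>\<^bsub>CT\<^esub> g = (\<lambda>z\<in>circle. c \<odot> g z)"
  "adj CT g = (\<lambda>z\<in>circle. adj A (g z))"
  "nrm CT g = (SUP z\<in>circle. nrm A (g z))"
  by (simp add: carrier_circle_tensor_ccont) (simp_all add: circle_tensor_def)

lemma ccont_ext: "ccont g \<Longrightarrow> ccont h \<Longrightarrow> (\<And>z. z \<in> circle \<Longrightarrow> g z = h z) \<Longrightarrow> g = h"
  by (auto simp: ccont_def PiE_def intro: extensionalityI)

lemma CT_closed:
  assumes "ccont g" "ccont h"
  shows "ccont (g \<otimes>\<^bsub>CT\<^esub> h)" "ccont (g \<oplus>\<^bsub>CT\<^esub> h)" "ccont (c \<odot>\<^bsub>CT\<^esub> g)" "ccont (adj CT g)"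
  unfolding CT_simps by (rule ccont_ops[OF assms])+

lemma CT_const_closed: "ccont \<one>\<^bsub>CT\<^esub>" "ccont \<zero>\<^bsub>CT\<^esub>"
  unfolding CT_simps by (rule ccont_const, simp)+

lemma CT_apply:
  assumes "z \<in> circle"
  shows "(g \<otimes>\<^bsub>CT\<^esub> h) z = g z \<otimes> h z" "(g \<oplus>\<^bsub>CT\<^esub> h) z = g z \<oplus> h z"
    "(c \<odot>\<^bsub>CT\<^esub> g) z = c \<odot> g z" "adj CT g z = adj A (g z)"
    "\<one>\<^bsub>CT\<^esub> z = \<one>" "\<zero>\<^bsub>CT\<^esub> z = \<zero>"
  unfolding CT_simps by (rule restrict_apply'[OF assms])+

lemma nrm_CT_le: "ccont g \<Longrightarrow> z \<in> circle \<Longrightarrow> nrm A (g z) \<le> nrm CT g"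
  unfolding CT_simps by (rule cSUP_upper[OF _ ccont_bdd])

lemma circle_ne: "(circle :: complex set) \<noteq> {}"
  by (auto intro!: exI[of _ 1])

lemma nrm_CT_leI: "(\<And>z. z \<in> circle \<Longrightarrow> nrm A (g z) \<le> r) \<Longrightarrow> nrm CT g \<le> r"
  unfolding CT_simps by (rule cSUP_least[OF circle_ne])

lemma ring_CT: "ring CT"
proof (rule ringI)
  show "abelian_group CT"
  proof (rule abelian_groupI)
    fix g assume "g \<in> carrier CT"
    then have g: "ccont g" by (simp add: CT_simps(1))
    have m: "(-1) \<odot> x \<oplus> x = \<zero>" if "x \<in> carrier A" for x
      using that by (simp add: smult_m1 l_neg)
    have "(-1) \<odot>\<^bsub>CT\<^esub> g \<oplus>\<^bsub>CT\<^esub> g = \<zero>\<^bsub>CT\<^esub>"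
      by (rule ccont_ext) (use g in \<open>simp_all add: CT_closed CT_const_closed CT_apply m ccontD del: mem_sphere_0\<close>)
    then show "\<exists>h\<in>carrier CT. h \<oplus>\<^bsub>CT\<^esub> g = \<zero>\<^bsub>CT\<^esub>"
      using CT_closed(3)[OF g g] by (auto simp: CT_simps(1))
  qed (auto simp: CT_simps(1) CT_closed CT_const_closed CT_apply ccontD a_ac simp del: mem_sphere_0
      intro!: ccont_ext)
  show "Group.monoid CT"
    by (rule monoidI; unfold CT_simps(1) mem_Collect_eq; (rule ccont_ext)?)
      (auto simp: CT_closed CT_const_closed CT_apply ccontD m_assoc simp del: mem_sphere_0)
qed (auto simp: CT_simps(1) CT_closed CT_apply ccontD l_distr r_distr simp del: mem_sphere_0
    intro!: ccont_ext)

lemma CT_minus: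
  assumes "ccont g" "ccont h" "z \<in> circle"
  shows "(g \<ominus>\<^bsub>CT\<^esub> h) z = g z \<ominus> h z"
proof -
  interpret CT: ring CT by (rule ring_CT)
  have c: "g \<in> carrier CT" "h \<in> carrier CT" using assms by (simp_all add: CT_simps)
  then have "ccont (g \<ominus>\<^bsub>CT\<^esub> h)" using CT.minus_closed by (auto simp: CT_simps)
  then have m: "(g \<ominus>\<^bsub>CT\<^esub> h) z \<in> carrier A" using ccontD assms by auto
  have "(g \<ominus>\<^bsub>CT\<^esub> h) \<oplus>\<^bsub>CT\<^esub> h = g" using c by (simp add: CT.minus_eq CT.a_assoc CT.l_neg)
  then have e: "(g \<ominus>\<^bsub>CT\<^esub> h) z \<oplus> h z = g z" using assms(3) by (metis CT_apply(2))
  show ?thesis unfolding e[symmetric] using m ccontD[OF assms(2,3)] by (simp add: minus_eq a_assoc r_neg)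
qed

lemma nrm_CT_nonneg: "ccont g \<Longrightarrow> 0 \<le> nrm CT g"
  using nrm_CT_le[of g 1] nrm_nonneg[of "g 1"] ccontD[of g 1] by fastforce

lemma unital_cstar_algebra_circle_tensor: "unital_cstar_algebra CT"
proof -
  interpret CT: ring CT by (rule ring_CT)
  have cring: "cring complex_ring" by (rule cring_complex_ring)
  have mod: "Module.module complex_ring CT"
    by (rule moduleI[OF cring CT.abelian_group_axioms]; unfold CT_simps(1) mem_Collect_eq; (rule ccont_ext)?)
      (auto simp: CT_closed CT_apply ccontD smult_add_left smult_smult smult_r_distr
        simp del: mem_sphere_0)
  have nz: "nrm CT g = 0 \<longleftrightarrow> g = \<zero>\<^bsub>CT\<^esub>" if g: "ccont g" for g
  proof
    assume "nrm CT g = 0"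
    then have "g z = \<zero>" if "z \<in> circle" for z
      using nrm_CT_le[OF g that] nrm_nonneg nrm_eq_0 ccontD[OF g that] by fastforce
    then show "g = \<zero>\<^bsub>CT\<^esub>" using g by (intro ccont_ext) (auto simp: CT_const_closed CT_apply simp del: mem_sphere_0)
  next
    assume "g = \<zero>\<^bsub>CT\<^esub>"
    then have "nrm CT g \<le> 0" by (intro nrm_CT_leI) (auto simp: CT_apply simp del: mem_sphere_0)
    then show "nrm CT g = 0" using nrm_CT_nonneg[OF g] by simp
  qed
  have add: "nrm CT (g \<oplus>\<^bsub>CT\<^esub> h) \<le> nrm CT g + nrm CT h" if "ccont g" "ccont h" for g h
  proof (rule nrm_CT_leI)
    fix z assume z: "z \<in> circle"
    have "nrm A (g z \<oplus> h z) \<le> nrm A (g z) + nrm A (h z)" using that z ccontD by (intro nrm_add) auto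
    then show "nrm A ((g \<oplus>\<^bsub>CT\<^esub> h) z) \<le> nrm CT g + nrm CT h"
      using nrm_CT_le[OF that(1) z] nrm_CT_le[OF that(2) z] z by (simp add: CT_apply del: mem_sphere_0)
  qed
  have mult: "nrm CT (g \<otimes>\<^bsub>CT\<^esub> h) \<le> nrm CT g * nrm CT h" if "ccont g" "ccont h" for g h
  proof (rule nrm_CT_leI)
    fix z assume z: "z \<in> circle"
    have "nrm A (g z \<otimes> h z) \<le> nrm A (g z) * nrm A (h z)" using that z ccontD by (intro nrm_mult) auto
    also have "\<dots> \<le> nrm CT g * nrm CT h"
      using nrm_CT_le[OF that(1) z] nrm_CT_le[OF that(2) z] nrm_nonneg ccontD that z nrm_CT_nonneg
      by (intro mult_mono) auto
    finally show "nrm A ((g \<otimes>\<^bsub>CT\<^esub> h) z) \<le> nrm CT g * nrm CT h"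
      using z by (simp add: CT_apply del: mem_sphere_0)
  qed
  have sm: "nrm CT (c \<odot>\<^bsub>CT\<^esub> g) = cmod c * nrm CT g" if g: "ccont g" for c g
  proof -
    have le: "nrm CT (c \<odot>\<^bsub>CT\<^esub> g) \<le> cmod c * nrm CT g" if g: "ccont g" for c g
    proof (rule nrm_CT_leI)
      fix z assume z: "z \<in> circle"
      show "nrm A ((c \<odot>\<^bsub>CT\<^esub> g) z) \<le> cmod c * nrm CT g"
        using nrm_CT_le[OF g z] z ccontD[OF g z] by (simp add: CT_apply nrm_smult mult_left_mono del: mem_sphere_0)
    qed
    show ?thesis
    proof (cases "c = 0")
      case True
      then show ?thesis using le[OF g, of c] nrm_CT_nonneg[OF CT_closed(3)[OF g g], of c] by simp
    next
      case False
      have cc: "ccont (c \<odot>\<^bsub>CT\<^esub> g)" by (rule CT_closed(3)[OF g g])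
      have "inverse c \<odot>\<^bsub>CT\<^esub> (c \<odot>\<^bsub>CT\<^esub> g) = g"
        by (rule ccont_ext) (use g False CT_closed(3)[OF cc cc] in
          \<open>auto simp: CT_apply ccontD smult_smult[symmetric] simp del: mem_sphere_0\<close>)
      then have "nrm CT g \<le> cmod (inverse c) * nrm CT (c \<odot>\<^bsub>CT\<^esub> g)"
        using le[OF cc, of "inverse c"] by simp
      then show ?thesis using le[OF g, of c] False by (simp add: norm_inverse norm_divide field_simps)
    qed
  qed
  have cs: "nrm CT (adj CT g \<otimes>\<^bsub>CT\<^esub> g) = (nrm CT g)\<^sup>2" if g: "ccont g" for g
  proof (rule antisym)
    have n: "nrm A ((adj CT g \<otimes>\<^bsub>CT\<^esub> g) z) = (nrm A (g z))\<^sup>2" if "z \<in> circle" for z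
      using that ccontD[OF g that] by (simp add: CT_apply nrm_adj_mult del: mem_sphere_0)
    show "nrm CT (adj CT g \<otimes>\<^bsub>CT\<^esub> g) \<le> (nrm CT g)\<^sup>2"
      by (rule nrm_CT_leI)
        (use n nrm_CT_le[OF g] nrm_nonneg ccontD[OF g] in \<open>auto intro!: power_mono simp del: mem_sphere_0\<close>)
    have "ccont (adj CT g \<otimes>\<^bsub>CT\<^esub> g)"
      using g by (simp add: CT_closed)
    then have "nrm A (g z) \<le> sqrt (nrm CT (adj CT g \<otimes>\<^bsub>CT\<^esub> g))" if "z \<in> circle" for z
      using nrm_CT_le[of "adj CT g \<otimes>\<^bsub>CT\<^esub> g" z] n[OF that] that by (metis real_le_rsqrt)
    then have "nrm CT g \<le> sqrt (nrm CT (adj CT g \<otimes>\<^bsub>CT\<^esub> g))" by (rule nrm_CT_leI)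
    from power_mono[OF this nrm_CT_nonneg[OF g], of 2]
    show "(nrm CT g)\<^sup>2 \<le> nrm CT (adj CT g \<otimes>\<^bsub>CT\<^esub> g)"
      using nrm_CT_nonneg[OF CT_closed(1)[OF CT_closed(4)[OF g g] g]] by simp
  qed
  interpret pre: Metric_space "carrier CT" "cstar_dist CT"
  proof
    have d: "cstar_dist CT g h = (if ccont g \<and> ccont h then nrm CT (g \<ominus>\<^bsub>CT\<^esub> h) else 0)" for g h
      by (simp add: cstar_dist_def CT_simps(1))
    have mc: "ccont (g \<ominus>\<^bsub>CT\<^esub> h)" if "ccont g" "ccont h" for g h
      using CT.minus_closed[of g h] that by (simp add: CT_simps(1))
    show "0 \<le> cstar_dist CT g h" for g h using nrm_CT_nonneg mc by (simp add: d)
    have "nrm CT (g \<ominus>\<^bsub>CT\<^esub> h) = nrm CT (h \<ominus>\<^bsub>CT\<^esub> g)" if "ccont g" "ccont h" for g h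
      unfolding CT_simps(8) using that ccontD by (intro SUP_cong refl) (simp add: CT_minus nrm_minus_commute del: mem_sphere_0)
    then show "cstar_dist CT g h = cstar_dist CT h g" for g h by (simp add: d)
    show "cstar_dist CT g h = 0 \<longleftrightarrow> g = h" if "g \<in> carrier CT" "h \<in> carrier CT" for g h
      using that nz[OF mc] CT.r_right_minus_eq by (simp add: d CT_simps(1))
    show "cstar_dist CT g k \<le> cstar_dist CT g h + cstar_dist CT h k"
      if "g \<in> carrier CT" "h \<in> carrier CT" "k \<in> carrier CT" for g h k
    proof -
      have "g \<ominus>\<^bsub>CT\<^esub> k = (g \<ominus>\<^bsub>CT\<^esub> h) \<oplus>\<^bsub>CT\<^esub> (h \<ominus>\<^bsub>CT\<^esub> k)"
        using that by (simp add: CT.minus_eq CT.a_assoc CT.r_neg1)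
      then show ?thesis using add[OF mc mc] that by (simp add: d CT_simps(1))
    qed
  qed
  have "pre.mcomplete"
    unfolding pre.mcomplete_def
  proof (intro allI impI)
    fix \<sigma> assume c: "pre.MCauchy \<sigma>"
    have \<sigma>: "ccont (\<sigma> n)" for n using c CT_simps(1) unfolding pre.MCauchy_def by blast
    have dle: "cstar_dist A (\<sigma> m z) (\<sigma> n z) \<le> cstar_dist CT (\<sigma> m) (\<sigma> n)" if z: "z \<in> circle" for m n z
      using nrm_CT_le[of "\<sigma> m \<ominus>\<^bsub>CT\<^esub> \<sigma> n" z] CT_minus[OF \<sigma> \<sigma> z] CT.minus_closed[of "\<sigma> m" "\<sigma> n"] ccontD[OF \<sigma> z] \<sigma> z
      by (simp add: cstar_dist_def CT_simps(1))
    have "\<exists>x. limitin metric.mtopology (\<lambda>n. \<sigma> n z) x sequentially" if z: "z \<in> circle" for z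
    proof -
      have "metric.MCauchy (\<lambda>n. \<sigma> n z)"
        using c ccontD[OF \<sigma> z] dle[OF z] unfolding pre.MCauchy_def metric.MCauchy_def
        by (auto simp del: mem_sphere_0) (metis order_le_less_trans)
      then show ?thesis using complete unfolding metric.mcomplete_def by blast
    qed
    then obtain l where l: "\<And>z. z \<in> circle \<Longrightarrow> limitin metric.mtopology (\<lambda>n. \<sigma> n z) (l z) sequentially"
      by metis
    define L where "L = restrict l circle"
    have Lc: "L z \<in> carrier A" if "z \<in> circle" for z
      using l[OF that] that by (simp add: L_def metric.limitin_metric)
    have unif: "\<exists>N. \<forall>n\<ge>N. \<forall>z\<in>circle. cstar_dist A (\<sigma> n z) (L z) < e" if e: "e > 0" for e
    proof -
      obtain N where N: "\<And>m n. m \<ge> N \<Longrightarrow> n \<ge> N \<Longrightarrow> cstar_dist CT (\<sigma> m) (\<sigma> n) < e/2"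
        using c e unfolding pre.MCauchy_def by (meson half_gt_zero)
      have "cstar_dist A (\<sigma> n z) (L z) < e" if n: "n \<ge> N" and z: "z \<in> circle" for n z
      proof -
        have "\<forall>\<^sub>F m in sequentially. cstar_dist A (\<sigma> m z) (L z) < e/2"
        proof -
          have "\<forall>\<^sub>F m in sequentially. \<sigma> m z \<in> carrier A \<and> cstar_dist A (\<sigma> m z) (l z) < e/2"
            using l[OF z] half_gt_zero[OF e] unfolding metric.limitin_metric by blast
          then show ?thesis unfolding L_def restrict_apply'[OF z] by (rule eventually_mono) blast
        qed
        then obtain M where "\<And>m. m \<ge> M \<Longrightarrow> cstar_dist A (\<sigma> m z) (L z) < e/2"
          by (auto simp: eventually_sequentially)
        then have "cstar_dist A (\<sigma> (max M N) z) (L z) < e/2" by simp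
        moreover have "cstar_dist A (\<sigma> n z) (\<sigma> (max M N) z) < e/2"
          using dle[OF z, of n "max M N"] N[of n "max M N"] n by simp
        moreover have "cstar_dist A (\<sigma> n z) (L z) \<le> cstar_dist A (\<sigma> n z) (\<sigma> (max M N) z) + cstar_dist A (\<sigma> (max M N) z) (L z)"
          using ccontD[OF \<sigma> z] Lc[OF z] by (intro metric.triangle)
        ultimately show ?thesis by simp
      qed
      then show ?thesis by blast
    qed
    have L: "ccont L"
    proof (rule ccont_uniform_limit)
      show "L \<in> circle \<rightarrow>\<^sub>E carrier A" using Lc by (auto simp: L_def)
      fix e :: real assume "e > 0"
      then obtain N where "\<forall>z\<in>circle. cstar_dist A (\<sigma> N z) (L z) < e" using unif by blast
      then have "\<forall>z\<in>circle. nrm A (L z \<ominus> \<sigma> N z) < e"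
        using ccontD[OF \<sigma>] Lc by (auto simp: cstar_dist_def nrm_minus_commute simp del: mem_sphere_0)
      then show "\<exists>h. ccont h \<and> (\<forall>z\<in>circle. nrm A (L z \<ominus> h z) < e)" using \<sigma> by blast
    qed
    have "limitin pre.mtopology \<sigma> L sequentially"
      unfolding pre.limitin_metric
    proof (intro conjI allI impI)
      show "L \<in> carrier CT" using L by (simp add: CT_simps(1))
      fix e :: real assume e: "e > 0"
      then obtain N where N: "\<And>n z. n \<ge> N \<Longrightarrow> z \<in> circle \<Longrightarrow> cstar_dist A (\<sigma> n z) (L z) < e/2"
        using unif[OF half_gt_zero[OF e]] by blast
      have "cstar_dist CT (\<sigma> n) L < e" if n: "n \<ge> N" for n
      proof -
        have "nrm CT (\<sigma> n \<ominus>\<^bsub>CT\<^esub> L) \<le> e/2"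
          by (rule nrm_CT_leI)
            (use N[OF n] ccontD[OF \<sigma>] Lc in \<open>force simp: CT_minus[OF \<sigma> L] cstar_dist_def simp del: mem_sphere_0\<close>)
        then show ?thesis using \<sigma> L e by (simp add: cstar_dist_def CT_simps(1))
      qed
      then show "\<forall>\<^sub>F n in sequentially. \<sigma> n \<in> carrier CT \<and> cstar_dist CT (\<sigma> n) L < e"
        using \<sigma> by (auto simp: eventually_sequentially CT_simps(1))
    qed
    then show "\<exists>x. limitin pre.mtopology \<sigma> x sequentially" by blast
  qed
  then show ?thesis
    by (intro unital_cstar_algebra.intro CT.ring_axioms mod unital_cstar_algebra_axioms.intro)
      (auto simp: CT_simps(1) nz add mult sm cs nrm_CT_nonneg CT_closed CT_apply ccontD adj_closed
        adj_adj adj_add adj_mult adj_smult smult_mult_left smult_mult_right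
        simp del: mem_sphere_0 intro!: ccont_ext)
qed


end

end

theory Submission
  imports Defs
begin

text \<open>
  A vector in \<open>Lg\<^sub>n(A)\<close> is a compatible pair of vectors over \<open>B\<close> and \<open>C\<close>; given matrices that solve the
  transitivity problem over \<open>B\<close> and over \<open>C\<close>, their images in \<open>GL\<^sub>n(D)\<close> differ by an element of the
  stabilizer of a vector \<open>d\<close>. If this element is the end of a path \<open>q\<close> in \<open>GL\<^sub>n(D)\<close> starting at \<open>1\<close>, then
  \<open>q d\<close> is a loop, i.e. an element of \<open>Lg\<^sub>n(C(\<T>) \<otimes> D)\<close>, and a \<open>g \<in> GL\<^sub>n(C(\<T>) \<otimes> D)\<close> moving it to the
  constant loop \<open>d\<close> turns \<open>q\<close> into a path with the same ends inside the stabilizer. Such a path is a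
  product of elements close to \<open>1\<close>, so it lifts along the surjective one of \<open>\<delta>\<close> and \<open>\<gamma>\<close>, and the lift
  corrects one of the two matrices. If \<open>g\<close> lies in \<open>GL\<^sub>n\<^sup>0\<close>, it lifts as well, which gives a path
  in \<open>GL\<^sub>n(A)\<close>. If \<open>K\<^sub>1(D) = 0\<close>, every element of \<open>GL\<^sub>n(D)\<close> is the end of a path after stabilization,
  and the same unwinding, applied to the last unit vector, removes the stabilization.
\<close>

section \<open>Matrices over a ring\<close>

text \<open>The obstacle is that an invertible matrix over \<open>D\<close> need not lift along a
  surjection, and that an element of a stabilizer may be joined to \<one> in \<open>GL\<close>
  without being joined to it inside the stabilizer. The hypothesis on C(T) \<otimes> D enters at
  this point. It speaks of loops, while the argument deforms paths; a path is therefore an element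
  of the circle algebra read along the angle from 1 to -1, and maps of the circle that are symmetric
  under conjugation pass from loops to paths. Conjugate points carry the moved loop and the constant
  loop \<open>d\<close>; comparing \<open>g\<close> at two such points makes \<open>g\<close> cancel
  at both ends. A path is then a single invertible matrix over a C*-algebra, so lifting near \<one>,
  applied to the induced homomorphism of circle algebras, lifts whole paths. Estimates aim at
  continuity: homomorphisms get the bound 2, matrices the sum of the norms of their entries, and
  limits are taken of sequences that converge like \<open>(1/2) ^ k\<close>. \<open>GL0\<close> is
  defined by connectedness; paths reach it because their ends form a subgroup that contains a
  neighbourhood of \<one>.\<close>

locale coeff_ring = ring A for A :: "('a, 'm) cstar_alg_scheme" (structure)
begin

lemma lin_comb_0 [simp]: "lin_comb A 0 a b = \<zero>"
  by (simp add: lin_comb_def)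

text \<open>The recursion replaces sums over finite sets by induction on the length in most
  identities below.\<close>

lemma lin_comb_Suc:
  assumes "\<And>k. k \<le> n \<Longrightarrow> a k \<in> carrier A" "\<And>k. k \<le> n \<Longrightarrow> b k \<in> carrier A"
  shows "lin_comb A (Suc n) a b = lin_comb A n a b \<oplus> a n \<otimes> b n"
proof -
  have "(\<Oplus>i\<in>{..<n}. a i \<otimes> b i) \<in> carrier A"
    using assms by (intro finsum_closed) auto
  moreover have "lin_comb A (Suc n) a b = a n \<otimes> b n \<oplus> lin_comb A n a b"
    unfolding lin_comb_def lessThan_Suc using assms by (intro finsum_insert) auto
  ultimately show ?thesis
    using assms by (simp add: lin_comb_def a_comm)
qed

lemma lin_comb_closed [simp]:
  assumes "\<And>k. k < n \<Longrightarrow> a k \<in> carrier A" "\<And>k. k < n \<Longrightarrow> b k \<in> carrier A"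
  shows "lin_comb A n a b \<in> carrier A"
  unfolding lin_comb_def using assms by (intro finsum_closed) auto

lemma lin_comb_cong:
  assumes "\<And>k. k < n \<Longrightarrow> a k \<in> carrier A" "\<And>k. k < n \<Longrightarrow> b k \<in> carrier A"
    and "\<And>k. k < n \<Longrightarrow> a k = a' k" "\<And>k. k < n \<Longrightarrow> b k = b' k"
  shows "lin_comb A n a b = lin_comb A n a' b'"
  unfolding lin_comb_def using assms by (intro finsum_cong') auto

lemma lin_comb_add_right:
  assumes "\<And>k. k < n \<Longrightarrow> a k \<in> carrier A" "\<And>k. k < n \<Longrightarrow> b k \<in> carrier A"
    "\<And>k. k < n \<Longrightarrow> c k \<in> carrier A"
  shows "lin_comb A n a (\<lambda>k. b k \<oplus> c k) = lin_comb A n a b \<oplus> lin_comb A n a c"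
  using assms by (induction n) (simp_all add: lin_comb_Suc r_distr a_ac)

lemma lin_comb_add_left:
  assumes "\<And>k. k < n \<Longrightarrow> a k \<in> carrier A" "\<And>k. k < n \<Longrightarrow> b k \<in> carrier A"
    "\<And>k. k < n \<Longrightarrow> c k \<in> carrier A"
  shows "lin_comb A n (\<lambda>k. a k \<oplus> b k) c = lin_comb A n a c \<oplus> lin_comb A n b c"
  using assms by (induction n) (simp_all add: lin_comb_Suc l_distr a_ac)

lemma lin_comb_minus_left:
  assumes "\<And>k. k < n \<Longrightarrow> a k \<in> carrier A" "\<And>k. k < n \<Longrightarrow> b k \<in> carrier A"
    "\<And>k. k < n \<Longrightarrow> c k \<in> carrier A"
  shows "lin_comb A n (\<lambda>k. a k \<ominus> b k) c = lin_comb A n a c \<ominus> lin_comb A n b c"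
proof -
  have cancel: "(x \<ominus> y) \<oplus> y = x" "(x \<oplus> y) \<ominus> y = x" if "x \<in> carrier A" "y \<in> carrier A" for x y
    using that by (simp_all add: a_minus_def a_assoc l_neg r_neg)
  have "lin_comb A n a c = lin_comb A n (\<lambda>k. (a k \<ominus> b k) \<oplus> b k) c"
    using assms by (intro lin_comb_cong) (simp_all add: cancel)
  also have "\<dots> = lin_comb A n (\<lambda>k. a k \<ominus> b k) c \<oplus> lin_comb A n b c"
    using assms by (intro lin_comb_add_left) simp_all
  finally show ?thesis using assms by (simp add: cancel)
qed

lemma lin_comb_mult_right:
  assumes "\<And>k. k < n \<Longrightarrow> a k \<in> carrier A" "\<And>k. k < n \<Longrightarrow> b k \<in> carrier A" "c \<in> carrier A"
  shows "lin_comb A n a (\<lambda>k. b k \<otimes> c) = lin_comb A n a b \<otimes> c"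
  using assms by (induction n) (simp_all add: lin_comb_Suc l_distr m_assoc)

lemma lin_comb_mult_left:
  assumes "\<And>k. k < n \<Longrightarrow> a k \<in> carrier A" "\<And>k. k < n \<Longrightarrow> b k \<in> carrier A" "c \<in> carrier A"
  shows "lin_comb A n (\<lambda>k. c \<otimes> a k) b = c \<otimes> lin_comb A n a b"
  using assms by (induction n) (simp_all add: lin_comb_Suc r_distr m_assoc)

lemma lin_comb_zero_left:
  assumes "\<And>k. k < n \<Longrightarrow> b k \<in> carrier A"
  shows "lin_comb A n (\<lambda>k. \<zero>) b = \<zero>"
  using assms by (induction n) (simp_all add: lin_comb_Suc)

lemma lin_comb_zero_right:
  assumes "\<And>k. k < n \<Longrightarrow> a k \<in> carrier A"
  shows "lin_comb A n a (\<lambda>k. \<zero>) = \<zero>"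
  using assms by (induction n) (simp_all add: lin_comb_Suc)

text \<open>Row times matrix times column: the common core of the associativity of matrix products,
  of the action on vectors and of the left inverse along an orbit in
  \<open>orbit_loop_Lg\<close>.\<close>

lemma lin_comb_assoc:
  assumes "\<And>j. j < m \<Longrightarrow> a j \<in> carrier A" "\<And>k. k < n \<Longrightarrow> c k \<in> carrier A"
    "\<And>j k. \<lbrakk>j < m; k < n\<rbrakk> \<Longrightarrow> x j k \<in> carrier A"
  shows "lin_comb A n (\<lambda>k. lin_comb A m a (\<lambda>j. x j k)) c = lin_comb A m a (\<lambda>j. lin_comb A n (x j) c)"
  using assms
proof (induction n)
  case 0
  then show ?case by (simp add: lin_comb_zero_right)
next
  case (Suc n)
  have "lin_comb A (Suc n) (\<lambda>k. lin_comb A m a (\<lambda>j. x j k)) c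
      = lin_comb A m a (\<lambda>j. lin_comb A n (x j) c) \<oplus> lin_comb A m a (\<lambda>j. x j n) \<otimes> c n"
    using Suc by (simp add: lin_comb_Suc)
  also have "\<dots> = lin_comb A m a (\<lambda>j. lin_comb A n (x j) c \<oplus> x j n \<otimes> c n)"
    using Suc.prems by (subst lin_comb_add_right) (simp_all add: lin_comb_mult_right)
  also have "\<dots> = lin_comb A m a (\<lambda>j. lin_comb A (Suc n) (x j) c)"
    using Suc.prems by (intro lin_comb_cong) (simp_all add: lin_comb_Suc)
  finally show ?case .
qed

lemma lin_comb_delta_left:
  assumes "\<And>k. k < n \<Longrightarrow> b k \<in> carrier A"
  shows "lin_comb A n (\<lambda>k. if i = k then \<one> else \<zero>) b = (if i < n then b i else \<zero>)"
  using assms by (induction n) (simp_all add: lin_comb_Suc, auto dest: less_SucE)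

lemma lin_comb_delta_right:
  assumes "\<And>k. k < n \<Longrightarrow> b k \<in> carrier A"
  shows "lin_comb A n b (\<lambda>k. if k = i then \<one> else \<zero>) = (if i < n then b i else \<zero>)"
  using assms by (induction n) (simp_all add: lin_comb_Suc, auto dest: less_SucE)

end

text \<open>\<open>mat_monoid\<close> enriched by addition and zero, so that ring theory and norm
  estimates apply; the unit groups coincide by \<open>GL_eq_Units\<close>.\<close>

definition mat_ring :: "('a, 'm) cstar_alg_scheme \<Rightarrow> nat \<Rightarrow> (nat \<times> nat \<Rightarrow> 'a) ring" where
  "mat_ring A n =
     \<lparr>carrier = {..<n} \<times> {..<n} \<rightarrow>\<^sub>E carrier A,
      monoid.mult = (\<lambda>x y. \<lambda>(i, j)\<in>{..<n} \<times> {..<n}. lin_comb A n (\<lambda>k. x (i, k)) (\<lambda>k. y (k, j))),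
      one = (\<lambda>(i, j)\<in>{..<n} \<times> {..<n}. if i = j then \<one>\<^bsub>A\<^esub> else \<zero>\<^bsub>A\<^esub>),
      ring.zero = (\<lambda>p\<in>{..<n} \<times> {..<n}. \<zero>\<^bsub>A\<^esub>),
      add = (\<lambda>x y. \<lambda>p\<in>{..<n} \<times> {..<n}. x p \<oplus>\<^bsub>A\<^esub> y p)\<rparr>"

abbreviation mats :: "('a, 'm) cstar_alg_scheme \<Rightarrow> nat \<Rightarrow> (nat \<times> nat \<Rightarrow> 'a) set" where
  "mats A n \<equiv> carrier (mat_ring A n)"

abbreviation vecs :: "('a, 'm) cstar_alg_scheme \<Rightarrow> nat \<Rightarrow> (nat \<Rightarrow> 'a) set" where
  "vecs A n \<equiv> {..<n} \<rightarrow>\<^sub>E carrier A"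

lemma GL_eq_Units: "GL A n = Units (mat_ring A n)"
  by (simp add: GL_def Units_def mat_ring_def mat_monoid_def)

lemma one_mat_monoid: "\<one>\<^bsub>mat_monoid A n\<^esub> = \<one>\<^bsub>mat_ring A n\<^esub>"
  by (simp add: mat_ring_def mat_monoid_def)

lemma mat_carrier: "mats A n = {..<n} \<times> {..<n} \<rightarrow>\<^sub>E carrier A"
  by (simp add: mat_ring_def)

lemma mat_carrierD:
  assumes "x \<in> mats A n" "i < n" "j < n" shows "x (i, j) \<in> carrier A"
  using assms by (auto simp: mat_carrier PiE_iff)

lemma mat_ext:
  assumes "x \<in> mats A n" "y \<in> mats A n"
    and "\<And>i j. \<lbrakk>i < n; j < n\<rbrakk> \<Longrightarrow> x (i, j) = y (i, j)"
  shows "x = y"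
  using assms unfolding mat_carrier PiE_iff by (intro extensionalityI[of x "{..<n} \<times> {..<n}" y]) auto

lemma mat_entries:
  assumes "i < n" "j < n"
  shows "(x \<otimes>\<^bsub>mat_ring A n\<^esub> y) (i, j) = lin_comb A n (\<lambda>k. x (i, k)) (\<lambda>k. y (k, j))"
    "\<one>\<^bsub>mat_ring A n\<^esub> (i, j) = (if i = j then \<one>\<^bsub>A\<^esub> else \<zero>\<^bsub>A\<^esub>)"
    "(x \<oplus>\<^bsub>mat_ring A n\<^esub> y) (i, j) = x (i, j) \<oplus>\<^bsub>A\<^esub> y (i, j)"
    "\<zero>\<^bsub>mat_ring A n\<^esub> (i, j) = \<zero>\<^bsub>A\<^esub>"
  using assms by (simp_all add: mat_ring_def)

lemma vec_ext:
  assumes "v \<in> vecs A n" "w \<in> vecs A n" "\<And>i. i < n \<Longrightarrow> v i = w i" shows "v = w"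
  using assms unfolding PiE_iff by (intro extensionalityI[of v "{..<n}" w]) auto

lemma mat_vec_apply: "i < n \<Longrightarrow> mat_vec A n g v i = lin_comb A n (\<lambda>k. g (i, k)) v"
  by (simp add: mat_vec_def)

section \<open>The matrix ring, its unit group and its action on vectors\<close>

context coeff_ring
begin

lemma mat_closed [simp]:
  assumes "x \<in> mats A n" "y \<in> mats A n"
  shows "x \<otimes>\<^bsub>mat_ring A n\<^esub> y \<in> mats A n" "x \<oplus>\<^bsub>mat_ring A n\<^esub> y \<in> mats A n"
  using assms by (auto simp: mat_ring_def PiE_iff intro!: lin_comb_closed)

lemma mat_const_closed [simp]:
  "\<one>\<^bsub>mat_ring A n\<^esub> \<in> mats A n" "\<zero>\<^bsub>mat_ring A n\<^esub> \<in> mats A n"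
  by (auto simp: mat_ring_def)

lemma ring_mat: "ring (mat_ring A n)"
proof (rule ringI)
  show "abelian_group (mat_ring A n)"
  proof (rule abelian_groupI)
    fix x assume x: "x \<in> mats A n"
    let ?y = "\<lambda>p\<in>{..<n} \<times> {..<n}. \<ominus> x p"
    have y: "?y \<in> mats A n" using x by (auto simp: mat_carrier PiE_iff)
    have "?y \<oplus>\<^bsub>mat_ring A n\<^esub> x = \<zero>\<^bsub>mat_ring A n\<^esub>"
      by (rule mat_ext[OF mat_closed(2)[OF y x] mat_const_closed(2)])
        (simp add: mat_entries l_neg mat_carrierD[OF x])
    with y show "\<exists>y\<in>mats A n. y \<oplus>\<^bsub>mat_ring A n\<^esub> x = \<zero>\<^bsub>mat_ring A n\<^esub>" by blast
  qed (auto intro!: mat_closed mat_const_closed intro: mat_ext[where A = A and n = n] simp: mat_entries mat_carrierD a_ac)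
  show "Group.monoid (mat_ring A n)"
  proof (rule monoidI)
    fix x y z assume c: "x \<in> mats A n" "y \<in> mats A n" "z \<in> mats A n"
    note e = mat_carrierD[OF c(1)] mat_carrierD[OF c(2)] mat_carrierD[OF c(3)]
    show "x \<otimes>\<^bsub>mat_ring A n\<^esub> y \<otimes>\<^bsub>mat_ring A n\<^esub> z = x \<otimes>\<^bsub>mat_ring A n\<^esub> (y \<otimes>\<^bsub>mat_ring A n\<^esub> z)"
    proof (rule mat_ext[where A = A])
      fix i j assume ij: "i < n" "j < n"
      have "(x \<otimes>\<^bsub>mat_ring A n\<^esub> y \<otimes>\<^bsub>mat_ring A n\<^esub> z) (i, j)
          = lin_comb A n (\<lambda>k. lin_comb A n (\<lambda>l. x (i, l)) (\<lambda>l. y (l, k))) (\<lambda>k. z (k, j))"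
        using ij e by (auto simp: mat_entries intro!: lin_comb_cong)
      also have "\<dots> = lin_comb A n (\<lambda>l. x (i, l)) (\<lambda>l. lin_comb A n (\<lambda>k. y (l, k)) (\<lambda>k. z (k, j)))"
        using ij e by (intro lin_comb_assoc) auto
      also have "\<dots> = (x \<otimes>\<^bsub>mat_ring A n\<^esub> (y \<otimes>\<^bsub>mat_ring A n\<^esub> z)) (i, j)"
        using ij e by (auto simp: mat_entries intro!: lin_comb_cong)
      finally show "(x \<otimes>\<^bsub>mat_ring A n\<^esub> y \<otimes>\<^bsub>mat_ring A n\<^esub> z) (i, j) = (x \<otimes>\<^bsub>mat_ring A n\<^esub> (y \<otimes>\<^bsub>mat_ring A n\<^esub> z)) (i, j)" .
    qed (use c mat_closed in auto)
  next
    fix x assume x: "x \<in> mats A n"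
    note e = mat_carrierD[OF x]
    show "\<one>\<^bsub>mat_ring A n\<^esub> \<otimes>\<^bsub>mat_ring A n\<^esub> x = x"
    proof (rule mat_ext[where A = A])
      fix i j assume ij: "i < n" "j < n"
      have "(\<one>\<^bsub>mat_ring A n\<^esub> \<otimes>\<^bsub>mat_ring A n\<^esub> x) (i, j)
          = lin_comb A n (\<lambda>k. if i = k then \<one> else \<zero>) (\<lambda>k. x (k, j))"
        using ij e by (auto simp: mat_entries intro!: lin_comb_cong)
      then show "(\<one>\<^bsub>mat_ring A n\<^esub> \<otimes>\<^bsub>mat_ring A n\<^esub> x) (i, j) = x (i, j)"
        using ij e by (simp add: lin_comb_delta_left)
    qed (use x mat_closed mat_const_closed in auto)
    show "x \<otimes>\<^bsub>mat_ring A n\<^esub> \<one>\<^bsub>mat_ring A n\<^esub> = x"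
    proof (rule mat_ext[where A = A])
      fix i j assume ij: "i < n" "j < n"
      have "(x \<otimes>\<^bsub>mat_ring A n\<^esub> \<one>\<^bsub>mat_ring A n\<^esub>) (i, j)
          = lin_comb A n (\<lambda>k. x (i, k)) (\<lambda>k. if k = j then \<one> else \<zero>)"
        using ij e by (auto simp: mat_entries intro!: lin_comb_cong)
      then show "(x \<otimes>\<^bsub>mat_ring A n\<^esub> \<one>\<^bsub>mat_ring A n\<^esub>) (i, j) = x (i, j)"
        using ij e by (simp add: lin_comb_delta_right)
    qed (use x mat_closed mat_const_closed in auto)
  qed (auto intro: mat_closed mat_const_closed)
  fix x y z assume c: "x \<in> mats A n" "y \<in> mats A n" "z \<in> mats A n"
  note e = mat_carrierD[OF c(1)] mat_carrierD[OF c(2)] mat_carrierD[OF c(3)]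
  show "(x \<oplus>\<^bsub>mat_ring A n\<^esub> y) \<otimes>\<^bsub>mat_ring A n\<^esub> z = x \<otimes>\<^bsub>mat_ring A n\<^esub> z \<oplus>\<^bsub>mat_ring A n\<^esub> y \<otimes>\<^bsub>mat_ring A n\<^esub> z"
  proof (rule mat_ext[where A = A])
    fix i j assume ij: "i < n" "j < n"
    have "((x \<oplus>\<^bsub>mat_ring A n\<^esub> y) \<otimes>\<^bsub>mat_ring A n\<^esub> z) (i, j)
        = lin_comb A n (\<lambda>k. x (i, k) \<oplus> y (i, k)) (\<lambda>k. z (k, j))"
      using ij e by (auto simp: mat_entries intro!: lin_comb_cong)
    then show "((x \<oplus>\<^bsub>mat_ring A n\<^esub> y) \<otimes>\<^bsub>mat_ring A n\<^esub> z) (i, j)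
        = (x \<otimes>\<^bsub>mat_ring A n\<^esub> z \<oplus>\<^bsub>mat_ring A n\<^esub> y \<otimes>\<^bsub>mat_ring A n\<^esub> z) (i, j)"
      using ij e by (simp add: lin_comb_add_left mat_entries)
  qed (use c mat_closed in auto)
  show "z \<otimes>\<^bsub>mat_ring A n\<^esub> (x \<oplus>\<^bsub>mat_ring A n\<^esub> y) = z \<otimes>\<^bsub>mat_ring A n\<^esub> x \<oplus>\<^bsub>mat_ring A n\<^esub> z \<otimes>\<^bsub>mat_ring A n\<^esub> y"
  proof (rule mat_ext[where A = A])
    fix i j assume ij: "i < n" "j < n"
    have "(z \<otimes>\<^bsub>mat_ring A n\<^esub> (x \<oplus>\<^bsub>mat_ring A n\<^esub> y)) (i, j)
        = lin_comb A n (\<lambda>k. z (i, k)) (\<lambda>k. x (k, j) \<oplus> y (k, j))"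
      using ij e by (auto simp: mat_entries intro!: lin_comb_cong)
    then show "(z \<otimes>\<^bsub>mat_ring A n\<^esub> (x \<oplus>\<^bsub>mat_ring A n\<^esub> y)) (i, j)
        = (z \<otimes>\<^bsub>mat_ring A n\<^esub> x \<oplus>\<^bsub>mat_ring A n\<^esub> z \<otimes>\<^bsub>mat_ring A n\<^esub> y) (i, j)"
      using ij e by (simp add: lin_comb_add_right mat_entries)
  qed (use c mat_closed in auto)
qed

lemma mat_minus:
  assumes "x \<in> mats A n" "y \<in> mats A n" "i < n" "j < n"
  shows "(x \<ominus>\<^bsub>mat_ring A n\<^esub> y) (i, j) = x (i, j) \<ominus> y (i, j)"
proof -
  interpret M: ring "mat_ring A n" by (rule ring_mat)
  have m: "x \<ominus>\<^bsub>mat_ring A n\<^esub> y \<in> mats A n" using assms by simp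
  have "(x \<ominus>\<^bsub>mat_ring A n\<^esub> y) \<oplus>\<^bsub>mat_ring A n\<^esub> y = x"
    using assms by (simp add: M.minus_eq M.a_assoc M.l_neg)
  then have e: "(x \<ominus>\<^bsub>mat_ring A n\<^esub> y) (i, j) \<oplus> y (i, j) = x (i, j)"
    using assms by (metis mat_entries(3))
  show ?thesis
    unfolding e[symmetric] using mat_carrierD[OF m] mat_carrierD[OF assms(2)] assms
    by (simp add: minus_eq a_assoc r_neg)
qed

lemma mat_vec_closed [simp]:
  assumes "g \<in> mats A n" "v \<in> vecs A n" shows "mat_vec A n g v \<in> vecs A n"
  using assms by (auto simp: mat_vec_def mat_carrier PiE_iff intro!: lin_comb_closed)

lemma mat_vec_mult:
  assumes "g \<in> mats A n" "h \<in> mats A n" "v \<in> vecs A n"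
  shows "mat_vec A n (g \<otimes>\<^bsub>mat_ring A n\<^esub> h) v = mat_vec A n g (mat_vec A n h v)"
proof (rule vec_ext[where A = A])
  fix i assume i: "i < n"
  note e = mat_carrierD[OF assms(1)] mat_carrierD[OF assms(2)] PiE_mem[OF assms(3)]
  have "mat_vec A n (g \<otimes>\<^bsub>mat_ring A n\<^esub> h) v i
      = lin_comb A n (\<lambda>k. lin_comb A n (\<lambda>l. g (i, l)) (\<lambda>l. h (l, k))) v"
    using i e by (auto simp: mat_vec_apply mat_entries intro!: lin_comb_cong)
  also have "\<dots> = lin_comb A n (\<lambda>l. g (i, l)) (\<lambda>l. lin_comb A n (\<lambda>k. h (l, k)) v)"
    using i e by (intro lin_comb_assoc) auto
  also have "\<dots> = mat_vec A n g (mat_vec A n h v) i"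
    using i e by (auto simp: mat_vec_apply intro!: lin_comb_cong)
  finally show "mat_vec A n (g \<otimes>\<^bsub>mat_ring A n\<^esub> h) v i = mat_vec A n g (mat_vec A n h v) i" .
qed (use assms mat_closed in auto)

lemma mat_vec_one:
  assumes "v \<in> vecs A n" shows "mat_vec A n \<one>\<^bsub>mat_ring A n\<^esub> v = v"
proof (rule vec_ext[where A = A])
  fix i assume i: "i < n"
  have "mat_vec A n \<one>\<^bsub>mat_ring A n\<^esub> v i = lin_comb A n (\<lambda>k. if i = k then \<one> else \<zero>) v"
    using i PiE_mem[OF assms] by (simp add: mat_vec_apply, intro lin_comb_cong) (simp_all add: mat_entries)
  then show "mat_vec A n \<one>\<^bsub>mat_ring A n\<^esub> v i = v i"
    using i PiE_mem[OF assms] by (simp add: lin_comb_delta_left)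
qed (simp_all add: assms mat_const_closed)

lemma GL_closed [simp]: "g \<in> GL A n \<Longrightarrow> g \<in> mats A n"
  by (simp add: GL_eq_Units Units_def)

lemma GL_one [simp]: "\<one>\<^bsub>mat_ring A n\<^esub> \<in> GL A n"
proof -
  interpret M: ring "mat_ring A n" by (rule ring_mat)
  show ?thesis by (simp add: GL_eq_Units)
qed

lemma GL_mult [simp]: "\<lbrakk>g \<in> GL A n; h \<in> GL A n\<rbrakk> \<Longrightarrow> g \<otimes>\<^bsub>mat_ring A n\<^esub> h \<in> GL A n"
proof -
  interpret M: ring "mat_ring A n" by (rule ring_mat)
  show "\<lbrakk>g \<in> GL A n; h \<in> GL A n\<rbrakk> \<Longrightarrow> g \<otimes>\<^bsub>mat_ring A n\<^esub> h \<in> GL A n" by (simp add: GL_eq_Units)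
qed

lemma GL_inv [simp]: "g \<in> GL A n \<Longrightarrow> inv\<^bsub>mat_ring A n\<^esub> g \<in> GL A n"
proof -
  interpret M: ring "mat_ring A n" by (rule ring_mat)
  show "g \<in> GL A n \<Longrightarrow> inv\<^bsub>mat_ring A n\<^esub> g \<in> GL A n" by (simp add: GL_eq_Units)
qed

lemma GL_l_inv [simp]: "g \<in> GL A n \<Longrightarrow> inv\<^bsub>mat_ring A n\<^esub> g \<otimes>\<^bsub>mat_ring A n\<^esub> g = \<one>\<^bsub>mat_ring A n\<^esub>"
proof -
  interpret M: ring "mat_ring A n" by (rule ring_mat)
  show "g \<in> GL A n \<Longrightarrow> inv\<^bsub>mat_ring A n\<^esub> g \<otimes>\<^bsub>mat_ring A n\<^esub> g = \<one>\<^bsub>mat_ring A n\<^esub>" by (simp add: GL_eq_Units)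
qed

lemma GL_r_inv [simp]: "g \<in> GL A n \<Longrightarrow> g \<otimes>\<^bsub>mat_ring A n\<^esub> inv\<^bsub>mat_ring A n\<^esub> g = \<one>\<^bsub>mat_ring A n\<^esub>"
proof -
  interpret M: ring "mat_ring A n" by (rule ring_mat)
  show "g \<in> GL A n \<Longrightarrow> g \<otimes>\<^bsub>mat_ring A n\<^esub> inv\<^bsub>mat_ring A n\<^esub> g = \<one>\<^bsub>mat_ring A n\<^esub>" by (simp add: GL_eq_Units)
qed

lemma GL_I:
  assumes "g \<in> mats A n" "h \<in> mats A n"
    "g \<otimes>\<^bsub>mat_ring A n\<^esub> h = \<one>\<^bsub>mat_ring A n\<^esub>" "h \<otimes>\<^bsub>mat_ring A n\<^esub> g = \<one>\<^bsub>mat_ring A n\<^esub>"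
  shows "g \<in> GL A n"
  unfolding GL_eq_Units Units_def using assms by blast

lemma GL_inv_eq:
  assumes "g \<in> GL A n" "h \<in> mats A n" "g \<otimes>\<^bsub>mat_ring A n\<^esub> h = \<one>\<^bsub>mat_ring A n\<^esub>"
  shows "inv\<^bsub>mat_ring A n\<^esub> g = h"
proof -
  interpret M: ring "mat_ring A n" by (rule ring_mat)
  have "inv\<^bsub>mat_ring A n\<^esub> g = inv\<^bsub>mat_ring A n\<^esub> g \<otimes>\<^bsub>mat_ring A n\<^esub> (g \<otimes>\<^bsub>mat_ring A n\<^esub> h)"
    unfolding assms(3) using assms(1) by simp
  also have "\<dots> = h"
    using assms(1,2) by (subst M.m_assoc[symmetric]) simp_all
  finally show ?thesis .
qed

lemma GL_cancel:
  assumes "g \<in> GL A n" "h \<in> mats A n"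
  shows "inv\<^bsub>mat_ring A n\<^esub> g \<otimes>\<^bsub>mat_ring A n\<^esub> (g \<otimes>\<^bsub>mat_ring A n\<^esub> h) = h"
    "g \<otimes>\<^bsub>mat_ring A n\<^esub> (inv\<^bsub>mat_ring A n\<^esub> g \<otimes>\<^bsub>mat_ring A n\<^esub> h) = h"
    "h \<otimes>\<^bsub>mat_ring A n\<^esub> g \<otimes>\<^bsub>mat_ring A n\<^esub> inv\<^bsub>mat_ring A n\<^esub> g = h"
    "h \<otimes>\<^bsub>mat_ring A n\<^esub> inv\<^bsub>mat_ring A n\<^esub> g \<otimes>\<^bsub>mat_ring A n\<^esub> g = h"
proof -
  interpret M: ring "mat_ring A n" by (rule ring_mat)
  note c = assms(2) GL_closed[OF assms(1)] GL_closed[OF GL_inv[OF assms(1)]]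
  show "inv\<^bsub>mat_ring A n\<^esub> g \<otimes>\<^bsub>mat_ring A n\<^esub> (g \<otimes>\<^bsub>mat_ring A n\<^esub> h) = h"
    "g \<otimes>\<^bsub>mat_ring A n\<^esub> (inv\<^bsub>mat_ring A n\<^esub> g \<otimes>\<^bsub>mat_ring A n\<^esub> h) = h"
    using assms(1) c by (simp_all add: M.m_assoc[symmetric])
  show "h \<otimes>\<^bsub>mat_ring A n\<^esub> g \<otimes>\<^bsub>mat_ring A n\<^esub> inv\<^bsub>mat_ring A n\<^esub> g = h"
    "h \<otimes>\<^bsub>mat_ring A n\<^esub> inv\<^bsub>mat_ring A n\<^esub> g \<otimes>\<^bsub>mat_ring A n\<^esub> g = h"
    using assms(1) c by (simp_all add: M.m_assoc)
qed

lemma mat_vec_inv: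
  assumes "g \<in> GL A n" "v \<in> vecs A n" "mat_vec A n g v = w"
  shows "mat_vec A n (inv\<^bsub>mat_ring A n\<^esub> g) w = v"
  unfolding assms(3)[symmetric] using assms(1,2) by (simp flip: mat_vec_mult add: mat_vec_one)

lemma mat_vec_fix_mult:
  assumes "g \<in> mats A n" "h \<in> mats A n" "v \<in> vecs A n"
    "mat_vec A n g v = v" "mat_vec A n h v = v"
  shows "mat_vec A n (g \<otimes>\<^bsub>mat_ring A n\<^esub> h) v = v"
  using assms by (simp add: mat_vec_mult)

text \<open>A left ideal is everything as soon as it contains \<one>, so a single row
  \<open>a\<close> witnesses unimodularity. In this form the property passes along homomorphisms and
  can be established for loops.\<close>

lemma Lg_iff: "v \<in> Lg A n \<longleftrightarrow> v \<in> vecs A n \<and> (\<exists>a\<in>vecs A n. lin_comb A n a v = \<one>)"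
proof
  assume v: "v \<in> Lg A n"
  then have "\<one> \<in> {lin_comb A n b v | b. b \<in> vecs A n}" by (simp add: Lg_def)
  then obtain a where "a \<in> vecs A n" "\<one> = lin_comb A n a v" by (elim CollectE exE conjE)
  then show "v \<in> vecs A n \<and> (\<exists>a\<in>vecs A n. lin_comb A n a v = \<one>)"
    using v by (intro conjI bexI[of _ a]) (simp_all add: Lg_def)
next
  assume "v \<in> vecs A n \<and> (\<exists>a\<in>vecs A n. lin_comb A n a v = \<one>)"
  then obtain a where v: "v \<in> vecs A n" and a: "a \<in> vecs A n" "lin_comb A n a v = \<one>"
    by (elim conjE bexE)
  note e = PiE_mem[OF v] PiE_mem[OF a(1)]
  have "{lin_comb A n b v | b. b \<in> vecs A n} = carrier A"
  proof (intro equalityI subsetI)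
    fix x assume "x \<in> {lin_comb A n b v | b. b \<in> vecs A n}"
    then obtain b where "x = lin_comb A n b v" and b: "b \<in> vecs A n" by (elim CollectE exE conjE)
    then show "x \<in> carrier A" using e PiE_mem[OF b] by simp
  next
    fix x assume x: "x \<in> carrier A"
    let ?b = "\<lambda>k\<in>{..<n}. x \<otimes> a k"
    have "lin_comb A n ?b v = lin_comb A n (\<lambda>k. x \<otimes> a k) v"
      using e x by (intro lin_comb_cong) simp_all
    also have "\<dots> = x" using e x a(2) by (subst lin_comb_mult_left) simp_all
    finally have "x = lin_comb A n ?b v" ..
    moreover have "?b \<in> vecs A n" using e x by simp
    ultimately show "x \<in> {lin_comb A n b v | b. b \<in> vecs A n}"
      by (intro CollectI exI[of _ ?b] conjI)
  qed
  then show "v \<in> Lg A n" using v by (simp add: Lg_def)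
qed

lemma delta_Lg:
  assumes "i < n" shows "(\<lambda>k\<in>{..<n}. if k = i then \<one> else \<zero>) \<in> Lg A n" (is "?e \<in> _")
proof -
  have "lin_comb A n ?e ?e = lin_comb A n ?e (\<lambda>k. if k = i then \<one> else \<zero>)"
    by (intro lin_comb_cong) auto
  also have "\<dots> = \<one>" using assms by (subst lin_comb_delta_right) auto
  finally show ?thesis unfolding Lg_iff by (intro conjI bexI[of _ ?e]) simp_all
qed

end

section \<open>Entrywise action of homomorphisms on matrices and vectors\<close>

definition mat_map :: "nat \<Rightarrow> ('a \<Rightarrow> 'b) \<Rightarrow> (nat \<times> nat \<Rightarrow> 'a) \<Rightarrow> nat \<times> nat \<Rightarrow> 'b" where
  "mat_map n h x = (\<lambda>p\<in>{..<n} \<times> {..<n}. h (x p))"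

definition vec_map :: "nat \<Rightarrow> ('a \<Rightarrow> 'b) \<Rightarrow> (nat \<Rightarrow> 'a) \<Rightarrow> nat \<Rightarrow> 'b" where
  "vec_map n h v = (\<lambda>i\<in>{..<n}. h (v i))"

lemma mat_map_apply [simp]: "\<lbrakk>i < n; j < n\<rbrakk> \<Longrightarrow> mat_map n h x (i, j) = h (x (i, j))"
  by (simp add: mat_map_def)

lemma vec_map_apply [simp]: "i < n \<Longrightarrow> vec_map n h v i = h (v i)"
  by (simp add: vec_map_def)

lemma mat_map_comp: "mat_map n h (mat_map n k x) = mat_map n (\<lambda>a. h (k a)) x"
  by (auto simp: mat_map_def fun_eq_iff)

lemma vec_map_comp: "vec_map n h (vec_map n k x) = vec_map n (\<lambda>a. h (k a)) x"
  by (auto simp: vec_map_def fun_eq_iff)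

lemma mat_map_id: "x \<in> mats A n \<Longrightarrow> mat_map n (\<lambda>a. a) x = x"
  by (simp add: mat_map_def mat_carrier PiE_restrict)

lemma mat_map_pointwise:
  assumes "\<And>a. h a = k a" shows "mat_map n h x = mat_map n k x"
  using assms by (auto simp: mat_map_def)

lemma vec_map_pointwise:
  assumes "\<And>a. h a = k a" shows "vec_map n h x = vec_map n k x"
  using assms by (auto simp: vec_map_def)

lemma vec_map_cong:
  assumes "v \<in> vecs A n" "\<And>a. a \<in> carrier A \<Longrightarrow> h a = k a"
  shows "vec_map n h v = vec_map n k v"
  using assms by (auto simp: vec_map_def fun_eq_iff PiE_iff)

text \<open>Plain ring homomorphisms, so that one set of facts serves maps of C*-algebras,
  evaluation of loops, reparametrization, constant loops and the two projections of the
  pullback.\<close>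

locale coeff_hom = A: coeff_ring A + B: coeff_ring B
  for A :: "('a, 'm) cstar_alg_scheme" and B :: "('b, 'n) cstar_alg_scheme" +
  fixes h
  assumes hom: "h \<in> ring_hom A B"
begin

lemma h_simps [simp]:
  "x \<in> carrier A \<Longrightarrow> h x \<in> carrier B"
  "\<lbrakk>x \<in> carrier A; y \<in> carrier A\<rbrakk> \<Longrightarrow> h (x \<otimes>\<^bsub>A\<^esub> y) = h x \<otimes>\<^bsub>B\<^esub> h y"
  "\<lbrakk>x \<in> carrier A; y \<in> carrier A\<rbrakk> \<Longrightarrow> h (x \<oplus>\<^bsub>A\<^esub> y) = h x \<oplus>\<^bsub>B\<^esub> h y"
  "h \<one>\<^bsub>A\<^esub> = \<one>\<^bsub>B\<^esub>"
  using hom by (auto simp: ring_hom_def)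

lemma h_zero [simp]: "h \<zero>\<^bsub>A\<^esub> = \<zero>\<^bsub>B\<^esub>"
  using ring_hom_zero[OF hom] A.ring_axioms B.ring_axioms by simp

lemma h_minus [simp]:
  assumes "x \<in> carrier A" "y \<in> carrier A" shows "h (x \<ominus>\<^bsub>A\<^esub> y) = h x \<ominus>\<^bsub>B\<^esub> h y"
proof -
  have "(x \<ominus>\<^bsub>A\<^esub> y) \<oplus>\<^bsub>A\<^esub> y = x"
    using assms by (simp add: A.minus_eq A.a_assoc A.l_neg)
  then have e: "h (x \<ominus>\<^bsub>A\<^esub> y) \<oplus>\<^bsub>B\<^esub> h y = h x"
    using assms by (metis h_simps(3) A.minus_closed)
  show ?thesis unfolding e[symmetric] using assms by (simp add: B.minus_eq B.a_assoc B.r_neg)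
qed

lemma h_lin_comb:
  assumes "\<And>k. k < n \<Longrightarrow> a k \<in> carrier A" "\<And>k. k < n \<Longrightarrow> b k \<in> carrier A"
  shows "h (lin_comb A n a b) = lin_comb B n (\<lambda>k. h (a k)) (\<lambda>k. h (b k))"
  using assms by (induction n) (simp_all add: A.lin_comb_Suc B.lin_comb_Suc)

lemma mat_map_closed [simp]: "x \<in> mats A n \<Longrightarrow> mat_map n h x \<in> mats B n"
  by (auto simp: mat_carrier mat_map_def PiE_iff)

lemma vec_map_closed [simp]: "v \<in> vecs A n \<Longrightarrow> vec_map n h v \<in> vecs B n"
  by (auto simp: vec_map_def PiE_iff)

lemma mat_map_mult:
  assumes "x \<in> mats A n" "y \<in> mats A n"
  shows "mat_map n h (x \<otimes>\<^bsub>mat_ring A n\<^esub> y) = mat_map n h x \<otimes>\<^bsub>mat_ring B n\<^esub> mat_map n h y"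
proof (rule mat_ext[where A = B])
  fix i j assume ij: "i < n" "j < n"
  show "mat_map n h (x \<otimes>\<^bsub>mat_ring A n\<^esub> y) (i, j) = (mat_map n h x \<otimes>\<^bsub>mat_ring B n\<^esub> mat_map n h y) (i, j)"
    using ij mat_carrierD[OF assms(1)] mat_carrierD[OF assms(2)]
    by (auto simp: mat_entries h_lin_comb intro!: B.lin_comb_cong)
qed (use assms A.mat_closed B.mat_closed in auto)

lemma mat_map_one: "mat_map n h \<one>\<^bsub>mat_ring A n\<^esub> = \<one>\<^bsub>mat_ring B n\<^esub>"
  by (rule mat_ext[where A = B and n = n]) (simp_all add: mat_entries)

lemma mat_map_GL [simp]: "x \<in> GL A n \<Longrightarrow> mat_map n h x \<in> GL B n"
  by (rule B.GL_I[where h = "mat_map n h (inv\<^bsub>mat_ring A n\<^esub> x)"])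
    (simp_all flip: mat_map_mult add: mat_map_one)

lemma mat_map_inv: "x \<in> GL A n \<Longrightarrow> mat_map n h (inv\<^bsub>mat_ring A n\<^esub> x) = inv\<^bsub>mat_ring B n\<^esub> (mat_map n h x)"
  by (rule B.GL_inv_eq[symmetric]) (simp_all flip: mat_map_mult add: mat_map_one)

lemma vec_map_mat_vec:
  assumes "x \<in> mats A n" "v \<in> vecs A n"
  shows "vec_map n h (mat_vec A n x v) = mat_vec B n (mat_map n h x) (vec_map n h v)"
proof (rule vec_ext[where A = B])
  fix i assume i: "i < n"
  show "vec_map n h (mat_vec A n x v) i = mat_vec B n (mat_map n h x) (vec_map n h v) i"
    using i mat_carrierD[OF assms(1)] PiE_mem[OF assms(2)]
    by (auto simp: mat_vec_apply h_lin_comb intro!: B.lin_comb_cong)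
qed (use assms in auto)

lemma vec_map_Lg [simp]:
  assumes "v \<in> Lg A n" shows "vec_map n h v \<in> Lg B n"
proof -
  from assms obtain a where v: "v \<in> vecs A n" and a: "a \<in> vecs A n" and e: "lin_comb A n a v = \<one>\<^bsub>A\<^esub>"
    unfolding A.Lg_iff by (elim conjE bexE)
  note m = PiE_mem[OF v] PiE_mem[OF a]
  have "lin_comb B n (vec_map n h a) (vec_map n h v) = lin_comb B n (\<lambda>k. h (a k)) (\<lambda>k. h (v k))"
    using m by (intro B.lin_comb_cong) simp_all
  also have "\<dots> = \<one>\<^bsub>B\<^esub>" using m e by (subst h_lin_comb[symmetric]) simp_all
  finally show ?thesis unfolding B.Lg_iff using v a
    by (intro conjI bexI[of _ "vec_map n h a"] vec_map_closed)
qed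

end

section \<open>Complete normed rings\<close>

text \<open>Completeness is only ever used for sequences that converge geometrically with ratio \<open>1/2\<close>,
  and this form of it carries over to matrices entry by entry.\<close>

locale complete_normed_ring = ring R for R (structure) +
  fixes N :: "'a \<Rightarrow> real"
  assumes N_nonneg: "x \<in> carrier R \<Longrightarrow> 0 \<le> N x"
    and N_eq_0: "x \<in> carrier R \<Longrightarrow> N x = 0 \<longleftrightarrow> x = \<zero>"
    and N_add: "\<lbrakk>x \<in> carrier R; y \<in> carrier R\<rbrakk> \<Longrightarrow> N (x \<oplus> y) \<le> N x + N y"
    and N_uminus: "x \<in> carrier R \<Longrightarrow> N (\<ominus> x) = N x"
    and N_mult: "\<lbrakk>x \<in> carrier R; y \<in> carrier R\<rbrakk> \<Longrightarrow> N (x \<otimes> y) \<le> N x * N y"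
    and N_geometric: "\<lbrakk>\<And>k. f k \<in> carrier R; \<And>k. N (f (Suc k) \<ominus> f k) \<le> c * (1/2) ^ k\<rbrakk>
      \<Longrightarrow> \<exists>l\<in>carrier R. \<exists>C. \<forall>k. N (l \<ominus> f k) \<le> C * (1/2) ^ k"
begin

text \<open>The way in which equations pass to a limit: the difference of the two sides stays below
  every term of a null sequence.\<close>

lemma N_geometric_null:
  assumes "x \<in> carrier R" "\<And>k. N x \<le> c * (1/2) ^ k" shows "x = \<zero>"
proof -
  have "(\<lambda>k. c * (1/2) ^ k :: real) \<longlonglongrightarrow> c * 0"
    by (intro tendsto_mult tendsto_const LIMSEQ_power_zero) simp
  then have "N x \<le> c * 0"
    by (rule LIMSEQ_le_const) (use assms in auto)
  then show ?thesis using N_nonneg[OF assms(1)] N_eq_0[OF assms(1)] by simp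
qed

lemma N_minus_triangle:
  assumes "x \<in> carrier R" "y \<in> carrier R" "z \<in> carrier R"
  shows "N (x \<ominus> z) \<le> N (x \<ominus> y) + N (y \<ominus> z)"
proof -
  have "x \<ominus> z = (x \<ominus> y) \<oplus> (y \<ominus> z)"
    using assms by (simp add: a_minus_def a_assoc r_neg1)
  then show ?thesis using N_add assms by simp
qed

lemma N_minus_commute:
  assumes "x \<in> carrier R" "y \<in> carrier R" shows "N (x \<ominus> y) = N (y \<ominus> x)"
proof -
  have "\<ominus> (x \<ominus> y) = y \<ominus> x"
    using assms by (simp add: a_minus_def minus_add a_comm)
  then show ?thesis using N_uminus[of "x \<ominus> y"] assms by simp
qed

lemma mult_minus_distrib:
  assumes "x \<in> carrier R" "y \<in> carrier R" "z \<in> carrier R"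
  shows "z \<otimes> (x \<ominus> y) = z \<otimes> x \<ominus> z \<otimes> y" "(x \<ominus> y) \<otimes> z = x \<otimes> z \<ominus> y \<otimes> z"
  using assms by (simp_all add: a_minus_def l_distr r_distr l_minus r_minus)

text \<open>The inverse is the limit of the partial sums \<open>S k\<close> of the Neumann series.\<close>

lemma one_minus_Unit:
  assumes a: "a \<in> carrier R" "N a \<le> 1/2" shows "\<one> \<ominus> a \<in> Units R"
proof -
  define S where "S = rec_nat \<one> (\<lambda>_ s. \<one> \<oplus> a \<otimes> s)"
  have S: "S 0 = \<one>" "S (Suc k) = \<one> \<oplus> a \<otimes> S k" for k by (simp_all add: S_def)
  have Sc: "S k \<in> carrier R" for k by (induction k) (simp_all add: S a)
  \<comment> \<open>Commutation gives the limit both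
    \<open>l = \<one> \<oplus> a \<otimes> l\<close> and
    \<open>l = \<one> \<oplus> l \<otimes> a\<close>, hence a two-sided inverse.\<close>
  have comm: "S k \<otimes> a = a \<otimes> S k" for k
    by (induction k) (simp_all add: S a Sc l_distr r_distr m_assoc)
  have diff: "(\<one> \<oplus> x) \<ominus> (\<one> \<oplus> y) = x \<ominus> y" if "x \<in> carrier R" "y \<in> carrier R" for x y
  proof -
    have "(\<one> \<oplus> x) \<ominus> (\<one> \<oplus> y) = (\<one> \<oplus> \<ominus> \<one>) \<oplus> (x \<ominus> y)"
      using that by (simp only: a_minus_def minus_add a_ac a_closed a_inv_closed one_closed)
    then show ?thesis using that by (simp add: r_neg)
  qed
  have cancel: "(x \<oplus> y) \<ominus> y = x" if "x \<in> carrier R" "y \<in> carrier R" for x y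
    using that by (simp add: a_minus_def a_assoc r_neg)
  have small: "N (S (Suc k) \<ominus> S k) \<le> 1/2 * (1/2) ^ k" for k
  proof (induction k)
    case 0
    have "S (Suc 0) \<ominus> S 0 = a" using a cancel[of a \<one>] by (simp add: S a_comm)
    then show ?case using a by simp
  next
    case (Suc k)
    have "S (Suc (Suc k)) \<ominus> S (Suc k) = a \<otimes> (S (Suc k) \<ominus> S k)"
      unfolding S(2)[of "Suc k"] S(2)[of k] diff[OF m_closed[OF a(1) a_closed[OF one_closed m_closed[OF a(1) Sc]]] m_closed[OF a(1) Sc]]
      using a Sc by (simp add: mult_minus_distrib)
    then have "N (S (Suc (Suc k)) \<ominus> S (Suc k)) \<le> N a * N (S (Suc k) \<ominus> S k)"
      using N_mult a Sc by simp
    also have "\<dots> \<le> 1/2 * (1/2 * (1/2) ^ k)"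
      by (intro mult_mono Suc a N_nonneg minus_closed Sc) auto
    finally show ?case by simp
  qed
  obtain l C where l: "l \<in> carrier R" and le: "\<And>k. N (l \<ominus> S k) \<le> C * (1/2) ^ k"
    using N_geometric[OF Sc small] by blast
  have le': "N (l \<ominus> S k) \<le> C * (1/2) ^ k" "N (S k \<ominus> l) \<le> C * (1/2) ^ k" for k
    using le[of k] N_minus_commute[OF l Sc, of k] by simp_all
  have C: "0 \<le> C" using le[of 0] N_nonneg[of "l \<ominus> S 0"] l Sc by simp
  have "N (l \<ominus> (\<one> \<oplus> a \<otimes> l)) \<le> C * (1/2) ^ k" for k
  proof -
    have "N (S (Suc k) \<ominus> (\<one> \<oplus> a \<otimes> l)) \<le> N a * N (S k \<ominus> l)"
      using N_mult[of a "S k \<ominus> l"] a Sc l by (simp add: S diff mult_minus_distrib)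
    also have "\<dots> \<le> 1/2 * (C * (1/2) ^ k)"
      by (intro mult_mono a le' N_nonneg minus_closed Sc l) auto
    finally show ?thesis
      using N_minus_triangle[of l "S (Suc k)" "\<one> \<oplus> a \<otimes> l"] le'(1)[of "Suc k"] a Sc l by simp
  qed
  then have "l \<ominus> (\<one> \<oplus> a \<otimes> l) = \<zero>" by (rule N_geometric_null[rotated]) (use a l in simp)
  then have 1: "l = \<one> \<oplus> a \<otimes> l" using a l by simp
  have "N (l \<ominus> (\<one> \<oplus> l \<otimes> a)) \<le> C * (1/2) ^ k" for k
  proof -
    have "N (S (Suc k) \<ominus> (\<one> \<oplus> l \<otimes> a)) \<le> N (S k \<ominus> l) * N a"
      using N_mult[of "S k \<ominus> l" a] a Sc l by (simp add: S diff comm[symmetric] mult_minus_distrib)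
    also have "\<dots> \<le> C * (1/2) ^ k * (1/2)"
      by (intro mult_mono a le' N_nonneg minus_closed Sc l) (auto simp: C)
    finally show ?thesis
      using N_minus_triangle[of l "S (Suc k)" "\<one> \<oplus> l \<otimes> a"] le'(1)[of "Suc k"] a Sc l by simp
  qed
  then have "l \<ominus> (\<one> \<oplus> l \<otimes> a) = \<zero>" by (rule N_geometric_null[rotated]) (use a l in simp)
  then have 2: "l = \<one> \<oplus> l \<otimes> a" using a l by simp
  have "(\<one> \<ominus> a) \<otimes> l = l \<ominus> a \<otimes> l" "l \<otimes> (\<one> \<ominus> a) = l \<ominus> l \<otimes> a"
    using a l by (simp_all add: mult_minus_distrib)
  moreover have "l \<ominus> a \<otimes> l = \<one>" "l \<ominus> l \<otimes> a = \<one>"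
    using arg_cong[OF 1, of "\<lambda>t. t \<ominus> a \<otimes> l"] arg_cong[OF 2, of "\<lambda>t. t \<ominus> l \<otimes> a"] a l
    by (simp_all add: cancel)
  ultimately show ?thesis
    unfolding Units_def using a l by (intro CollectI conjI bexI[of _ l]) simp_all
qed

end

sublocale unital_cstar_algebra \<subseteq> coeff_ring A ..

lemma (in unital_cstar_algebra) nrm_geometric:
  assumes f: "\<And>k. f k \<in> carrier A" and s: "\<And>k. nrm A (f (Suc k) \<ominus> f k) \<le> c * (1/2) ^ k"
  shows "\<exists>l\<in>carrier A. \<forall>k. nrm A (l \<ominus> f k) \<le> 2 * c * (1/2) ^ k"
proof -
  \<comment> \<open>The factor \<open>1 - (1/2) ^ m\<close> comes from the finite geometric sum and
    makes the induction on \<open>m\<close> exact.\<close>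
  have b: "nrm A (f (k + m) \<ominus> f k) \<le> 2 * c * (1/2) ^ k * (1 - (1/2) ^ m)" for k m
  proof (induction m)
    case 0
    then show ?case using f by (simp add: a_minus_def r_neg)
  next
    case (Suc m)
    have "nrm A (f (k + Suc m) \<ominus> f k) \<le> c * (1/2) ^ (k + m) + 2 * c * (1/2) ^ k * (1 - (1/2) ^ m)"
      using nrm_minus_triangle[of "f (k + Suc m)" "f (k + m)" "f k"] s[of "k + m"] Suc f by simp
    also have "\<dots> = 2 * c * (1/2) ^ k * (1 - (1/2) ^ Suc m)"
      by (simp add: power_add algebra_simps)
    finally show ?case .
  qed
  have "0 \<le> c" using s[of 0] nrm_nonneg[of "f (Suc 0) \<ominus> f 0"] f by simp
  then have b': "nrm A (f n \<ominus> f k) \<le> 2 * c * (1/2) ^ k" if "k \<le> n" for k n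
    using b[of k "n - k"] that mult_left_le[of "1 - (1/2) ^ (n - k)" "2 * c * (1/2) ^ k"] by simp
  have lim: "(\<lambda>k. 2 * c * (1/2) ^ k) \<longlonglongrightarrow> 2 * c * 0"
    by (intro tendsto_mult tendsto_const LIMSEQ_power_zero) simp
  have "metric.MCauchy f"
    unfolding metric.MCauchy_def
  proof (intro conjI allI impI)
    show "range f \<subseteq> carrier A" using f by blast
    fix e :: real assume "e > 0"
    then obtain M where M: "\<And>k. k \<ge> M \<Longrightarrow> 2 * c * (1/2) ^ k < e"
      using order_tendstoD(2)[OF lim, of e] by (auto simp: eventually_sequentially)
    have "cstar_dist A (f n) (f n') < e" if "M \<le> n" "M \<le> n'" for n n'
    proof (cases "n \<le> n'")
      case True
      then show ?thesis using b'[OF True] M[OF that(1)] f nrm_minus_commute[of "f n" "f n'"]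
        by (simp add: cstar_dist_def)
    next
      case False
      then show ?thesis using b'[of n' n] M[OF that(2)] f by (simp add: cstar_dist_def)
    qed
    then show "\<exists>N. \<forall>n n'. N \<le> n \<longrightarrow> N \<le> n' \<longrightarrow> cstar_dist A (f n) (f n') < e" by blast
  qed
  then obtain l where "limitin metric.mtopology f l sequentially"
    using complete unfolding metric.mcomplete_def by blast
  then have l: "l \<in> carrier A" "\<And>e. e > 0 \<Longrightarrow> \<forall>\<^sub>F n in sequentially. cstar_dist A (f n) l < e"
    unfolding metric.limitin_metric by (auto elim: eventually_mono)
  have "nrm A (l \<ominus> f k) \<le> 2 * c * (1/2) ^ k" for k
  proof (rule field_le_epsilon)
    fix e :: real assume "e > 0"
    then obtain n where n: "n \<ge> k" "cstar_dist A (f n) l < e"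
      using l(2) unfolding eventually_sequentially by (meson nle_le)
    then show "nrm A (l \<ominus> f k) \<le> 2 * c * (1/2) ^ k + e"
      using b'[OF n(1)] nrm_minus_triangle[of l "f n" "f k"] nrm_minus_commute[of l "f n"] l f
      by (simp add: cstar_dist_def)
  qed
  then show "\<exists>l\<in>carrier A. \<forall>k. nrm A (l \<ominus> f k) \<le> 2 * c * (1/2) ^ k" using l(1) by blast
qed

lemma (in unital_cstar_algebra) complete_normed_ring: "complete_normed_ring A (nrm A)"
proof
  fix f :: "nat \<Rightarrow> 'a" and c :: real
  assume "\<And>k. f k \<in> carrier A" "\<And>k. nrm A (f (Suc k) \<ominus> f k) \<le> c * (1/2) ^ k"
  then show "\<exists>l\<in>carrier A. \<exists>C. \<forall>k. nrm A (l \<ominus> f k) \<le> C * (1/2) ^ k"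
    by (meson nrm_geometric)
qed (simp_all add: nrm_nonneg nrm_eq_0 nrm_add nrm_uminus nrm_mult)

text \<open>The sum over all entries is submultiplicative and induces entrywise convergence, so it
  can stand in for the C*-norm of \<open>M\<^sub>n(A)\<close>. The price is a factor
  \<open>real n * real n\<close> whenever a bound on the entries becomes a bound on the
  matrix.\<close>

definition mat_nrm :: "('a, 'm) cstar_alg_scheme \<Rightarrow> nat \<Rightarrow> (nat \<times> nat \<Rightarrow> 'a) \<Rightarrow> real" where
  "mat_nrm A n x = (\<Sum>i<n. \<Sum>j<n. nrm A (x (i, j)))"

context unital_cstar_algebra
begin

lemma nrm_lin_comb:
  assumes "\<And>k. k < n \<Longrightarrow> a k \<in> carrier A" "\<And>k. k < n \<Longrightarrow> b k \<in> carrier A"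
  shows "nrm A (lin_comb A n a b) \<le> (\<Sum>k<n. nrm A (a k) * nrm A (b k))"
  using assms
proof (induction n)
  case (Suc n)
  have "nrm A (lin_comb A (Suc n) a b) \<le> nrm A (lin_comb A n a b) + nrm A (a n \<otimes> b n)"
    using Suc.prems by (subst lin_comb_Suc) (simp_all add: nrm_add)
  also have "\<dots> \<le> (\<Sum>k<n. nrm A (a k) * nrm A (b k)) + nrm A (a n) * nrm A (b n)"
    using Suc by (intro add_mono nrm_mult) simp_all
  finally show ?case by simp
qed simp

lemma nrm_entry_le:
  assumes "x \<in> mats A n" "i < n" "j < n"
  shows "nrm A (x (i, j)) \<le> mat_nrm A n x"
proof -
  note e = mat_carrierD[OF assms(1)]
  have "nrm A (x (i, j)) \<le> (\<Sum>j<n. nrm A (x (i, j)))"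
    by (rule member_le_sum[where f = "\<lambda>j. nrm A (x (i, j))"]) (use e assms nrm_nonneg in simp_all)
  also have "\<dots> \<le> mat_nrm A n x" unfolding mat_nrm_def
    by (rule member_le_sum[where f = "\<lambda>i. \<Sum>j<n. nrm A (x (i, j))"])
      (use assms(2) in \<open>auto intro!: sum_nonneg nrm_nonneg e\<close>)
  finally show ?thesis .
qed

lemma mat_nrm_bound:
  assumes "\<And>i j. \<lbrakk>i < n; j < n\<rbrakk> \<Longrightarrow> nrm A (x (i, j)) \<le> e"
  shows "mat_nrm A n x \<le> real n * real n * e"
proof -
  have "mat_nrm A n x \<le> (\<Sum>i<n. \<Sum>j<n. e)"
    unfolding mat_nrm_def by (intro sum_mono assms) simp_all
  then show ?thesis by simp
qed

lemma mat_complete_normed_ring: "complete_normed_ring (mat_ring A n) (mat_nrm A n)"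
proof -
  interpret Mn: ring "mat_ring A n" by (rule ring_mat)
  note d = mat_carrierD
  show ?thesis
  proof
    fix x assume x: "x \<in> mats A n"
    show "0 \<le> mat_nrm A n x" unfolding mat_nrm_def by (auto intro!: sum_nonneg nrm_nonneg d[OF x])
    show "mat_nrm A n x = 0 \<longleftrightarrow> x = \<zero>\<^bsub>mat_ring A n\<^esub>"
    proof
      assume z: "mat_nrm A n x = 0"
      show "x = \<zero>\<^bsub>mat_ring A n\<^esub>"
      proof (rule mat_ext[where A = A and n = n])
        fix i j assume "i < n" "j < n"
        then show "x (i, j) = \<zero>\<^bsub>mat_ring A n\<^esub> (i, j)"
          using nrm_entry_le[OF x, of i j] d[OF x, of i j] nrm_nonneg[of "x (i, j)"] nrm_eq_0[of "x (i, j)"] z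
          by (simp add: mat_entries)
      qed (use x in simp_all)
    qed (simp add: mat_nrm_def mat_entries)
    have "(\<ominus>\<^bsub>mat_ring A n\<^esub> x) (i, j) = \<ominus> x (i, j)" if "i < n" "j < n" for i j
      using mat_minus[OF Mn.zero_closed x that] that d[OF x] x by (simp add: Mn.minus_eq mat_entries a_minus_def)
    then show "mat_nrm A n (\<ominus>\<^bsub>mat_ring A n\<^esub> x) = mat_nrm A n x"
      using d[OF x] by (simp add: mat_nrm_def nrm_uminus)
  next
    fix x y assume x: "x \<in> mats A n" and y: "y \<in> mats A n"
    show "mat_nrm A n (x \<oplus>\<^bsub>mat_ring A n\<^esub> y) \<le> mat_nrm A n x + mat_nrm A n y"
      unfolding mat_nrm_def sum.distrib[symmetric]
      by (intro sum_mono) (simp add: mat_entries nrm_add d[OF x] d[OF y])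
    have r: "(\<Sum>j<n. nrm A (y (k, j))) \<le> mat_nrm A n y" if "k < n" for k
      unfolding mat_nrm_def using that
      by (intro member_le_sum[where f = "\<lambda>i. \<Sum>j<n. nrm A (y (i, j))"])
        (auto intro!: sum_nonneg nrm_nonneg d[OF y])
    have "mat_nrm A n (x \<otimes>\<^bsub>mat_ring A n\<^esub> y)
        \<le> (\<Sum>i<n. \<Sum>j<n. \<Sum>k<n. nrm A (x (i, k)) * nrm A (y (k, j)))"
      unfolding mat_nrm_def using d[OF x] d[OF y]
      by (intro sum_mono) (simp add: mat_entries nrm_lin_comb)
    also have "\<dots> = (\<Sum>i<n. \<Sum>k<n. nrm A (x (i, k)) * (\<Sum>j<n. nrm A (y (k, j))))"
      by (rule sum.cong[OF refl], unfold sum_distrib_left, rule sum.swap)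
    also have "\<dots> \<le> (\<Sum>i<n. \<Sum>k<n. nrm A (x (i, k)) * mat_nrm A n y)"
      using d[OF x] r by (intro sum_mono mult_left_mono) (simp_all add: nrm_nonneg)
    also have "\<dots> = mat_nrm A n x * mat_nrm A n y"
      by (simp add: mat_nrm_def[of A n x] sum_distrib_right)
    finally show "mat_nrm A n (x \<otimes>\<^bsub>mat_ring A n\<^esub> y) \<le> mat_nrm A n x * mat_nrm A n y" .
  next
    fix f :: "nat \<Rightarrow> nat \<times> nat \<Rightarrow> 'a" and c :: real
    assume f: "\<And>k. f k \<in> mats A n"
      and s: "\<And>k. mat_nrm A n (f (Suc k) \<ominus>\<^bsub>mat_ring A n\<^esub> f k) \<le> c * (1/2) ^ k"
    have "\<exists>l\<in>carrier A. \<forall>k. nrm A (l \<ominus> f k (i, j)) \<le> 2 * c * (1/2) ^ k" if ij: "i < n" "j < n" for i j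
    proof (rule nrm_geometric)
      show "nrm A (f (Suc k) (i, j) \<ominus> f k (i, j)) \<le> c * (1/2) ^ k" for k
        using nrm_entry_le[OF Mn.minus_closed[OF f f] ij, of "Suc k" k] s[of k]
        by (simp add: mat_minus[OF f f ij])
    qed (rule d[OF f ij])
    then obtain l where l: "\<And>i j. \<lbrakk>i < n; j < n\<rbrakk> \<Longrightarrow> l i j \<in> carrier A"
      "\<And>i j k. \<lbrakk>i < n; j < n\<rbrakk> \<Longrightarrow> nrm A (l i j \<ominus> f k (i, j)) \<le> 2 * c * (1/2) ^ k"
      by metis
    define L where "L = (\<lambda>(i, j)\<in>{..<n} \<times> {..<n}. l i j)"
    have L: "L \<in> mats A n" using l(1) by (auto simp: L_def mat_carrier)
    have "mat_nrm A n (L \<ominus>\<^bsub>mat_ring A n\<^esub> f k) \<le> real n * real n * (2 * c * (1/2) ^ k)" for k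
      by (rule mat_nrm_bound) (simp add: mat_minus[OF L f], simp add: L_def l(2))
    then have "mat_nrm A n (L \<ominus>\<^bsub>mat_ring A n\<^esub> f k) \<le> real n * real n * (2 * c) * (1/2) ^ k" for k
      by (simp add: mult.assoc)
    with L show "\<exists>l\<in>mats A n. \<exists>C. \<forall>k. mat_nrm A n (l \<ominus>\<^bsub>mat_ring A n\<^esub> f k) \<le> C * (1/2) ^ k"
      by blast
  qed
qed

end

section \<open>Homomorphisms of C*-algebras\<close>

context unital_cstar_algebra
begin

lemmas nrm_geometric_null = complete_normed_ring.N_geometric_null[OF complete_normed_ring]
lemmas mult_minus_distrib = complete_normed_ring.mult_minus_distrib[OF complete_normed_ring]

lemma nrm_minus_le:
  assumes "x \<in> carrier A" "y \<in> carrier A" shows "nrm A (x \<ominus> y) \<le> nrm A x + nrm A y"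
  using nrm_add[of x "\<ominus> y"] assms by (simp add: a_minus_def nrm_uminus)

lemma smult_closed' [simp]: "x \<in> carrier A \<Longrightarrow> c \<odot> x \<in> carrier A"
  by (rule smult_closed) simp_all

lemma smult_add_right: "\<lbrakk>x \<in> carrier A; y \<in> carrier A\<rbrakk> \<Longrightarrow> c \<odot> (x \<oplus> y) = c \<odot> x \<oplus> c \<odot> y"
  by (rule smult_r_distr) simp_all

lemma minus_add_minus:
  assumes "x \<in> carrier A" "y \<in> carrier A" "z \<in> carrier A" "w \<in> carrier A"
  shows "(x \<ominus> y) \<ominus> (z \<ominus> w) = (x \<ominus> z) \<ominus> (y \<ominus> w)"
  using assms by (simp add: a_minus_def minus_add a_ac)

lemma add_minus_cancel:
  assumes "x \<in> carrier A" "y \<in> carrier A"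
  shows "(x \<oplus> y) \<ominus> y = x" "(y \<oplus> x) \<ominus> y = x" "(x \<ominus> y) \<oplus> y = x" "y \<oplus> (x \<ominus> y) = x"
  using assms a_comm[of x y] a_comm[of "x \<ominus> y" y] by (simp_all add: a_minus_def a_assoc r_neg l_neg)

lemma adj_one: "adj A \<one> = \<one>"
proof -
  have "adj A (adj A \<one> \<otimes> \<one>) = adj A \<one> \<otimes> adj A (adj A \<one>)"
    by (rule adj_mult) (simp_all add: adj_closed)
  then show ?thesis by (simp add: adj_closed adj_adj)
qed

lemma nrm_one_le: "nrm A \<one> \<le> 1"
proof -
  have "nrm A \<one> = (nrm A \<one>)\<^sup>2" using nrm_adj_mult[of \<one>] by (simp add: adj_one)
  then have "nrm A \<one> * (nrm A \<one> - 1) = 0" by (simp add: power2_eq_square algebra_simps)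
  then show ?thesis by auto
qed

text \<open>The square root is \<open>1 - y\<close>, where \<open>y\<close> is the fixed point of \<open>y \<mapsto> (a\<^sup>2 + y\<^sup>2) / 2\<close>.\<close>

lemma sqrt_one_minus_square:
  assumes a: "a \<in> carrier A" "adj A a = a" "nrm A a \<le> 1/2"
  shows "\<exists>s\<in>carrier A. adj A s = s \<and> s \<otimes> a = a \<otimes> s \<and> s \<otimes> s = \<one> \<ominus> a \<otimes> a"
proof -
  define b where "b = a \<otimes> a"
  have b: "b \<in> carrier A" "adj A b = b" using a by (simp_all add: b_def adj_mult)
  have ba: "b \<otimes> a = a \<otimes> b" using a by (simp add: b_def m_assoc)
  have "nrm A b \<le> nrm A a * nrm A a" unfolding b_def using a by (intro nrm_mult)
  also have "\<dots> \<le> 1/2 * (1/2)" using a by (intro mult_mono) (simp_all add: nrm_nonneg)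
  finally have nb: "nrm A b \<le> 1/4" by simp
  define T where "T y = (1/2) \<odot> (b \<oplus> y \<otimes> y)" for y
  have T: "T y \<in> carrier A" if "y \<in> carrier A" for y using that b by (simp add: T_def)
  have nT: "nrm A (T y) \<le> 1/2 * (1/4 + nrm A y * nrm A y)" if "y \<in> carrier A" for y
  proof -
    have "nrm A (b \<oplus> y \<otimes> y) \<le> nrm A b + nrm A (y \<otimes> y)" using that b by (intro nrm_add) simp_all
    also have "\<dots> \<le> 1/4 + nrm A y * nrm A y" using nb nrm_mult[OF that that] by simp
    finally show ?thesis using that b by (simp add: T_def nrm_smult norm_divide)
  qed
  have dT: "nrm A (T u \<ominus> T v) \<le> 1/2 * (nrm A (u \<ominus> v) * (nrm A (u \<ominus> v) + 2 * nrm A v))"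
    if uv: "u \<in> carrier A" "v \<in> carrier A" for u v
  proof -
    have "T u \<ominus> T v = (1/2) \<odot> ((b \<oplus> u \<otimes> u) \<ominus> (b \<oplus> v \<otimes> v))"
      unfolding T_def using uv b by (subst smult_minus_right) simp_all
    then have "nrm A (T u \<ominus> T v) = 1/2 * nrm A ((b \<oplus> u \<otimes> u) \<ominus> (b \<oplus> v \<otimes> v))"
      using uv b by (simp add: nrm_smult norm_divide)
    also have "nrm A ((b \<oplus> u \<otimes> u) \<ominus> (b \<oplus> v \<otimes> v)) \<le> nrm A (b \<ominus> b) + nrm A (u \<otimes> u \<ominus> v \<otimes> v)"
      using uv b by (intro nrm_add_diff) simp_all
    also have "nrm A (b \<ominus> b) = 0" using nrm_minus_eq_0[of b b] b by simp
    also have "nrm A (u \<otimes> u \<ominus> v \<otimes> v) \<le> nrm A (u \<ominus> v) * (nrm A (u \<ominus> v) + nrm A v) + nrm A v * nrm A (u \<ominus> v)"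
      using uv by (intro nrm_mult_diff)
    finally show ?thesis by (simp add: algebra_simps)
  qed
  define y where "y = rec_nat \<zero> (\<lambda>_. T)"
  have y: "y 0 = \<zero>" "y (Suc k) = T (y k)" for k by (simp_all add: y_def)
  have yc: "y k \<in> carrier A" for k by (induction k) (simp_all add: y T)
  \<comment> \<open>As \<open>b\<close> has norm at most 1/4, the ball of radius 1/4 is mapped into
    itself. For successive iterates at distance \<open>e\<close> the factor
    \<open>e + 2 * nrm A (y k)\<close> from \<open>dT\<close> is then at most 1, which leaves the
    contraction ratio 1/2.\<close>
  have yn: "nrm A (y k) \<le> 1/4" for k
  proof (induction k)
    case (Suc k)
    have "nrm A (y k) * nrm A (y k) \<le> 1/4 * (1/4)"
      using Suc by (intro mult_mono) (simp_all add: nrm_nonneg yc)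
    then show ?case using nT[OF yc[of k]] by (simp add: y)
  qed (simp add: y)
  have ya: "adj A (y k) = y k" for k
  proof (induction k)
    case 0
    have "adj A \<zero> = \<zero>" using adj_smult[of \<zero> 0] adj_closed[of \<zero>] by (simp add: smult_l_null[simplified] smult_r_null)
    then show ?case by (simp add: y)
  next
    case (Suc k)
    then show ?case using b yc by (simp add: y T_def adj_smult adj_add adj_mult)
  qed
  have yac: "y k \<otimes> a = a \<otimes> y k" for k
  proof (induction k)
    case (Suc k)
    have "(y k \<otimes> y k) \<otimes> a = a \<otimes> (y k \<otimes> y k)"
      using Suc yc[of k] a by (metis m_assoc)
    then show ?case using b ba yc[of k] a
      by (simp add: y T_def smult_mult_left smult_mult_right l_distr r_distr)
  qed (use a in \<open>simp add: y\<close>)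
  have "nrm A (y (Suc k) \<ominus> y k) \<le> 1 * (1/2) ^ k" for k
  proof (induction k)
    case 0
    show ?case using nrm_minus_le[OF yc yc, of "Suc 0" 0] yn[of 0] yn[of "Suc 0"] by simp
  next
    case (Suc k)
    define e where "e = nrm A (y (Suc k) \<ominus> y k)"
    have e: "0 \<le> e" "e \<le> 1/2" "e \<le> (1/2) ^ k"
      using nrm_nonneg[of "y (Suc k) \<ominus> y k"] nrm_minus_le[OF yc yc, of "Suc k" k] yn[of k] yn[of "Suc k"] yc Suc
      by (simp_all add: e_def)
    have "nrm A (y (Suc (Suc k)) \<ominus> y (Suc k)) \<le> 1/2 * (e * (e + 2 * nrm A (y k)))"
      using dT[OF yc yc, of "Suc k" k] by (simp add: y(2)[symmetric] e_def)
    also have "\<dots> \<le> 1/2 * (e * 1)"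
      using e yn[of k] by (intro mult_left_mono) simp_all
    finally show ?case using e by simp
  qed
  then obtain l where l: "l \<in> carrier A" and le: "\<And>k. nrm A (l \<ominus> y k) \<le> 2 * (1/2) ^ k"
    using nrm_geometric[of y 1, OF yc] by auto
  have le': "nrm A (y k \<ominus> l) \<le> 2 * (1/2) ^ k" for k
    using le[of k] nrm_minus_commute[OF l yc, of k] by simp
  have "nrm A (l \<ominus> T l) \<le> (3 + 2 * nrm A l) * (1/2) ^ k" for k
  proof -
    have p: "(1/2) ^ k \<le> (1::real)" by (simp add: power_le_one)
    have "nrm A (y (Suc k) \<ominus> T l) \<le> 1/2 * (nrm A (y k \<ominus> l) * (nrm A (y k \<ominus> l) + 2 * nrm A l))"
      unfolding y(2) by (rule dT[OF yc l])
    also have "\<dots> \<le> 1/2 * (2 * (1/2) ^ k * (2 + 2 * nrm A l))"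
      using le'[of k] p nrm_nonneg[OF l] nrm_nonneg[of "y k \<ominus> l"] yc l
      by (intro mult_left_mono mult_mono) simp_all
    finally have 1: "nrm A (y (Suc k) \<ominus> T l) \<le> (1/2) ^ k * (2 + 2 * nrm A l)" by simp
    have "nrm A (l \<ominus> T l) \<le> nrm A (l \<ominus> y (Suc k)) + nrm A (y (Suc k) \<ominus> T l)"
      by (rule nrm_minus_triangle) (use l yc T in simp_all)
    also have "\<dots> \<le> (1/2) ^ k + (1/2) ^ k * (2 + 2 * nrm A l)"
      using le[of "Suc k"] 1 by simp
    finally show ?thesis by (simp add: algebra_simps)
  qed
  then have "l \<ominus> T l = \<zero>" by (rule nrm_geometric_null[rotated]) (use l T in simp)
  then have lT: "l = T l" using l T by simp
  have "l \<oplus> l = (1/2 + 1/2) \<odot> (b \<oplus> l \<otimes> l)"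
    using l b arg_cong2[OF lT lT, of "(\<oplus>)"] by (simp only: T_def) (subst smult_add_left, simp_all)
  then have l2: "l \<oplus> l = b \<oplus> l \<otimes> l" using l b by simp
  have "nrm A (adj A l \<ominus> l) \<le> 4 * (1/2) ^ k" for k
  proof -
    have "nrm A (adj A l \<ominus> l) \<le> nrm A (adj A l \<ominus> adj A (y k)) + nrm A (y k \<ominus> l)"
      using nrm_minus_triangle[of "adj A l" "y k" l] l yc adj_closed by (simp add: ya)
    then show ?thesis using le[of k] le'[of k] nrm_adj_diff[OF l yc] by simp
  qed
  then have "adj A l \<ominus> l = \<zero>" by (rule nrm_geometric_null[rotated]) (use l adj_closed in simp)
  then have la: "adj A l = l" using l adj_closed by simp
  have "nrm A (l \<otimes> a \<ominus> a \<otimes> l) \<le> (4 * nrm A a) * (1/2) ^ k" for k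
  proof -
    have "nrm A (l \<otimes> a \<ominus> a \<otimes> l) \<le> nrm A (l \<otimes> a \<ominus> y k \<otimes> a) + nrm A (a \<otimes> y k \<ominus> a \<otimes> l)"
      using nrm_minus_triangle[of "l \<otimes> a" "y k \<otimes> a" "a \<otimes> l"] l yc a by (simp add: yac)
    also have "\<dots> \<le> nrm A (l \<ominus> y k) * nrm A a + nrm A a * nrm A (y k \<ominus> l)"
      using l yc a by (intro add_mono) (simp_all flip: mult_minus_distrib add: nrm_mult)
    also have "\<dots> \<le> 2 * (1/2) ^ k * nrm A a + nrm A a * (2 * (1/2) ^ k)"
      using le le' by (intro add_mono mult_mono) (simp_all add: nrm_nonneg l yc a)
    finally show ?thesis by (simp add: algebra_simps)
  qed
  then have "l \<otimes> a \<ominus> a \<otimes> l = \<zero>" by (rule nrm_geometric_null[rotated]) (use l a in simp)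
  then have lc: "l \<otimes> a = a \<otimes> l" using l a by simp
  define s where "s = \<one> \<ominus> l"
  have sc: "s \<in> carrier A" using l by (simp add: s_def)
  \<comment> \<open>Here \<open>l2\<close> turns \<open>l \<oplus> l\<close> into
    \<open>b \<oplus> l \<otimes> l\<close>, and the squares of \<open>l\<close> cancel.\<close>
  have "s \<otimes> s = (\<one> \<ominus> l) \<ominus> (l \<ominus> l \<otimes> l)" using l by (simp add: s_def mult_minus_distrib)
  also have "\<dots> = (\<one> \<ominus> (l \<oplus> l)) \<oplus> l \<otimes> l" using l by (simp add: a_minus_def minus_add a_ac)
  also have "\<dots> = ((\<one> \<ominus> b) \<ominus> l \<otimes> l) \<oplus> l \<otimes> l" unfolding l2 using l b by (simp add: a_minus_def minus_add a_ac)
  also have "\<dots> = \<one> \<ominus> b" using l b by (simp add: add_minus_cancel)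
  finally have "s \<otimes> s = \<one> \<ominus> b" .
  moreover have "adj A s = s"
    using l by (simp add: s_def a_minus_def adj_add adj_uminus adj_one la)
  moreover have "s \<otimes> a = a \<otimes> s"
    using l a by (simp add: s_def mult_minus_distrib lc)
  ultimately show ?thesis using sc unfolding b_def by blast
qed

end

locale cstar_morphism = A: unital_cstar_algebra A + B: unital_cstar_algebra B
  for A :: "('a, 'm) cstar_alg_scheme" and B :: "('b, 'n) cstar_alg_scheme" +
  fixes h
  assumes cstar_hom: "h \<in> cstar_hom A B"

sublocale cstar_morphism \<subseteq> coeff_hom A B h
  by unfold_locales (use cstar_hom in \<open>simp add: cstar_hom_def\<close>)

context cstar_morphism
begin

lemma h_smult [simp]: "x \<in> carrier A \<Longrightarrow> h (c \<odot>\<^bsub>A\<^esub> x) = c \<odot>\<^bsub>B\<^esub> h x"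
  using cstar_hom by (simp add: cstar_hom_def)

lemma h_adj [simp]: "x \<in> carrier A \<Longrightarrow> h (adj A x) = adj B (h x)"
  using cstar_hom by (simp add: cstar_hom_def)

text \<open>\<open>h a + i h (sqrt (1 - a\<^sup>2))\<close> is unitary and has real part \<open>h a\<close>.\<close>

lemma nrm_h_selfadjoint_le_1:
  assumes a: "a \<in> carrier A" "adj A a = a" "nrm A a \<le> 1/2"
  shows "nrm B (h a) \<le> 1"
proof -
  obtain s where s: "s \<in> carrier A" "adj A s = s" "s \<otimes>\<^bsub>A\<^esub> a = a \<otimes>\<^bsub>A\<^esub> s"
    "s \<otimes>\<^bsub>A\<^esub> s = \<one>\<^bsub>A\<^esub> \<ominus>\<^bsub>A\<^esub> a \<otimes>\<^bsub>A\<^esub> a"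
    using A.sqrt_one_minus_square[OF a] by blast
  define p q where "p = h a" and "q = h s"
  have pc: "p \<in> carrier B" "q \<in> carrier B" using a s by (simp_all add: p_def q_def)
  have pa: "adj B p = p" "adj B q = q" using h_adj[OF a(1)] h_adj[OF s(1)] a s by (simp_all add: p_def q_def)
  have qp: "q \<otimes>\<^bsub>B\<^esub> p = p \<otimes>\<^bsub>B\<^esub> q"
    using h_simps(2)[OF s(1) a(1)] h_simps(2)[OF a(1) s(1)] s(3) by (simp add: p_def q_def)
  have qq: "q \<otimes>\<^bsub>B\<^esub> q = \<one>\<^bsub>B\<^esub> \<ominus>\<^bsub>B\<^esub> p \<otimes>\<^bsub>B\<^esub> p"
    using h_simps(2)[OF s(1) s(1)] a s(4) by (simp add: p_def q_def)
  define w where "w = p \<otimes>\<^bsub>B\<^esub> q"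
  define u where "u = p \<oplus>\<^bsub>B\<^esub> \<i> \<odot>\<^bsub>B\<^esub> q"
  have wc: "w \<in> carrier B" and uc: "u \<in> carrier B" using pc by (simp_all add: w_def u_def)
  have cancel: "\<i> \<odot>\<^bsub>B\<^esub> v \<oplus>\<^bsub>B\<^esub> (-\<i>) \<odot>\<^bsub>B\<^esub> v = \<zero>\<^bsub>B\<^esub>" if "v \<in> carrier B" for v
    using that B.smult_add_left[OF that, of \<i> "-\<i>"] B.smult_l_null[OF that] by simp
  have ua: "adj B u = p \<oplus>\<^bsub>B\<^esub> (-\<i>) \<odot>\<^bsub>B\<^esub> q"
    using pc pa by (simp add: u_def B.adj_add B.adj_smult)
  have "((-\<i>) \<odot>\<^bsub>B\<^esub> q) \<otimes>\<^bsub>B\<^esub> (\<i> \<odot>\<^bsub>B\<^esub> q) = q \<otimes>\<^bsub>B\<^esub> q"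
    using pc B.smult_smult[of "q \<otimes>\<^bsub>B\<^esub> q" \<i> "-\<i>"] by (simp add: B.smult_mult_left B.smult_mult_right)
  then have "adj B u \<otimes>\<^bsub>B\<^esub> u = (p \<otimes>\<^bsub>B\<^esub> p \<oplus>\<^bsub>B\<^esub> (-\<i>) \<odot>\<^bsub>B\<^esub> w) \<oplus>\<^bsub>B\<^esub> (\<i> \<odot>\<^bsub>B\<^esub> w \<oplus>\<^bsub>B\<^esub> q \<otimes>\<^bsub>B\<^esub> q)"
    unfolding ua unfolding u_def w_def
    using pc by (simp add: B.l_distr B.r_distr B.smult_mult_left B.smult_mult_right B.smult_add_right qp)
  also have "\<dots> = (p \<otimes>\<^bsub>B\<^esub> p \<oplus>\<^bsub>B\<^esub> q \<otimes>\<^bsub>B\<^esub> q) \<oplus>\<^bsub>B\<^esub> (\<i> \<odot>\<^bsub>B\<^esub> w \<oplus>\<^bsub>B\<^esub> (-\<i>) \<odot>\<^bsub>B\<^esub> w)"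
    using pc wc by (simp add: B.a_ac)
  also have "\<dots> = \<one>\<^bsub>B\<^esub>"
    unfolding cancel[OF wc] qq using pc by (simp add: B.add_minus_cancel)
  finally have "(nrm B u)\<^sup>2 \<le> 1\<^sup>2"
    using B.nrm_adj_mult[OF uc] B.nrm_one_le by simp
  then have nu: "nrm B u \<le> 1" by (rule power2_le_imp_le) simp
  have "u \<oplus>\<^bsub>B\<^esub> adj B u = (p \<oplus>\<^bsub>B\<^esub> p) \<oplus>\<^bsub>B\<^esub> (\<i> \<odot>\<^bsub>B\<^esub> q \<oplus>\<^bsub>B\<^esub> (-\<i>) \<odot>\<^bsub>B\<^esub> q)"
    unfolding ua unfolding u_def using pc by (simp add: B.a_ac)
  then have "u \<oplus>\<^bsub>B\<^esub> adj B u = 2 \<odot>\<^bsub>B\<^esub> p"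
    unfolding cancel[OF pc(2)] using pc B.smult_add_left[OF pc(1), of 1 1] by simp
  then have "nrm B (2 \<odot>\<^bsub>B\<^esub> p) \<le> nrm B u + nrm B (adj B u)"
    using B.nrm_add[OF uc B.adj_closed[OF uc]] by simp
  then show ?thesis
    using nu pc B.nrm_adj[OF uc] by (simp add: B.nrm_smult p_def[symmetric])
qed

lemma nrm_h_selfadjoint:
  assumes a: "a \<in> carrier A" "adj A a = a"
  shows "nrm B (h a) \<le> 2 * nrm A a"
proof (cases "nrm A a = 0")
  case True
  then show ?thesis using A.nrm_eq_0[OF a(1)] by simp
next
  case False
  then have pos: "nrm A a > 0" using A.nrm_nonneg[OF a(1)] by simp
  \<comment> \<open>Scales the norm of \<open>a\<close> to 1/2, the range in which the square root
    is available; this is the origin of the factor 2.\<close>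
  define r where "r = 1 / (2 * nrm A a)"
  have r: "r > 0" "r * nrm A a = 1/2" using pos by (simp_all add: r_def)
  have "nrm B (h (complex_of_real r \<odot>\<^bsub>A\<^esub> a)) \<le> 1"
    by (rule nrm_h_selfadjoint_le_1) (use a r in \<open>simp_all add: A.adj_smult A.nrm_smult\<close>)
  then have "r * nrm B (h a) \<le> 1" using a r by (simp add: B.nrm_smult)
  then show ?thesis using pos by (simp add: r_def field_simps)
qed

text \<open>The C*-identity reduces the bound to the self-adjoint element
  \<open>adj A x \<otimes> x\<close>. Later arguments draw continuity from it.\<close>

lemma nrm_h_le:
  assumes x: "x \<in> carrier A" shows "nrm B (h x) \<le> 2 * nrm A x"
proof -
  have "(nrm B (h x))\<^sup>2 = nrm B (h (adj A x \<otimes>\<^bsub>A\<^esub> x))"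
    using x A.adj_closed by (simp add: B.nrm_adj_mult)
  also have "\<dots> \<le> 2 * nrm A (adj A x \<otimes>\<^bsub>A\<^esub> x)"
    using x by (intro nrm_h_selfadjoint) (simp_all add: A.adj_closed A.adj_mult A.adj_adj)
  also have "\<dots> = 2 * (nrm A x)\<^sup>2" using x by (simp add: A.nrm_adj_mult)
  also have "\<dots> \<le> (2 * nrm A x)\<^sup>2" by (simp add: power2_eq_square)
  finally show ?thesis by (rule power2_le_imp_le) (use A.nrm_nonneg x in simp)
qed

text \<open>The iterative half of the open mapping theorem: the remainder \<open>r k\<close> is
  approximately lifted again and halves each time, so the corrections form a geometric series whose
  sum is an exact lift. It is separated from surjectivity because \<open>push_surj\<close> enters
  here with an approximate lift of another origin.\<close>

lemma lift_of_approx_lift: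
  assumes K: "\<And>y. y \<in> carrier B \<Longrightarrow>
      \<exists>x\<in>carrier A. nrm A x \<le> K * nrm B y \<and> nrm B (y \<ominus>\<^bsub>B\<^esub> h x) \<le> nrm B y / 2"
    and y: "y \<in> carrier B" and "K \<ge> 0"
  shows "\<exists>x\<in>carrier A. h x = y \<and> nrm A x \<le> 2 * K * nrm B y"
proof -
  obtain f where f: "\<And>y. y \<in> carrier B \<Longrightarrow> f y \<in> carrier A"
    "\<And>y. y \<in> carrier B \<Longrightarrow> nrm A (f y) \<le> K * nrm B y"
    "\<And>y. y \<in> carrier B \<Longrightarrow> nrm B (y \<ominus>\<^bsub>B\<^esub> h (f y)) \<le> nrm B y / 2"
    using K by metis
  define s where "s = rec_nat \<zero>\<^bsub>A\<^esub> (\<lambda>_ x. x \<oplus>\<^bsub>A\<^esub> f (y \<ominus>\<^bsub>B\<^esub> h x))"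
  have s: "s 0 = \<zero>\<^bsub>A\<^esub>" "s (Suc k) = s k \<oplus>\<^bsub>A\<^esub> f (y \<ominus>\<^bsub>B\<^esub> h (s k))" for k by (simp_all add: s_def)
  have sc: "s k \<in> carrier A" for k by (induction k) (simp_all add: s f y)
  define r where "r k = y \<ominus>\<^bsub>B\<^esub> h (s k)" for k
  have rc: "r k \<in> carrier B" for k using sc y by (simp add: r_def)
  have rn: "nrm B (r k) \<le> nrm B y * (1/2) ^ k" for k
  proof (induction k)
    case 0
    then show ?case using y by (simp add: r_def s a_minus_def)
  next
    case (Suc k)
    have "r (Suc k) = r k \<ominus>\<^bsub>B\<^esub> h (f (r k))"
      using sc f(1)[OF rc] y by (simp add: r_def s a_minus_def B.minus_add B.a_ac)
    then show ?case using f(3)[OF rc[of k]] Suc by simp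
  qed
  have "nrm A (s (Suc k) \<ominus>\<^bsub>A\<^esub> s k) \<le> K * nrm B y * (1/2) ^ k" for k
  proof -
    have "s (Suc k) \<ominus>\<^bsub>A\<^esub> s k = f (r k)"
      using sc f(1)[OF rc] by (simp add: s r_def A.add_minus_cancel)
    then have "nrm A (s (Suc k) \<ominus>\<^bsub>A\<^esub> s k) \<le> K * nrm B (r k)" using f(2)[OF rc] by simp
    also have "\<dots> \<le> K * (nrm B y * (1/2) ^ k)" using rn \<open>K \<ge> 0\<close> by (intro mult_left_mono)
    finally show ?thesis by simp
  qed
  then have "\<exists>l\<in>carrier A. \<forall>k. nrm A (l \<ominus>\<^bsub>A\<^esub> s k) \<le> 2 * (K * nrm B y) * (1/2) ^ k"
    by (intro A.nrm_geometric sc)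
  then obtain l where l: "l \<in> carrier A" and le: "\<And>k. nrm A (l \<ominus>\<^bsub>A\<^esub> s k) \<le> 2 * (K * nrm B y) * (1/2) ^ k"
    by auto
  have "nrm B (y \<ominus>\<^bsub>B\<^esub> h l) \<le> (nrm B y + 4 * (K * nrm B y)) * (1/2) ^ k" for k
  proof -
    have "nrm B (h (s k) \<ominus>\<^bsub>B\<^esub> h l) \<le> 2 * nrm A (s k \<ominus>\<^bsub>A\<^esub> l)"
      using nrm_h_le[of "s k \<ominus>\<^bsub>A\<^esub> l"] sc l by simp
    then have "nrm B (h (s k) \<ominus>\<^bsub>B\<^esub> h l) \<le> 4 * (K * nrm B y) * (1/2) ^ k"
      using le[of k] A.nrm_minus_commute[OF sc l, of k] by simp
    moreover have "nrm B (y \<ominus>\<^bsub>B\<^esub> h l) \<le> nrm B (r k) + nrm B (h (s k) \<ominus>\<^bsub>B\<^esub> h l)"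
      unfolding r_def using sc l y by (intro B.nrm_minus_triangle) simp_all
    ultimately show ?thesis using rn[of k] by (simp add: algebra_simps)
  qed
  then have "y \<ominus>\<^bsub>B\<^esub> h l = \<zero>\<^bsub>B\<^esub>" by (rule B.nrm_geometric_null[rotated]) (use y l in simp)
  then have "h l = y" using y l by simp
  moreover have "nrm A l \<le> 2 * K * nrm B y" using le[of 0] l by (simp add: s a_minus_def)
  ultimately show ?thesis using l by blast
qed

text \<open>The Baire category half of the open mapping theorem: the closure of the image of some
  ball has an interior point, and a difference of two points near it is a small multiple of
  \<open>y\<close>.\<close>

lemma approx_lift_of_surj:
  assumes surj: "h ` carrier A = carrier B"
  shows "\<exists>K\<ge>0. \<forall>y\<in>carrier B. \<exists>x\<in>carrier A.
    nrm A x \<le> K * nrm B y \<and> nrm B (y \<ominus>\<^bsub>B\<^esub> h x) \<le> nrm B y / 2"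
proof -
  define F where "F k = B.metric.mtopology closure_of (h ` {x \<in> carrier A. nrm A x \<le> real k})" for k :: nat
  have "\<Union>(range F) = carrier B"
  proof
    show "\<Union>(range F) \<subseteq> carrier B"
      unfolding F_def using closure_of_subset_topspace[of B.metric.mtopology] by auto
    show "carrier B \<subseteq> \<Union>(range F)"
    proof
      fix y assume "y \<in> carrier B"
      then obtain x where x: "x \<in> carrier A" "y = h x" using surj by blast
      obtain k :: nat where "nrm A x \<le> real k" using real_arch_simple by blast
      moreover have "h ` {x \<in> carrier A. nrm A x \<le> real k} \<subseteq> F k"
        unfolding F_def by (rule closure_of_subset) auto
      ultimately show "y \<in> \<Union>(range F)" using x by blast
    qed
  qed
  moreover have "B.metric.mtopology interior_of carrier B = carrier B"
    using interior_of_topspace[of B.metric.mtopology] by simp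
  ultimately have ne: "B.metric.mtopology interior_of (\<Union>(range F)) \<noteq> {}"
    using B.zero_closed by auto
  have "\<exists>k. B.metric.mtopology interior_of F k \<noteq> {}"
  proof (rule ccontr)
    assume "\<nexists>k. B.metric.mtopology interior_of F k \<noteq> {}"
    then have "closedin B.metric.mtopology T \<and> B.metric.mtopology interior_of T = {}" if "T \<in> range F" for T
      using that by (auto simp: F_def)
    then have "B.metric.mtopology interior_of (\<Union>(range F)) = {}"
      by (intro B.metric.metric_Baire_category_alt B.complete) auto
    with ne show False by contradiction
  qed
  then obtain k where "B.metric.mtopology interior_of F k \<noteq> {}" by blast
  then obtain y0 where y0: "y0 \<in> B.metric.mtopology interior_of F k" by blast
  then have y0c: "y0 \<in> carrier B" using interior_of_subset_topspace[of B.metric.mtopology] by auto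
  have "openin B.metric.mtopology (B.metric.mtopology interior_of F k)" by (rule openin_interior_of)
  then obtain r where r: "r > 0" "B.metric.mball y0 r \<subseteq> B.metric.mtopology interior_of F k"
    using y0 unfolding B.metric.openin_mtopology by blast
  have F: "\<exists>x\<in>carrier A. nrm A x \<le> real k \<and> nrm B (w \<ominus>\<^bsub>B\<^esub> h x) < r / 8"
    if w: "w \<in> carrier B" "nrm B (y0 \<ominus>\<^bsub>B\<^esub> w) < r" for w
  proof -
    have "w \<in> B.metric.mball y0 r"
      using w y0c by (simp add: B.metric.in_mball cstar_dist_def)
    then have "w \<in> F k" using r(2) interior_of_subset[of B.metric.mtopology "F k"] by blast
    moreover have "r / 8 > 0" using r(1) by simp
    ultimately obtain y where "y \<in> h ` {x \<in> carrier A. nrm A x \<le> real k}" "y \<in> B.metric.mball w (r / 8)"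
      unfolding F_def B.metric.metric_closure_of by blast
    then show ?thesis using w by (auto simp: B.metric.in_mball cstar_dist_def)
  qed
  \<comment> \<open>With \<open>t = r / (2 * nrm B y)\<close> both \<open>y0\<close> and
    \<open>y0\<close> plus \<open>t\<close> times \<open>y\<close> lie in the ball of radius
    \<open>r\<close>. Their approximate preimages have norm at most \<open>k\<close> and error below
    \<open>r / 8\<close>. Dividing the difference of the preimages by \<open>t\<close> gives norm at
    most \<open>2 k / t = K * nrm B y\<close> and error at most
    \<open>(r / 4) / t = nrm B y / 2\<close>.\<close>
  define K where "K = 4 * real k / r"
  have "\<exists>x\<in>carrier A. nrm A x \<le> K * nrm B y \<and> nrm B (y \<ominus>\<^bsub>B\<^esub> h x) \<le> nrm B y / 2" if y: "y \<in> carrier B" for y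
  proof (cases "nrm B y = 0")
    case True
    then have "y = \<zero>\<^bsub>B\<^esub>" using B.nrm_eq_0[OF y] by simp
    then show ?thesis by (intro bexI[of _ "\<zero>\<^bsub>A\<^esub>"]) (simp_all add: a_minus_def)
  next
    case False
    then have pos: "nrm B y > 0" using B.nrm_nonneg[OF y] by simp
    define t where "t = r / (2 * nrm B y)"
    have t: "t > 0" "t * nrm B y = r / 2" "1 / t = 2 * nrm B y / r" using pos r(1) by (simp_all add: t_def)
    define w where "w = y0 \<oplus>\<^bsub>B\<^esub> complex_of_real t \<odot>\<^bsub>B\<^esub> y"
    have wc: "w \<in> carrier B" using y y0c by (simp add: w_def)
    have wy0: "w \<ominus>\<^bsub>B\<^esub> y0 = complex_of_real t \<odot>\<^bsub>B\<^esub> y" using y y0c by (simp add: w_def B.add_minus_cancel)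
    have "nrm B (y0 \<ominus>\<^bsub>B\<^esub> w) < r"
      unfolding B.nrm_minus_commute[OF y0c wc] wy0 using y t r(1) by (simp add: B.nrm_smult)
    from F[OF wc this] obtain x1 where x1: "x1 \<in> carrier A" "nrm A x1 \<le> real k" "nrm B (w \<ominus>\<^bsub>B\<^esub> h x1) < r / 8" by blast
    have "nrm B (y0 \<ominus>\<^bsub>B\<^esub> y0) < r" using B.nrm_minus_eq_0[OF y0c y0c] r(1) by simp
    from F[OF y0c this] obtain x2 where x2: "x2 \<in> carrier A" "nrm A x2 \<le> real k" "nrm B (y0 \<ominus>\<^bsub>B\<^esub> h x2) < r / 8" by blast
    define x where "x = complex_of_real (1 / t) \<odot>\<^bsub>A\<^esub> (x1 \<ominus>\<^bsub>A\<^esub> x2)"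
    have xc: "x \<in> carrier A" using x1 x2 by (simp add: x_def)
    have "nrm A x = 1 / t * nrm A (x1 \<ominus>\<^bsub>A\<^esub> x2)"
      unfolding x_def using x1 x2 t(1) by (subst A.nrm_smult) (simp_all add: norm_divide)
    also have "\<dots> \<le> 1 / t * (2 * real k)"
      using A.nrm_minus_le[OF x1(1) x2(1)] x1 x2 t(1) by (intro mult_left_mono) simp_all
    also have "\<dots> = K * nrm B y" unfolding t(3) K_def by simp
    finally have 1: "nrm A x \<le> K * nrm B y" .
    have "complex_of_real (1 / t) \<odot>\<^bsub>B\<^esub> (complex_of_real t \<odot>\<^bsub>B\<^esub> y) = y"
      using t(1) y B.smult_smult[OF y, of "complex_of_real (1 / t)" "complex_of_real t"] by simp
    then have "y \<ominus>\<^bsub>B\<^esub> h x = complex_of_real (1 / t) \<odot>\<^bsub>B\<^esub> ((w \<ominus>\<^bsub>B\<^esub> y0) \<ominus>\<^bsub>B\<^esub> (h x1 \<ominus>\<^bsub>B\<^esub> h x2))"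
      unfolding wy0 x_def using x1 x2 y by (subst B.smult_minus_right) simp_all
    also have "(w \<ominus>\<^bsub>B\<^esub> y0) \<ominus>\<^bsub>B\<^esub> (h x1 \<ominus>\<^bsub>B\<^esub> h x2) = (w \<ominus>\<^bsub>B\<^esub> h x1) \<ominus>\<^bsub>B\<^esub> (y0 \<ominus>\<^bsub>B\<^esub> h x2)"
      using wc y0c x1 x2 by (intro B.minus_add_minus) simp_all
    finally have e: "y \<ominus>\<^bsub>B\<^esub> h x
        = complex_of_real (1 / t) \<odot>\<^bsub>B\<^esub> ((w \<ominus>\<^bsub>B\<^esub> h x1) \<ominus>\<^bsub>B\<^esub> (y0 \<ominus>\<^bsub>B\<^esub> h x2))" .
    have "nrm B (y \<ominus>\<^bsub>B\<^esub> h x) = 1 / t * nrm B ((w \<ominus>\<^bsub>B\<^esub> h x1) \<ominus>\<^bsub>B\<^esub> (y0 \<ominus>\<^bsub>B\<^esub> h x2))"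
      unfolding e using wc y0c x1 x2 t(1) by (subst B.nrm_smult) (simp_all add: norm_divide)
    also have "\<dots> \<le> 1 / t * (r / 8 + r / 8)"
      using B.nrm_minus_le[of "w \<ominus>\<^bsub>B\<^esub> h x1" "y0 \<ominus>\<^bsub>B\<^esub> h x2"] wc y0c x1 x2 t(1) by (intro mult_left_mono) simp_all
    also have "\<dots> = nrm B y / 2" unfolding t(3) using r(1) by simp
    finally show ?thesis using 1 xc by blast
  qed
  moreover have "K \<ge> 0" using r(1) by (simp add: K_def)
  ultimately show ?thesis by blast
qed

lemma bounded_lift_of_surj:
  assumes "h ` carrier A = carrier B"
  shows "\<exists>K\<ge>0. \<forall>y\<in>carrier B. \<exists>x\<in>carrier A. h x = y \<and> nrm A x \<le> K * nrm B y"
proof -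
  from approx_lift_of_surj[OF assms] obtain K where "K \<ge> 0" and
    K: "\<And>y. y \<in> carrier B \<Longrightarrow> \<exists>x\<in>carrier A. nrm A x \<le> K * nrm B y \<and> nrm B (y \<ominus>\<^bsub>B\<^esub> h x) \<le> nrm B y / 2"
    by blast
  then show ?thesis using lift_of_approx_lift[OF K] by (intro exI[of _ "2 * K"]) simp
qed

end

section \<open>Homomorphisms between circle algebras\<close>

lemma coeff_homI: "\<lbrakk>coeff_ring A; coeff_ring B; h \<in> ring_hom A B\<rbrakk> \<Longrightarrow> coeff_hom A B h"
  by (simp add: coeff_hom_def coeff_hom_axioms_def)

lemma (in coeff_hom) h_finsum:
  fixes n :: nat
  assumes "\<And>i. i < n \<Longrightarrow> x i \<in> carrier A"
  shows "h (finsum A x {..<n}) = finsum B (\<lambda>i. h (x i)) {..<n}"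
  using assms
proof (induction n)
  case (Suc n)
  have 1: "finsum A x {..<Suc n} = x n \<oplus>\<^bsub>A\<^esub> finsum A x {..<n}"
    unfolding lessThan_Suc using Suc.prems by (intro A.finsum_insert) auto
  have 2: "finsum B (\<lambda>i. h (x i)) {..<Suc n} = h (x n) \<oplus>\<^bsub>B\<^esub> finsum B (\<lambda>i. h (x i)) {..<n}"
    unfolding lessThan_Suc using Suc.prems by (intro B.finsum_insert) auto
  have "finsum A x {..<n} \<in> carrier A" using Suc.prems by (intro A.finsum_closed) auto
  then show ?case unfolding 1 2 using Suc by simp
qed simp

definition circle_comp :: "(complex \<Rightarrow> complex) \<Rightarrow> (complex \<Rightarrow> 'a) \<Rightarrow> complex \<Rightarrow> 'a" where
  "circle_comp s g = (\<lambda>z\<in>circle. g (s z))"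

definition circle_push :: "('a \<Rightarrow> 'b) \<Rightarrow> (complex \<Rightarrow> 'a) \<Rightarrow> complex \<Rightarrow> 'b" where
  "circle_push h g = (\<lambda>z\<in>circle. h (g z))"

definition circle_const :: "'a \<Rightarrow> complex \<Rightarrow> 'a" where
  "circle_const a = (\<lambda>z\<in>circle. a)"

lemma circle_map_apply:
  assumes "z \<in> circle"
  shows "circle_comp s g z = g (s z)" "circle_push h g z = h (g z)" "circle_const a z = a"
  unfolding circle_comp_def circle_push_def circle_const_def by (rule restrict_apply'[OF assms])+

context unital_cstar_algebra
begin

lemma CT_coeff_ring: "coeff_ring CT"
  by (rule coeff_ring.intro[OF ring_CT])

lemma ev_hom: assumes z: "z \<in> circle" shows "coeff_hom CT A (\<lambda>g. g z)"
proof (rule coeff_homI[OF CT_coeff_ring coeff_ring_axioms ring_hom_memI])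
  show "g z \<in> carrier A" if "g \<in> carrier CT" for g
    using that z ccontD by (simp only: CT_simps(1) mem_Collect_eq)
qed (simp_all only: CT_apply[OF z])

lemma ccont_iff: "ccont g \<longleftrightarrow> g \<in> extensional circle \<and> continuous_map (top_of_set circle) (cstar_topology A) g"
  using carrier_circle_tensor carrier_circle_tensor_ccont by auto

lemma ccont_comp:
  assumes g: "ccont g" and s: "continuous_on circle s" "s ` circle \<subseteq> circle"
  shows "ccont (circle_comp s g)"
proof -
  have "continuous_map (top_of_set circle) (top_of_set circle) s"
    using s by (simp add: continuous_map_in_subtopology image_subset_iff Pi_iff)
  then have "continuous_map (top_of_set circle) (cstar_topology A) (g \<circ> s)"
    using g unfolding ccont_iff by (intro continuous_map_compose) auto
  then have "continuous_map (top_of_set circle) (cstar_topology A) (circle_comp s g)"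
    by (rule continuous_map_eq) (simp add: circle_comp_def)
  then show ?thesis unfolding ccont_iff by (simp add: circle_comp_def)
qed

lemma comp_hom:
  assumes s: "continuous_on circle s" "s ` circle \<subseteq> circle"
  shows "coeff_hom CT CT (circle_comp s)"
proof -
  have sz: "s z \<in> circle" if "z \<in> circle" for z using s(2) that by blast
  have c: "ccont (circle_comp s g)" if "g \<in> carrier CT" for g
    using ccont_comp[OF _ s] that by (simp only: CT_simps(1) mem_Collect_eq)
  show ?thesis
  proof (rule coeff_homI[OF CT_coeff_ring CT_coeff_ring ring_hom_memI])
    show "circle_comp s g \<in> carrier CT" if "g \<in> carrier CT" for g
      using c[OF that] by (simp only: CT_simps(1) mem_Collect_eq)
  qed (auto simp only: circle_comp_def CT_simps fun_eq_iff restrict_def sz split: if_splits)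
qed

lemma const_hom: "coeff_hom A CT circle_const"
proof (rule coeff_homI[OF coeff_ring_axioms CT_coeff_ring ring_hom_memI])
  show "circle_const a \<in> carrier CT" if "a \<in> carrier A" for a
    unfolding circle_const_def CT_simps(1) using ccont_const[OF that] by simp
qed (auto simp only: circle_const_def CT_simps fun_eq_iff restrict_def split: if_splits)

lemma ccont_uniformly:
  assumes g: "ccont g" and e: "e > 0"
  shows "\<exists>d>0. \<forall>z\<in>circle. \<forall>w\<in>circle. dist z w < d \<longrightarrow> nrm A (g z \<ominus> g w) < e"
proof -
  have "\<exists>d>0. \<forall>w\<in>circle. dist w z < d \<longrightarrow> nrm A (g w \<ominus> g z) < e/2" if z: "z \<in> circle" for z
  proof -
    have "\<forall>\<^sub>F w in at z within circle. nrm A (g w \<ominus> g z) < e/2"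
      using order_tendstoD(2)[OF ccont_lim[OF g z], of "e/2"] e by simp
    then obtain d where d: "d > 0" "\<And>w. \<lbrakk>w \<in> circle; w \<noteq> z; dist w z < d\<rbrakk> \<Longrightarrow> nrm A (g w \<ominus> g z) < e/2"
      unfolding eventually_at by blast
    have "nrm A (g z \<ominus> g z) < e/2" using nrm_minus_eq_0[OF ccontD[OF g z] ccontD[OF g z]] e by simp
    then show ?thesis using d by metis
  qed
  then obtain r where r: "\<And>z. z \<in> circle \<Longrightarrow> r z > 0"
    "\<And>z w. \<lbrakk>z \<in> circle; w \<in> circle; dist w z < r z\<rbrakk> \<Longrightarrow> nrm A (g w \<ominus> g z) < e/2"
    by metis
  \<comment> \<open>A Lebesgue number for the cover by balls on which \<open>g\<close> stays within
    \<open>e/2\<close> of its value at the centre.\<close>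
  have "\<exists>d>0. \<forall>x\<in>circle. \<exists>G\<in>(\<lambda>z. ball z (r z)) ` circle. ball x d \<subseteq> G"
  proof (rule Heine_Borel_lemma[of circle "(\<lambda>z. ball z (r z)) ` circle"])
    show "circle \<subseteq> \<Union>((\<lambda>z. ball z (r z)) ` circle)" using r(1) by force
  qed (auto simp del: mem_sphere_0)
  then obtain d where d: "d > 0" "\<And>x. x \<in> circle \<Longrightarrow> \<exists>u\<in>circle. ball x d \<subseteq> ball u (r u)"
    by blast
  have "nrm A (g z \<ominus> g w) < e" if zw: "z \<in> circle" "w \<in> circle" "dist z w < d" for z w
  proof -
    obtain u where u: "u \<in> circle" "ball z d \<subseteq> ball u (r u)" using d(2)[OF zw(1)] by blast
    have "z \<in> ball z d" "w \<in> ball z d" using zw d(1) by simp_all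
    then have "z \<in> ball u (r u)" "w \<in> ball u (r u)" using u(2) by blast+
    then have "nrm A (g z \<ominus> g u) < e/2" "nrm A (g w \<ominus> g u) < e/2"
      using r(2)[OF u(1) zw(1)] r(2)[OF u(1) zw(2)] by (simp_all add: dist_commute)
    then show ?thesis
      using nrm_minus_triangle[of "g z" "g u" "g w"] nrm_minus_commute[of "g w" "g u"]
        ccontD[OF g zw(1)] ccontD[OF g zw(2)] ccontD[OF g u(1)] by simp
  qed
  then show ?thesis using d(1) by blast
qed

end

context cstar_morphism
begin

lemma ccont_push:
  assumes g: "A.ccont g" shows "B.ccont (circle_push h g)"
proof (rule B.ccontI[where f = "\<lambda>z w. 2 * nrm A (g w \<ominus>\<^bsub>A\<^esub> g z)"])
  note gc = A.ccontD[OF g]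
  show "circle_push h g \<in> circle \<rightarrow>\<^sub>E carrier B"
    unfolding circle_push_def using gc by (intro restrict_PiE_iff[THEN iffD2] ballI h_simps(1))
  show "((\<lambda>w. 2 * nrm A (g w \<ominus>\<^bsub>A\<^esub> g z)) \<longlongrightarrow> 0) (at z within circle)" if "z \<in> circle" for z
    using tendsto_mult_right[OF A.ccont_lim[OF g that], of 2] by (simp add: mult.commute)
  show "nrm B (circle_push h g w \<ominus>\<^bsub>B\<^esub> circle_push h g z) \<le> 2 * nrm A (g w \<ominus>\<^bsub>A\<^esub> g z)"
    if "z \<in> circle" "w \<in> circle" for z w
    using nrm_h_le[of "g w \<ominus>\<^bsub>A\<^esub> g z"] gc[OF that(1)] gc[OF that(2)] that by (simp add: circle_map_apply del: mem_sphere_0)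
qed

text \<open>Places the circle algebras in the same locale, so that the lifting results for
  \<open>h\<close> apply to whole paths at once.\<close>

lemma push_morphism: "cstar_morphism (circle_tensor A) (circle_tensor B) (circle_push h)"
proof (rule cstar_morphism.intro[OF A.unital_cstar_algebra_circle_tensor B.unital_cstar_algebra_circle_tensor cstar_morphism_axioms.intro])
  have c: "g z \<in> carrier A" if "g \<in> carrier (circle_tensor A)" "z \<in> circle" for g z
    using that A.ccontD by (simp only: A.CT_simps(1) mem_Collect_eq)
  have "circle_push h \<in> ring_hom (circle_tensor A) (circle_tensor B)"
  proof (rule ring_hom_memI)
    show "circle_push h g \<in> carrier (circle_tensor B)" if "g \<in> carrier (circle_tensor A)" for g
      using ccont_push that by (simp only: A.CT_simps(1) B.CT_simps(1) mem_Collect_eq)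
  qed (auto simp: circle_push_def A.CT_simps(2-) B.CT_simps(2-) fun_eq_iff restrict_def c simp del: mem_sphere_0)
  then show "circle_push h \<in> cstar_hom (circle_tensor A) (circle_tensor B)"
    unfolding cstar_hom_def
    by (auto simp: circle_push_def A.CT_simps(2-) B.CT_simps(2-) fun_eq_iff restrict_def c simp del: mem_sphere_0)
qed

text \<open>Pointwise lifts need not depend continuously on the point. Instead, norm-controlled
  lifts of finitely many values are averaged with a partition of unity; the result is continuous and
  close enough for \<open>lift_of_approx_lift\<close> to make it exact.\<close>

lemma push_surj:
  assumes surj: "h ` carrier A = carrier B"
  shows "circle_push h ` carrier (circle_tensor A) = carrier (circle_tensor B)"
proof -
  interpret T: cstar_morphism "circle_tensor A" "circle_tensor B" "circle_push h" by (rule push_morphism)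
  obtain K where "K \<ge> 0" and K: "\<And>y. y \<in> carrier B \<Longrightarrow> \<exists>x\<in>carrier A. h x = y \<and> nrm A x \<le> K * nrm B y"
    using bounded_lift_of_surj[OF surj] by blast
  have "\<exists>x\<in>carrier (circle_tensor A). nrm (circle_tensor A) x \<le> K * nrm (circle_tensor B) y \<and>
      nrm (circle_tensor B) (y \<ominus>\<^bsub>circle_tensor B\<^esub> circle_push h x) \<le> nrm (circle_tensor B) y / 2"
    if yc: "y \<in> carrier (circle_tensor B)" for y
  proof (cases "nrm (circle_tensor B) y = 0")
    case True
    then have "y = \<zero>\<^bsub>circle_tensor B\<^esub>" using T.B.nrm_eq_0[OF yc] by simp
    then show ?thesis by (intro bexI[of _ "\<zero>\<^bsub>circle_tensor A\<^esub>"]) (simp_all add: a_minus_def)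
  next
    case False
    define E where "E = nrm (circle_tensor B) y"
    have E: "E > 0" using False T.B.nrm_nonneg[OF yc] by (simp add: E_def)
    have y: "B.ccont y" using yc by (simp only: B.CT_simps(1) mem_Collect_eq)
    note ym = B.ccontD[OF y]
    \<comment> \<open>Points at distance less than \<open>d\<close> have values that differ by less
      than half the norm of \<open>y\<close>, the error that \<open>lift_of_approx_lift\<close>
      admits.\<close>
    obtain d where d: "d > 0" "\<And>z w. \<lbrakk>z \<in> circle; w \<in> circle; dist z w < d\<rbrakk> \<Longrightarrow> nrm B (y z \<ominus>\<^bsub>B\<^esub> y w) < E/2"
      using B.ccont_uniformly[OF y, of "E/2"] E by auto
    have "compact circle" by simp
    then obtain Z where Z: "Z \<subseteq> circle" "finite Z" "circle \<subseteq> (\<Union>z\<in>Z. ball z d)"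
      by (rule compactE_image[of circle circle "\<lambda>z. ball z d"]) (use d(1) in auto)
    obtain zs :: "nat \<Rightarrow> complex" and n where zs: "Z = zs ` {i. i < n}"
      using finite_imp_nat_seg_image_inj_on[OF Z(2)] by blast
    then have zc: "zs i \<in> circle" if "i < n" for i using that Z(1) by auto
    \<comment> \<open>A hat function, positive exactly on the ball of radius \<open>d\<close> around
      \<open>zs i\<close>; the quotients by the sum \<open>s\<close> are the partition of
      unity.\<close>
    define q where "q i w = max 0 (d - dist w (zs i))" for i w
    define s where "s w = (\<Sum>i<n. q i w)" for w
    have spos: "s w > 0" if w: "w \<in> circle" for w
    proof -
      obtain i where i: "i < n" "w \<in> ball (zs i) d" using Z(3) w zs by auto
      then have "q i w > 0" by (simp add: q_def dist_commute)
      then show ?thesis unfolding s_def using i by (intro sum_pos2[of _ i]) (auto simp: q_def)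
    qed
    define r where "r i w = q i w / s w" for i w
    have rsum: "(\<Sum>i<n. r i w) = 1" if "w \<in> circle" for w
      using spos[OF that] by (simp add: r_def sum_divide_distrib[symmetric]) (simp add: s_def)
    have r0: "0 \<le> r i w" if "w \<in> circle" for i w
      using spos[OF that] by (simp add: r_def q_def)
    have rcont: "continuous_on circle (\<lambda>w. complex_of_real (r i w))" for i
      unfolding r_def s_def q_def using spos
      by (intro continuous_intros) (auto simp: s_def q_def less_le simp del: mem_sphere_0)
    obtain c where c: "\<And>i. i < n \<Longrightarrow> c i \<in> carrier A" "\<And>i. i < n \<Longrightarrow> h (c i) = y (zs i)"
      "\<And>i. i < n \<Longrightarrow> nrm A (c i) \<le> K * nrm B (y (zs i))"
      using K[OF ym[OF zc]] by metis
    have ci: "nrm A (c i) \<le> K * E" if "i < n" for i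
    proof -
      have "nrm B (y (zs i)) \<le> E" unfolding E_def by (rule B.nrm_CT_le[OF y zc[OF that]])
      then have "K * nrm B (y (zs i)) \<le> K * E" using \<open>K \<ge> 0\<close> by (rule mult_left_mono)
      then show ?thesis using c(3)[OF that] by linarith
    qed
    define x where "x = (\<lambda>w\<in>circle. finsum A (\<lambda>i. complex_of_real (r i w) \<odot>\<^bsub>A\<^esub> c i) {..<n})"
    have xe: "x w = finsum A (\<lambda>i. complex_of_real (r i w) \<odot>\<^bsub>A\<^esub> c i) {..<n}" if "w \<in> circle" for w
      unfolding x_def by (rule restrict_apply'[OF that])
    have "x \<in> circle_tensors A"
      unfolding circle_tensors_def x_def using rcont c(1)
      by (intro CollectI exI[of _ n] exI[of _ "\<lambda>i w. complex_of_real (r i w)"] exI[of _ c]) auto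
    then have x: "A.ccont x" by (rule A.ccont_tensors)
    then have xc: "x \<in> carrier (circle_tensor A)" by (simp only: A.CT_simps(1) mem_Collect_eq)
    have "nrm (circle_tensor A) x \<le> K * E"
    proof (rule A.nrm_CT_leI)
      fix w :: complex assume w: "w \<in> circle"
      have "nrm A (x w) \<le> (\<Sum>i<n. nrm A (complex_of_real (r i w) \<odot>\<^bsub>A\<^esub> c i))"
        unfolding xe[OF w] using c(1) by (intro A.nrm_finsum) auto
      also have "\<dots> \<le> (\<Sum>i<n. r i w * (K * E))"
        using c(1) ci r0[OF w] by (intro sum_mono) (simp add: A.nrm_smult mult_left_mono)
      also have "\<dots> = K * E" unfolding sum_distrib_right[symmetric] rsum[OF w] by simp
      finally show "nrm A (x w) \<le> K * E" .
    qed
    moreover have "nrm (circle_tensor B) (y \<ominus>\<^bsub>circle_tensor B\<^esub> circle_push h x) \<le> E / 2"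
    proof (rule B.nrm_CT_leI)
      fix w :: complex assume w: "w \<in> circle"
      have "h (x w) = finsum B (\<lambda>i. h (complex_of_real (r i w) \<odot>\<^bsub>A\<^esub> c i)) {..<n}"
        unfolding xe[OF w] by (rule h_finsum) (simp add: c(1))
      also have "\<dots> = finsum B (\<lambda>i. complex_of_real (r i w) \<odot>\<^bsub>B\<^esub> y (zs i)) {..<n}"
        using ym[OF zc] c by (intro B.finsum_cong') auto
      finally have hx: "h (x w) = finsum B (\<lambda>i. complex_of_real (r i w) \<odot>\<^bsub>B\<^esub> y (zs i)) {..<n}" .
      have "y w = (\<Sum>i<n. complex_of_real (r i w)) \<odot>\<^bsub>B\<^esub> y w"
        using rsum[OF w] ym[OF w] by (simp flip: of_real_sum)
      also have "\<dots> = finsum B (\<lambda>i. complex_of_real (r i w) \<odot>\<^bsub>B\<^esub> y w) {..<n}"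
        using ym[OF w] by (intro B.smult_sum_left) auto
      finally have "nrm B (y w \<ominus>\<^bsub>B\<^esub> h (x w)) = nrm B (finsum B (\<lambda>i. complex_of_real (r i w) \<odot>\<^bsub>B\<^esub> y w) {..<n}
          \<ominus>\<^bsub>B\<^esub> finsum B (\<lambda>i. complex_of_real (r i w) \<odot>\<^bsub>B\<^esub> y (zs i)) {..<n})"
        unfolding hx by simp
      also have "\<dots> \<le> (\<Sum>i<n. nrm B (complex_of_real (r i w) \<odot>\<^bsub>B\<^esub> y w \<ominus>\<^bsub>B\<^esub> complex_of_real (r i w) \<odot>\<^bsub>B\<^esub> y (zs i)))"
        using ym[OF w] ym[OF zc] by (intro B.nrm_finsum_diff) auto
      also have "\<dots> \<le> (\<Sum>i<n. r i w * (E/2))"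
      proof (rule sum_mono)
        fix i assume "i \<in> {..<n}"
        then have i: "i < n" by simp
        have "nrm B (complex_of_real (r i w) \<odot>\<^bsub>B\<^esub> y w \<ominus>\<^bsub>B\<^esub> complex_of_real (r i w) \<odot>\<^bsub>B\<^esub> y (zs i))
            = r i w * nrm B (y w \<ominus>\<^bsub>B\<^esub> y (zs i))"
          using ym[OF w] ym[OF zc[OF i]] r0[OF w] by (simp flip: B.smult_minus_right add: B.nrm_smult)
        also have "\<dots> \<le> r i w * (E/2)"
        proof (cases "r i w = 0")
          case False
          then have "dist w (zs i) < d" by (auto simp: r_def q_def max_def split: if_splits)
          then have "nrm B (y w \<ominus>\<^bsub>B\<^esub> y (zs i)) \<le> E/2" using d(2)[OF w zc[OF i]] by simp
          then show ?thesis using r0[OF w] by (intro mult_left_mono)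
        qed simp
        finally show "nrm B (complex_of_real (r i w) \<odot>\<^bsub>B\<^esub> y w \<ominus>\<^bsub>B\<^esub> complex_of_real (r i w) \<odot>\<^bsub>B\<^esub> y (zs i)) \<le> r i w * (E/2)" .
      qed
      also have "\<dots> = E/2" unfolding sum_distrib_right[symmetric] rsum[OF w] by simp
      finally have "nrm B (y w \<ominus>\<^bsub>B\<^esub> h (x w)) \<le> E / 2" .
      then show "nrm B ((y \<ominus>\<^bsub>circle_tensor B\<^esub> circle_push h x) w) \<le> E / 2"
        by (simp only: B.CT_minus[OF y ccont_push[OF x] w] circle_map_apply[OF w])
    qed
    ultimately show ?thesis using xc unfolding E_def by blast
  qed
  then have "\<exists>x\<in>carrier (circle_tensor A). circle_push h x = y" if "y \<in> carrier (circle_tensor B)" for y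
    using T.lift_of_approx_lift[OF _ that \<open>K \<ge> 0\<close>] by blast
  then show ?thesis using T.h_simps(1) by blast
qed

end

section \<open>The identity component of the general linear group\<close>

context unital_cstar_algebra
begin

lemma near_one_GL:
  assumes x: "x \<in> mats A n"
    and le: "mat_nrm A n (x \<ominus>\<^bsub>mat_ring A n\<^esub> \<one>\<^bsub>mat_ring A n\<^esub>) \<le> 1/2"
  shows "x \<in> GL A n"
proof -
  interpret Mn: complete_normed_ring "mat_ring A n" "mat_nrm A n" by (rule mat_complete_normed_ring)
  let ?a = "\<one>\<^bsub>mat_ring A n\<^esub> \<ominus>\<^bsub>mat_ring A n\<^esub> x"
  have "\<one>\<^bsub>mat_ring A n\<^esub> \<ominus>\<^bsub>mat_ring A n\<^esub> ?a \<in> Units (mat_ring A n)"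
    using x le Mn.N_minus_commute[OF x Mn.one_closed] by (intro Mn.one_minus_Unit) simp_all
  moreover have "\<one>\<^bsub>mat_ring A n\<^esub> \<ominus>\<^bsub>mat_ring A n\<^esub> ?a = x"
    using x by (simp add: Mn.minus_eq Mn.minus_add Mn.a_assoc[symmetric] Mn.r_neg)
  ultimately show ?thesis by (simp add: GL_eq_Units)
qed

lemma mat_CT_eqI:
  assumes "x \<in> mats CT n" "y \<in> mats CT n"
    and "\<And>z. z \<in> circle \<Longrightarrow> mat_map n (\<lambda>g. g z) x = mat_map n (\<lambda>g. g z) y"
  shows "x = y"
proof (rule mat_ext[OF assms(1,2)])
  fix i j assume ij: "i < n" "j < n"
  show "x (i, j) = y (i, j)"
  proof (rule ccont_ext)
    show "x (i, j) z = y (i, j) z" if "z \<in> circle" for z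
      using fun_cong[OF assms(3)[OF that], of "(i, j)"] ij by simp
  qed (use mat_carrierD[OF assms(1) ij] mat_carrierD[OF assms(2) ij] in \<open>simp_all only: CT_simps(1) mem_Collect_eq\<close>)
qed

lemma vec_CT_eqI:
  assumes "v \<in> vecs CT n" "w \<in> vecs CT n"
    and "\<And>z. z \<in> circle \<Longrightarrow> vec_map n (\<lambda>g. g z) v = vec_map n (\<lambda>g. g z) w"
  shows "v = w"
proof (rule vec_ext[OF assms(1,2)])
  fix i assume i: "i < n"
  have c: "v i \<in> carrier CT" "w i \<in> carrier CT" using PiE_mem[OF assms(1)] PiE_mem[OF assms(2)] i by simp_all
  show "v i = w i"
  proof (rule ccont_ext)
    show "v i z = w i z" if "z \<in> circle" for z
      using fun_cong[OF assms(3)[OF that], of i] i by simp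
  qed (use c in \<open>simp_all only: CT_simps(1) mem_Collect_eq\<close>)
qed

lemma ccont_scale:
  assumes t: "continuous_on circle t" and a: "a \<in> carrier A"
  shows "ccont (\<lambda>z\<in>circle. complex_of_real (t z) \<odot> a)"
proof (rule ccontI[where f = "\<lambda>z w. \<bar>t w - t z\<bar> * nrm A a"])
  show "(\<lambda>z\<in>circle. complex_of_real (t z) \<odot> a) \<in> circle \<rightarrow>\<^sub>E carrier A"
    using a by (intro restrict_PiE_iff[THEN iffD2] ballI smult_closed')
  show "((\<lambda>w. \<bar>t w - t z\<bar> * nrm A a) \<longlongrightarrow> 0) (at z within circle)" if z: "z \<in> circle" for z
  proof -
    have "((\<lambda>w. \<bar>t w - t z\<bar> * nrm A a) \<longlongrightarrow> \<bar>t z - t z\<bar> * nrm A a) (at z within circle)"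
      using t z by (intro tendsto_intros) (auto simp: continuous_on_def simp del: mem_sphere_0)
    then show ?thesis by simp
  qed
  show "nrm A ((\<lambda>z\<in>circle. complex_of_real (t z) \<odot> a) w \<ominus> (\<lambda>z\<in>circle. complex_of_real (t z) \<odot> a) z) \<le> \<bar>t w - t z\<bar> * nrm A a"
    if "z \<in> circle" "w \<in> circle" for z w
  proof -
    have "nrm A (complex_of_real (t w) \<odot> a \<ominus> complex_of_real (t z) \<odot> a) = \<bar>t w - t z\<bar> * nrm A a"
      using a by (simp flip: smult_minus_left of_real_diff add: nrm_smult)
    then show ?thesis using that by (simp del: mem_sphere_0)
  qed
qed

text \<open>A path in \<open>GL\<^sub>n(A)\<close> is encoded as a matrix over \<open>C(\<T>) \<otimes> A\<close>, the endpoints being its values at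
  \<open>1\<close> and \<open>-1\<close>. This makes the paths from \<open>1\<close> into a group.\<close>

definition loop :: "nat \<Rightarrow> (nat \<times> nat \<Rightarrow> complex \<Rightarrow> 'a) \<Rightarrow> (nat \<times> nat \<Rightarrow> 'a) \<Rightarrow> bool" where
  "loop n p x \<longleftrightarrow> p \<in> GL CT n \<and> mat_map n (\<lambda>g. g 1) p = \<one>\<^bsub>mat_ring A n\<^esub> \<and> mat_map n (\<lambda>g. g (-1)) p = x"

lemma loop_one: "loop n \<one>\<^bsub>mat_ring CT n\<^esub> \<one>\<^bsub>mat_ring A n\<^esub>"
proof -
  interpret E: coeff_hom CT A "\<lambda>g. g 1" by (rule ev_hom) simp
  interpret F: coeff_hom CT A "\<lambda>g. g (-1)" by (rule ev_hom) simp
  show ?thesis unfolding loop_def by (simp add: E.mat_map_one F.mat_map_one E.A.GL_one)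
qed

lemma loop_mult:
  assumes "loop n p x" "loop n q y"
  shows "loop n (p \<otimes>\<^bsub>mat_ring CT n\<^esub> q) (x \<otimes>\<^bsub>mat_ring A n\<^esub> y)"
proof -
  interpret E: coeff_hom CT A "\<lambda>g. g 1" by (rule ev_hom) simp
  interpret F: coeff_hom CT A "\<lambda>g. g (-1)" by (rule ev_hom) simp
  interpret Mn: ring "mat_ring A n" by (rule ring_mat)
  show ?thesis using assms unfolding loop_def by (simp add: E.mat_map_mult F.mat_map_mult)
qed

lemma loop_inv:
  assumes "loop n p x"
  shows "loop n (inv\<^bsub>mat_ring CT n\<^esub> p) (inv\<^bsub>mat_ring A n\<^esub> x)"
proof -
  interpret E: coeff_hom CT A "\<lambda>g. g 1" by (rule ev_hom) simp
  interpret F: coeff_hom CT A "\<lambda>g. g (-1)" by (rule ev_hom) simp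
  interpret Mn: ring "mat_ring A n" by (rule ring_mat)
  show ?thesis using assms unfolding loop_def by (simp add: E.mat_map_inv F.mat_map_inv)
qed

lemma loop_GL: assumes "loop n p x" shows "x \<in> GL A n"
proof -
  interpret F: coeff_hom CT A "\<lambda>g. g (-1)" by (rule ev_hom) simp
  show ?thesis using assms unfolding loop_def by auto
qed

text \<open>The straight line from \<one> to \<open>x\<close> with parameter
  \<open>(1 - Re z) / 2\<close>, which is 0 at 1 and 1 at -1. As one matrix over the circle algebra
  it is close to \<one>, so \<open>near_one_GL\<close> yields invertibility along the line together
  with continuity of the inverse. The factor in the last hypothesis turns the bound on its entries
  into one on the matrix.\<close>

lemma near_one_loop:
  assumes x: "x \<in> mats A n"
    and le: "mat_nrm A n (x \<ominus>\<^bsub>mat_ring A n\<^esub> \<one>\<^bsub>mat_ring A n\<^esub>) \<le> e" and e: "real n * real n * e \<le> 1/2"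
  shows "\<exists>p. loop n p x"
proof -
  interpret T: unital_cstar_algebra CT by (rule unital_cstar_algebra_circle_tensor)
  interpret Mn: ring "mat_ring A n" by (rule ring_mat)
  interpret MT: ring "mat_ring CT n" by (rule T.ring_mat)
  define a where "a = x \<ominus>\<^bsub>mat_ring A n\<^esub> \<one>\<^bsub>mat_ring A n\<^esub>"
  have a: "a \<in> mats A n" using x by (simp add: a_def)
  define b where "b = (\<lambda>p\<in>{..<n} \<times> {..<n}. \<lambda>z\<in>circle. complex_of_real ((1 - Re z) / 2) \<odot> a p)"
  have bc: "ccont (b (i, j))" if "i < n" "j < n" for i j
  proof -
    have e: "b (i, j) = (\<lambda>z\<in>circle. complex_of_real ((1 - Re z) / 2) \<odot> a (i, j))"
      unfolding b_def using that by simp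
    show ?thesis unfolding e
      by (rule ccont_scale[OF _ mat_carrierD[OF a that]]) (intro continuous_intros, simp)
  qed
  have be: "b (i, j) z = complex_of_real ((1 - Re z) / 2) \<odot> a (i, j)" if "i < n" "j < n" "z \<in> circle" for i j z
    unfolding b_def using that by (simp del: mem_sphere_0)
  have b: "b \<in> mats CT n"
    unfolding mat_carrier
  proof (rule PiE_I)
    fix p assume "p \<in> {..<n} \<times> {..<n}"
    then obtain i j where "p = (i, j)" "i < n" "j < n" by auto
    then show "b p \<in> carrier CT" using bc[of i j] by (simp only: CT_simps(1) mem_Collect_eq)
  qed (simp add: b_def)
  define p where "p = \<one>\<^bsub>mat_ring CT n\<^esub> \<oplus>\<^bsub>mat_ring CT n\<^esub> b"
  have p: "p \<in> mats CT n" using b by (simp add: p_def)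
  have pe: "mat_map n (\<lambda>g. g z) p (i, j) = \<one>\<^bsub>mat_ring A n\<^esub> (i, j) \<oplus> complex_of_real ((1 - Re z) / 2) \<odot> a (i, j)"
    if ij: "i < n" "j < n" "z \<in> circle" for i j z
    using ij by (simp add: p_def mat_entries CT_apply be if_distrib[of "\<lambda>g. g z"] del: mem_sphere_0)
  have "p \<in> GL CT n"
  proof (rule T.near_one_GL[OF p])
    have "p \<ominus>\<^bsub>mat_ring CT n\<^esub> \<one>\<^bsub>mat_ring CT n\<^esub> = b"
      using b MT.a_comm[OF MT.one_closed b] by (simp add: p_def MT.minus_eq MT.a_assoc MT.r_neg)
    moreover have "mat_nrm CT n b \<le> real n * real n * e"
    proof (rule T.mat_nrm_bound)
      fix i j assume ij: "i < n" "j < n"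
      show "nrm CT (b (i, j)) \<le> e"
      proof (rule nrm_CT_leI)
        fix z :: complex assume z: "z \<in> circle"
        have "\<bar>Re z\<bar> \<le> 1" using z abs_Re_le_cmod[of z] by simp
        then have "\<bar>(1 - Re z) / 2\<bar> \<le> 1" by simp
        moreover have "nrm A (b (i, j) z) = \<bar>(1 - Re z) / 2\<bar> * nrm A (a (i, j))"
          unfolding be[OF ij z] using mat_carrierD[OF a ij] by (simp only: nrm_smult norm_of_real)
        ultimately have "nrm A (b (i, j) z) \<le> 1 * nrm A (a (i, j))"
          using nrm_nonneg[OF mat_carrierD[OF a ij]] by (simp only:) (rule mult_right_mono)
        then show "nrm A (b (i, j) z) \<le> e"
          using nrm_entry_le[OF a ij] le by (simp add: a_def)
      qed
    qed
    ultimately show "mat_nrm CT n (p \<ominus>\<^bsub>mat_ring CT n\<^esub> \<one>\<^bsub>mat_ring CT n\<^esub>) \<le> 1/2" using e by simp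
  qed
  moreover have "mat_map n (\<lambda>g. g 1) p = \<one>\<^bsub>mat_ring A n\<^esub>"
  proof (rule mat_ext[where A = A and n = n])
    interpret E: coeff_hom CT A "\<lambda>g. g 1" by (rule ev_hom) simp
    show "mat_map n (\<lambda>g. g 1) p \<in> mats A n" using p by (rule E.mat_map_closed)
    fix i j assume ij: "i < n" "j < n"
    show "mat_map n (\<lambda>g. g 1) p (i, j) = \<one>\<^bsub>mat_ring A n\<^esub> (i, j)"
      using pe[OF ij, of 1] mat_carrierD[OF a ij] mat_carrierD[OF mat_const_closed(1) ij] smult_l_null[OF mat_carrierD[OF a ij]]
      by simp
  qed simp
  moreover have "mat_map n (\<lambda>g. g (-1)) p = x"
  proof (rule mat_ext[where A = A and n = n])
    interpret E: coeff_hom CT A "\<lambda>g. g (-1)" by (rule ev_hom) simp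
    show "mat_map n (\<lambda>g. g (-1)) p \<in> mats A n" using p by (rule E.mat_map_closed)
    fix i j assume ij: "i < n" "j < n"
    show "mat_map n (\<lambda>g. g (-1)) p (i, j) = x (i, j)"
      using pe[OF ij, of "-1"] mat_carrierD[OF a ij] mat_carrierD[OF mat_const_closed(1) ij] mat_carrierD[OF x ij]
      by (simp add: a_def mat_minus[OF x _ ij] add_minus_cancel)
  qed (use x in simp)
  ultimately show ?thesis unfolding loop_def by blast
qed

lemma topspace_GL: "topspace (GL_topology A n) = GL A n"
proof -
  have "GL A n \<subseteq> {..<n} \<times> {..<n} \<rightarrow>\<^sub>E carrier A" using GL_closed by (auto simp: mat_carrier)
  then show ?thesis unfolding GL_topology_def cstar_topology_def by auto
qed

lemma GL_nbhd:
  assumes g: "g \<in> GL A n" and e: "e > 0"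
  shows "\<exists>U. openin (GL_topology A n) U \<and> g \<in> U \<and>
    (\<forall>x\<in>U. x \<in> GL A n \<and> mat_nrm A n (x \<otimes>\<^bsub>mat_ring A n\<^esub> inv\<^bsub>mat_ring A n\<^esub> g \<ominus>\<^bsub>mat_ring A n\<^esub> \<one>\<^bsub>mat_ring A n\<^esub>) < e)"
proof -
  interpret Mn: complete_normed_ring "mat_ring A n" "mat_nrm A n" by (rule mat_complete_normed_ring)
  note gc = GL_closed[OF g] note ic = GL_closed[OF GL_inv[OF g]]
  define m where "m = mat_nrm A n (inv\<^bsub>mat_ring A n\<^esub> g)"
  have m: "0 \<le> m" unfolding m_def by (rule Mn.N_nonneg[OF ic])
  \<comment> \<open>Since \<open>x g^-1 - 1 = (x - g) g^-1\<close>, the norm to be bounded is at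
    most \<open>real n * real n * r * m\<close>. The summand 1 keeps the denominator
    positive.\<close>
  define r where "r = e / (real n * real n * m + 1)"
  have pos: "real n * real n * m + 1 > 0" using m by (simp add: add_nonneg_pos)
  have r: "r > 0" "real n * real n * r * m < e" using e m pos by (simp_all add: r_def field_simps)
  define U where "U = (Pi\<^sub>E ({..<n} \<times> {..<n}) (\<lambda>p. metric.mball (g p) r)) \<inter> GL A n"
  have "openin (GL_topology A n) U"
    unfolding GL_topology_def U_def cstar_topology_def
    by (intro openin_subtopology_Int openin_PiE_gen[THEN iffD2] disjI2 conjI) auto
  moreover have "g \<in> U"
    using g gc r(1) unfolding U_def by (auto simp: mat_carrier)
  moreover have "mat_nrm A n (x \<otimes>\<^bsub>mat_ring A n\<^esub> inv\<^bsub>mat_ring A n\<^esub> g \<ominus>\<^bsub>mat_ring A n\<^esub> \<one>\<^bsub>mat_ring A n\<^esub>) < e" if "x \<in> U" for x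
  proof -
    have x: "x \<in> GL A n" using that by (simp add: U_def)
    note xc = GL_closed[OF x]
    have "nrm A ((x \<ominus>\<^bsub>mat_ring A n\<^esub> g) (i, j)) \<le> r" if ij: "i < n" "j < n" for i j
    proof -
      have "x (i, j) \<in> metric.mball (g (i, j)) r" using \<open>x \<in> U\<close> ij
          PiE_mem[of x "{..<n} \<times> {..<n}" "\<lambda>p. metric.mball (g p) r" "(i, j)"] by (simp add: U_def)
      then show ?thesis
        unfolding mat_minus[OF xc gc ij] using nrm_minus_commute[OF mat_carrierD[OF xc ij] mat_carrierD[OF gc ij]]
        by (simp add: metric.in_mball cstar_dist_def split: if_splits)
    qed
    then have 1: "mat_nrm A n (x \<ominus>\<^bsub>mat_ring A n\<^esub> g) \<le> real n * real n * r" by (rule mat_nrm_bound)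
    have "x \<otimes>\<^bsub>mat_ring A n\<^esub> inv\<^bsub>mat_ring A n\<^esub> g \<ominus>\<^bsub>mat_ring A n\<^esub> \<one>\<^bsub>mat_ring A n\<^esub> = (x \<ominus>\<^bsub>mat_ring A n\<^esub> g) \<otimes>\<^bsub>mat_ring A n\<^esub> inv\<^bsub>mat_ring A n\<^esub> g"
      using xc gc ic g by (simp add: Mn.mult_minus_distrib)
    then have "mat_nrm A n (x \<otimes>\<^bsub>mat_ring A n\<^esub> inv\<^bsub>mat_ring A n\<^esub> g \<ominus>\<^bsub>mat_ring A n\<^esub> \<one>\<^bsub>mat_ring A n\<^esub>) \<le> mat_nrm A n (x \<ominus>\<^bsub>mat_ring A n\<^esub> g) * m"
      using Mn.N_mult[of "x \<ominus>\<^bsub>mat_ring A n\<^esub> g" "inv\<^bsub>mat_ring A n\<^esub> g"] xc gc ic by (simp add: m_def)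
    also have "\<dots> \<le> real n * real n * r * m" using 1 m by (rule mult_right_mono)
    finally show ?thesis using r(2) by simp
  qed
  ultimately show ?thesis by (intro exI[of _ U]) (auto simp: U_def)
qed

text \<open>A subgroup containing a neighbourhood of \<open>1\<close> is open, and so are its cosets; hence it is clopen.\<close>

lemma GL0_subset:
  assumes H: "H \<subseteq> GL A n" "\<one>\<^bsub>mat_ring A n\<^esub> \<in> H"
    and mult: "\<And>x y. \<lbrakk>x \<in> H; y \<in> H\<rbrakk> \<Longrightarrow> x \<otimes>\<^bsub>mat_ring A n\<^esub> y \<in> H"
    and inv: "\<And>x. x \<in> H \<Longrightarrow> inv\<^bsub>mat_ring A n\<^esub> x \<in> H"
    and e: "e > 0" "\<And>x. \<lbrakk>x \<in> GL A n; mat_nrm A n (x \<ominus>\<^bsub>mat_ring A n\<^esub> \<one>\<^bsub>mat_ring A n\<^esub>) < e\<rbrakk> \<Longrightarrow> x \<in> H"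
  shows "GL0 A n \<subseteq> H"
proof -
  have nb: "\<exists>U. openin (GL_topology A n) U \<and> g \<in> U \<and> (\<forall>x\<in>U. x \<in> GL A n \<and> x \<otimes>\<^bsub>mat_ring A n\<^esub> inv\<^bsub>mat_ring A n\<^esub> g \<in> H)"
    if g: "g \<in> GL A n" for g
  proof -
    obtain U where U: "openin (GL_topology A n) U" "g \<in> U"
      "\<And>x. x \<in> U \<Longrightarrow> x \<in> GL A n \<and> mat_nrm A n (x \<otimes>\<^bsub>mat_ring A n\<^esub> inv\<^bsub>mat_ring A n\<^esub> g \<ominus>\<^bsub>mat_ring A n\<^esub> \<one>\<^bsub>mat_ring A n\<^esub>) < e"
      using GL_nbhd[OF g e(1)] by blast
    have "x \<otimes>\<^bsub>mat_ring A n\<^esub> inv\<^bsub>mat_ring A n\<^esub> g \<in> H" if "x \<in> U" for x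
      using U(3)[OF that] g by (intro e(2)) simp_all
    then show ?thesis using U by blast
  qed
  have "openin (GL_topology A n) H"
  proof (subst openin_subopen, intro ballI)
    fix g assume g: "g \<in> H"
    then obtain U where U: "openin (GL_topology A n) U" "g \<in> U"
      "\<And>x. x \<in> U \<Longrightarrow> x \<in> GL A n \<and> x \<otimes>\<^bsub>mat_ring A n\<^esub> inv\<^bsub>mat_ring A n\<^esub> g \<in> H"
      using nb[OF subsetD[OF H(1) g]] by (elim exE conjE) blast
    have "x \<in> H" if "x \<in> U" for x
    proof -
      have "x \<otimes>\<^bsub>mat_ring A n\<^esub> inv\<^bsub>mat_ring A n\<^esub> g \<otimes>\<^bsub>mat_ring A n\<^esub> g \<in> H" by (rule mult[OF conjunct2[OF U(3)[OF that]] g])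
      then show ?thesis using U(3)[OF that] g H(1) by (simp add: GL_cancel subset_iff)
    qed
    then show "\<exists>T. openin (GL_topology A n) T \<and> g \<in> T \<and> T \<subseteq> H" using U by blast
  qed
  moreover have "openin (GL_topology A n) (GL A n - H)"
  proof (subst openin_subopen, intro ballI)
    fix g assume g: "g \<in> GL A n - H"
    then obtain U where U: "openin (GL_topology A n) U" "g \<in> U"
      "\<And>x. x \<in> U \<Longrightarrow> x \<in> GL A n \<and> x \<otimes>\<^bsub>mat_ring A n\<^esub> inv\<^bsub>mat_ring A n\<^esub> g \<in> H"
      using nb[OF DiffD1[OF g]] by (elim exE conjE) blast
    have "x \<notin> H" if "x \<in> U" for x
    proof
      assume "x \<in> H"
      interpret Mn: ring "mat_ring A n" by (rule ring_mat)
      let ?k = "x \<otimes>\<^bsub>mat_ring A n\<^esub> inv\<^bsub>mat_ring A n\<^esub> g"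
      have k: "?k \<in> GL A n" "x \<in> GL A n" "g \<in> GL A n" using U(3)[OF that] g H(1) by auto
      have "?k \<otimes>\<^bsub>mat_ring A n\<^esub> g = x" using k by (simp add: GL_cancel)
      then have "inv\<^bsub>mat_ring A n\<^esub> ?k \<otimes>\<^bsub>mat_ring A n\<^esub> x = g" using GL_cancel(1)[OF k(1) GL_closed[OF k(3)]] by simp
      moreover have "inv\<^bsub>mat_ring A n\<^esub> ?k \<otimes>\<^bsub>mat_ring A n\<^esub> x \<in> H"
        by (rule mult[OF inv[OF conjunct2[OF U(3)[OF that]]] \<open>x \<in> H\<close>])
      ultimately show False using g by simp
    qed
    then show "\<exists>T. openin (GL_topology A n) T \<and> g \<in> T \<and> T \<subseteq> GL A n - H" using U by blast
  qed
  ultimately have "closedin (GL_topology A n) H" "openin (GL_topology A n) H"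
    using H(1) by (simp_all add: closedin_def topspace_GL)
  show ?thesis
  proof
    fix x assume "x \<in> GL0 A n"
    then obtain C where C: "connectedin (GL_topology A n) C" "\<one>\<^bsub>mat_ring A n\<^esub> \<in> C" "x \<in> C"
      unfolding GL0_def one_mat_monoid connected_component_of_def by blast
    have "C \<subseteq> H \<or> disjnt C H"
      by (rule connectedin_clopen_cases[OF C(1)]) fact+
    then show "x \<in> H" using C(2,3) H(2) by (auto simp: disjnt_def)
  qed
qed

lemma one_GL0: "\<one>\<^bsub>mat_ring A n\<^esub> \<in> GL0 A n"
  unfolding GL0_def one_mat_monoid by (simp add: connected_component_of_refl topspace_GL)

lemma GL0_subset_GL: "GL0 A n \<subseteq> GL A n"
  unfolding GL0_def using connected_component_of_subset_topspace[of "GL_topology A n"] by (simp add: topspace_GL)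

text \<open>The ends of paths form a subgroup which contains a neighbourhood of \<one> by
  \<open>near_one_loop\<close>, so \<open>GL0_subset\<close> applies. This is where connectedness is
  turned into paths.\<close>

lemma GL0_loop: assumes "x \<in> GL0 A n" shows "\<exists>p. loop n p x"
proof -
  \<comment> \<open>Chosen to meet the bound 1/2 in \<open>near_one_loop\<close>; the summand 1
    keeps the denominator positive for \<open>n = 0\<close>.\<close>
  define e :: real where "e = 1 / (2 * (real n * real n + 1))"
  have e: "e > 0" "real n * real n * e \<le> 1/2"
    by (simp_all add: e_def field_simps add_pos_nonneg)
  have "GL0 A n \<subseteq> {x. \<exists>p. loop n p x}"
  proof (rule GL0_subset)
    show "{x. \<exists>p. loop n p x} \<subseteq> GL A n" using loop_GL by blast
    show "\<one>\<^bsub>mat_ring A n\<^esub> \<in> {x. \<exists>p. loop n p x}" using loop_one by blast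
    show "x \<otimes>\<^bsub>mat_ring A n\<^esub> y \<in> {x. \<exists>p. loop n p x}" if "x \<in> {x. \<exists>p. loop n p x}" "y \<in> {x. \<exists>p. loop n p x}" for x y
      using that loop_mult by blast
    show "inv\<^bsub>mat_ring A n\<^esub> x \<in> {x. \<exists>p. loop n p x}" if "x \<in> {x. \<exists>p. loop n p x}" for x
      using that loop_inv by blast
    show "x \<in> {x. \<exists>p. loop n p x}" if "x \<in> GL A n" "mat_nrm A n (x \<ominus>\<^bsub>mat_ring A n\<^esub> \<one>\<^bsub>mat_ring A n\<^esub>) < e" for x
      using near_one_loop[OF GL_closed[OF that(1)] _ e(2)] that(2) by simp
  qed (rule e(1))
  then show ?thesis using assms by blast
qed

end

section \<open>Lifting invertible matrices along a surjection\<close>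

context cstar_morphism
begin

text \<open>If \<open>c a c = c\<close> for a row \<open>a\<close>, then \<open>1 - c a\<close> projects lifts of matrices annihilating \<open>h c\<close> onto
  lifts annihilating \<open>c\<close>. The case \<open>c = 0\<close> is the lifting without side condition.\<close>

lemma near_one_lift:
  assumes surj: "h ` carrier A = carrier B"
    and c: "c \<in> vecs A n" and a: "a \<in> vecs A n"
    and cac: "\<And>i. i < n \<Longrightarrow> c i \<otimes>\<^bsub>A\<^esub> lin_comb A n a c = c i"
  shows "\<exists>e>0. \<forall>x\<in>mats B n.
    mat_nrm B n (x \<ominus>\<^bsub>mat_ring B n\<^esub> \<one>\<^bsub>mat_ring B n\<^esub>) < e \<longrightarrow> mat_vec B n x (vec_map n h c) = vec_map n h c \<longrightarrow>
    (\<exists>y\<in>GL A n. mat_map n h y = x \<and> mat_vec A n y c = c)"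
proof -
  obtain K where K0: "K \<ge> 0" and K: "\<And>y. y \<in> carrier B \<Longrightarrow> \<exists>x\<in>carrier A. h x = y \<and> nrm A x \<le> K * nrm B y"
    using bounded_lift_of_surj[OF surj] by blast
  interpret MA: ring "mat_ring A n" by (rule A.ring_mat)
  interpret MB: ring "mat_ring B n" by (rule B.ring_mat)
  have cc: "c k \<in> carrier A" and ac: "a k \<in> carrier A" if "k < n" for k
    using PiE_mem[OF c] PiE_mem[OF a] that by simp_all
  define S T where "S = (\<Sum>k<n. nrm A (c k))" and "T = (\<Sum>k<n. nrm A (a k))"
  have S: "0 \<le> S" and T: "0 \<le> T" by (auto simp: S_def T_def intro!: sum_nonneg A.nrm_nonneg cc ac)
  have aT: "nrm A (a j) \<le> T" if "j < n" for j
    unfolding T_def using that by (intro member_le_sum) (auto intro!: A.nrm_nonneg ac)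
  \<comment> \<open>The entries are first lifted with norm at most \<open>K * e\<close>; the
    correction below adds at most \<open>K * e * S * T\<close> to each of the
    \<open>real n * real n\<close> entries. The choice of \<open>e\<close> makes the total at most
    1/2, as \<open>near_one_GL\<close> demands.\<close>
  define L where "L = real n * real n * (K * (1 + S * T))"
  have L: "0 \<le> L" using K0 S T by (simp add: L_def)
  define e where "e = 1 / (2 * (L + 1))"
  have e: "e > 0" "L * e \<le> 1/2" using L by (simp_all add: e_def field_simps)
  have "\<exists>y\<in>GL A n. mat_map n h y = x \<and> mat_vec A n y c = c"
    if x: "x \<in> mats B n"
      and small: "mat_nrm B n (x \<ominus>\<^bsub>mat_ring B n\<^esub> \<one>\<^bsub>mat_ring B n\<^esub>) < e"
      and fix_c: "mat_vec B n x (vec_map n h c) = vec_map n h c" for x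
  proof -
    define t where "t = x \<ominus>\<^bsub>mat_ring B n\<^esub> \<one>\<^bsub>mat_ring B n\<^esub>"
    have t: "t \<in> mats B n" using x by (simp add: t_def)
    note tc = mat_carrierD[OF t]
    have te: "t (i, j) = x (i, j) \<ominus>\<^bsub>B\<^esub> (if i = j then \<one>\<^bsub>B\<^esub> else \<zero>\<^bsub>B\<^esub>)" if "i < n" "j < n" for i j
      using that by (simp add: t_def B.mat_minus[OF x MB.one_closed] mat_entries)
    have "\<exists>l\<in>carrier A. h l = t (i, j) \<and> nrm A l \<le> K * e" if ij: "i < n" "j < n" for i j
    proof -
      obtain l where l: "l \<in> carrier A" "h l = t (i, j)" "nrm A l \<le> K * nrm B (t (i, j))"
        using K[OF tc[OF ij]] by blast
      moreover have "K * nrm B (t (i, j)) \<le> K * e"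
        using B.nrm_entry_le[OF t ij] small K0 by (intro mult_left_mono) (simp_all add: t_def)
      ultimately show ?thesis using order_trans by blast
    qed
    then obtain l where l: "\<And>i j. \<lbrakk>i < n; j < n\<rbrakk> \<Longrightarrow> l i j \<in> carrier A"
      "\<And>i j. \<lbrakk>i < n; j < n\<rbrakk> \<Longrightarrow> h (l i j) = t (i, j)"
      "\<And>i j. \<lbrakk>i < n; j < n\<rbrakk> \<Longrightarrow> nrm A (l i j) \<le> K * e"
      by metis
    define u where "u i = lin_comb A n (l i) c" for i
    have uc: "u i \<in> carrier A" if "i < n" for i using that l(1) cc by (simp add: u_def)
    have un: "nrm A (u i) \<le> K * e * S" if i: "i < n" for i
    proof -
      have "nrm A (u i) \<le> (\<Sum>k<n. nrm A (l i k) * nrm A (c k))"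
        unfolding u_def using i l(1) cc by (intro A.nrm_lin_comb) simp_all
      also have "\<dots> \<le> (\<Sum>k<n. K * e * nrm A (c k))"
        using i l(3) cc by (intro sum_mono mult_right_mono) (simp_all add: A.nrm_nonneg)
      finally show ?thesis by (simp add: S_def sum_distrib_left)
    qed
    \<comment> \<open>\<open>h (u i)\<close> is entry \<open>i\<close> of \<open>x - 1\<close>
      applied to the image of \<open>c\<close>, and \<open>x\<close> fixes this image.\<close>
    have hu: "h (u i) = \<zero>\<^bsub>B\<^esub>" if i: "i < n" for i
    proof -
      have hc: "h (c k) \<in> carrier B" if "k < n" for k using cc that by simp
      have xc: "x (i, k) \<in> carrier B" if "k < n" for k using mat_carrierD[OF x i that] .
      have "h (u i) = lin_comb B n (\<lambda>k. h (l i k)) (\<lambda>k. h (c k))"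
        unfolding u_def using i l(1) cc by (intro h_lin_comb) simp_all
      also have "\<dots> = lin_comb B n (\<lambda>k. x (i, k) \<ominus>\<^bsub>B\<^esub> (if i = k then \<one>\<^bsub>B\<^esub> else \<zero>\<^bsub>B\<^esub>)) (\<lambda>k. h (c k))"
        using i l(1,2) cc te xc by (intro B.lin_comb_cong) simp_all
      also have "\<dots> = lin_comb B n (\<lambda>k. x (i, k)) (\<lambda>k. h (c k)) \<ominus>\<^bsub>B\<^esub> lin_comb B n (\<lambda>k. if i = k then \<one>\<^bsub>B\<^esub> else \<zero>\<^bsub>B\<^esub>) (\<lambda>k. h (c k))"
        using xc hc by (intro B.lin_comb_minus_left) simp_all
      also have "lin_comb B n (\<lambda>k. x (i, k)) (\<lambda>k. h (c k)) = lin_comb B n (\<lambda>k. x (i, k)) (vec_map n h c)"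
        using xc hc by (intro B.lin_comb_cong) simp_all
      also have "\<dots> = h (c i)" using fun_cong[OF fix_c, of i] i by (simp add: mat_vec_apply)
      also have "lin_comb B n (\<lambda>k. if i = k then \<one>\<^bsub>B\<^esub> else \<zero>\<^bsub>B\<^esub>) (\<lambda>k. h (c k)) = h (c i)"
        using hc i by (simp add: B.lin_comb_delta_left)
      finally show ?thesis using hc[OF i] by (simp add: a_minus_def B.r_neg)
    qed
    \<comment> \<open>The lift \<open>l\<close> times the projection \<open>1 - c a\<close>, written
      with \<open>u = l c\<close>. The image under \<open>h\<close> is unchanged because
      \<open>h\<close> annihilates \<open>u\<close>.\<close>
    define m where "m i j = l i j \<ominus>\<^bsub>A\<^esub> u i \<otimes>\<^bsub>A\<^esub> a j" for i j
    have mc: "m i j \<in> carrier A" if "i < n" "j < n" for i j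
      using that l(1) uc ac by (simp add: m_def)
    have hm: "h (m i j) = t (i, j)" if "i < n" "j < n" for i j
      using that l(1,2) uc ac hu tc by (simp add: m_def B.minus_eq)
    have mn: "nrm A (m i j) \<le> K * (1 + S * T) * e" if ij: "i < n" "j < n" for i j
    proof -
      have "nrm A (m i j) \<le> nrm A (l i j) + nrm A (u i \<otimes>\<^bsub>A\<^esub> a j)"
        unfolding m_def using ij l(1) uc ac by (intro A.nrm_minus_le) simp_all
      also have "nrm A (u i \<otimes>\<^bsub>A\<^esub> a j) \<le> nrm A (u i) * nrm A (a j)"
        using ij uc ac by (intro A.nrm_mult) simp_all
      also have "\<dots> \<le> K * e * S * T"
        using ij un aT K0 e S uc ac by (intro mult_mono) (simp_all add: A.nrm_nonneg)
      finally show ?thesis using l(3)[OF ij] by (simp add: algebra_simps)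
    qed
    have mzero: "lin_comb A n (m i) c = \<zero>\<^bsub>A\<^esub>" if i: "i < n" for i
    proof -
      have q: "lin_comb A n a c \<in> carrier A" using ac cc by simp
      have "lin_comb A n (m i) c = u i \<ominus>\<^bsub>A\<^esub> lin_comb A n (\<lambda>j. u i \<otimes>\<^bsub>A\<^esub> a j) c"
        unfolding m_def u_def[of i, symmetric] using i l(1) uc ac cc by (subst A.lin_comb_minus_left) (simp_all add: u_def)
      also have "lin_comb A n (\<lambda>j. u i \<otimes>\<^bsub>A\<^esub> a j) c = u i \<otimes>\<^bsub>A\<^esub> lin_comb A n a c"
        using i uc ac cc by (intro A.lin_comb_mult_left) simp_all
      also have "\<dots> = lin_comb A n (l i) (\<lambda>k. c k \<otimes>\<^bsub>A\<^esub> lin_comb A n a c)"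
        unfolding u_def using i l(1) cc q by (subst A.lin_comb_mult_right) simp_all
      also have "\<dots> = u i" unfolding u_def using i l(1) cc q by (intro A.lin_comb_cong) (simp_all add: cac)
      finally show ?thesis using uc[OF i] by (simp add: a_minus_def A.r_neg)
    qed
    define d where "d = (\<lambda>(i, j)\<in>{..<n} \<times> {..<n}. m i j)"
    have de: "d (i, j) = m i j" if "i < n" "j < n" for i j using that by (simp add: d_def)
    have d: "d \<in> mats A n"
      unfolding mat_carrier by (rule PiE_I) (use mc de in \<open>auto simp: d_def\<close>)
    define y where "y = \<one>\<^bsub>mat_ring A n\<^esub> \<oplus>\<^bsub>mat_ring A n\<^esub> d"
    have y: "y \<in> mats A n" using d by (simp add: y_def)
    have ye: "y (i, j) = (if i = j then \<one>\<^bsub>A\<^esub> else \<zero>\<^bsub>A\<^esub>) \<oplus>\<^bsub>A\<^esub> m i j" if "i < n" "j < n" for i j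
      using that by (simp add: y_def mat_entries de)
    have "y \<ominus>\<^bsub>mat_ring A n\<^esub> \<one>\<^bsub>mat_ring A n\<^esub> = d"
      using d MA.a_comm[OF MA.one_closed d] by (simp add: y_def MA.minus_eq MA.a_assoc MA.r_neg)
    moreover have "mat_nrm A n d \<le> real n * real n * (K * (1 + S * T) * e)"
      by (rule A.mat_nrm_bound) (simp add: de mn)
    ultimately have "mat_nrm A n (y \<ominus>\<^bsub>mat_ring A n\<^esub> \<one>\<^bsub>mat_ring A n\<^esub>) \<le> 1/2"
      using e(2) by (simp add: L_def mult.assoc)
    then have "y \<in> GL A n" by (rule A.near_one_GL[OF y])
    moreover have "mat_map n h y = x"
    proof (rule mat_ext[where A = B and n = n])
      fix i j assume ij: "i < n" "j < n"
      have "h (y (i, j)) = (if i = j then \<one>\<^bsub>B\<^esub> else \<zero>\<^bsub>B\<^esub>) \<oplus>\<^bsub>B\<^esub> t (i, j)"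
        unfolding ye[OF ij] using mc[OF ij] hm[OF ij] by simp
      then show "mat_map n h y (i, j) = x (i, j)"
        using ij mat_carrierD[OF x ij] by (simp add: te B.add_minus_cancel)
    qed (use x y in simp_all)
    moreover have "mat_vec A n y c = c"
    proof (rule vec_ext[where A = A and n = n])
      fix i assume i: "i < n"
      have "mat_vec A n y c i = lin_comb A n (\<lambda>j. (if i = j then \<one>\<^bsub>A\<^esub> else \<zero>\<^bsub>A\<^esub>) \<oplus>\<^bsub>A\<^esub> m i j) c"
        unfolding mat_vec_apply[OF i] using i mat_carrierD[OF y i] cc ye by (intro A.lin_comb_cong) simp_all
      also have "\<dots> = lin_comb A n (\<lambda>j. if i = j then \<one>\<^bsub>A\<^esub> else \<zero>\<^bsub>A\<^esub>) c \<oplus>\<^bsub>A\<^esub> lin_comb A n (m i) c"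
        using i mc cc by (intro A.lin_comb_add_left) simp_all
      also have "\<dots> = c i" using i cc by (simp add: A.lin_comb_delta_left mzero)
      finally show "mat_vec A n y c i = c i" .
    qed (use c y in simp_all)
    ultimately show ?thesis by blast
  qed
  then show ?thesis using e(1) by blast
qed

text \<open>The image of \<open>GL A n\<close> is a subgroup of \<open>GL B n\<close>. With the zero
  vector for \<open>c\<close> the side condition of \<open>near_one_lift\<close> always holds, so
  this subgroup contains a neighbourhood of \<one>, and \<open>GL0_subset\<close> applies.\<close>

lemma GL0_lift:
  assumes surj: "h ` carrier A = carrier B" and x: "x \<in> GL0 B n"
  shows "\<exists>y\<in>GL A n. mat_map n h y = x"
proof -
  let ?c = "\<lambda>k\<in>{..<n}. \<zero>\<^bsub>A\<^esub>"
  have "\<exists>e>0. \<forall>x\<in>mats B n.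
    mat_nrm B n (x \<ominus>\<^bsub>mat_ring B n\<^esub> \<one>\<^bsub>mat_ring B n\<^esub>) < e \<longrightarrow> mat_vec B n x (vec_map n h ?c) = vec_map n h ?c \<longrightarrow>
    (\<exists>y\<in>GL A n. mat_map n h y = x \<and> mat_vec A n y ?c = ?c)"
    by (rule near_one_lift[OF surj, where a = ?c]) simp_all
  then obtain e where e: "e > 0" "\<And>x. \<lbrakk>x \<in> mats B n;
      mat_nrm B n (x \<ominus>\<^bsub>mat_ring B n\<^esub> \<one>\<^bsub>mat_ring B n\<^esub>) < e; mat_vec B n x (vec_map n h ?c) = vec_map n h ?c\<rbrakk>
    \<Longrightarrow> \<exists>y\<in>GL A n. mat_map n h y = x \<and> mat_vec A n y ?c = ?c" by blast
  have z: "mat_vec B n x (vec_map n h ?c) = vec_map n h ?c" if "x \<in> mats B n" for x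
  proof (rule vec_ext[where A = B and n = n])
    fix i assume i: "i < n"
    have "lin_comb B n (\<lambda>k. x (i, k)) (vec_map n h ?c) = lin_comb B n (\<lambda>k. x (i, k)) (\<lambda>k. \<zero>\<^bsub>B\<^esub>)"
      using mat_carrierD[OF that i] by (intro B.lin_comb_cong) simp_all
    then show "mat_vec B n x (vec_map n h ?c) i = vec_map n h ?c i"
      using i mat_carrierD[OF that i] by (simp add: mat_vec_apply B.lin_comb_zero_right)
  qed (use that vec_map_closed[of ?c n] in simp_all)
  have "GL0 B n \<subseteq> mat_map n h ` GL A n"
  proof (rule B.GL0_subset)
    show "mat_map n h ` GL A n \<subseteq> GL B n" by auto
    show "\<one>\<^bsub>mat_ring B n\<^esub> \<in> mat_map n h ` GL A n"
      using mat_map_one[of n] A.GL_one by (metis imageI)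
    show "x \<otimes>\<^bsub>mat_ring B n\<^esub> y \<in> mat_map n h ` GL A n" if "x \<in> mat_map n h ` GL A n" "y \<in> mat_map n h ` GL A n" for x y
      using that by (auto simp flip: mat_map_mult)
    show "inv\<^bsub>mat_ring B n\<^esub> x \<in> mat_map n h ` GL A n" if "x \<in> mat_map n h ` GL A n" for x
      using that by (auto simp flip: mat_map_inv)
    show "x \<in> mat_map n h ` GL A n" if "x \<in> GL B n" "mat_nrm B n (x \<ominus>\<^bsub>mat_ring B n\<^esub> \<one>\<^bsub>mat_ring B n\<^esub>) < e" for x
      using e(2)[OF B.GL_closed[OF that(1)] that(2) z[OF B.GL_closed[OF that(1)]]] by blast
  qed (rule e(1))
  then show ?thesis using x by blast
qed

end

section \<open>Self-maps of the circle\<close>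

text \<open>The unsigned angle. It identifies the circle modulo conjugation with the interval from 0
  to \<open>pi\<close>, the parameter interval of paths from 1 to -1.\<close>

definition circle_angle :: "complex \<Rightarrow> real" where
  "circle_angle z = arccos (Re z)"

text \<open>\<open>fold_circle 1\<close> folds the circle onto the upper half circle, and \<open>fold_circle (-1)\<close> onto the
  lower half circle.\<close>

definition fold_circle :: "real \<Rightarrow> complex \<Rightarrow> complex" where
  "fold_circle l z = cis (l * circle_angle z)"

text \<open>Doubles the speed in the unsigned angle: -1 is reached at angle \<open>pi / 2\<close>,
  and the rest there leaves room for the deformation in \<open>orbit_loop_Lg\<close>.\<close>

definition run_circle :: "complex \<Rightarrow> complex" where
  "run_circle z = cis (min pi (2 * circle_angle z))"

lemma circle_angle_bounds:
  assumes "z \<in> circle" shows "0 \<le> circle_angle z" "circle_angle z \<le> pi"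
proof -
  have "\<bar>Re z\<bar> \<le> 1" using assms abs_Re_le_cmod[of z] by simp
  then show "0 \<le> circle_angle z" "circle_angle z \<le> pi"
    by (simp_all add: circle_angle_def arccos_lbound arccos_ubound)
qed

lemma continuous_circle_angle: "continuous_on circle circle_angle"
proof -
  have "-1 \<le> Re z \<and> Re z \<le> 1" if "z \<in> circle" for z
    using that abs_Re_le_cmod[of z] by (simp add: abs_le_iff)
  then show ?thesis unfolding circle_angle_def by (intro continuous_intros) blast
qed

lemma circle_angle_cis: "\<lbrakk>0 \<le> t; t \<le> pi\<rbrakk> \<Longrightarrow> circle_angle (cis t) = t"
  by (simp add: circle_angle_def arccos_cos)

lemma circle_angle_special [simp]: "circle_angle 1 = 0" "circle_angle (-1) = pi"
  using circle_angle_cis[of 0] circle_angle_cis[of pi] by simp_all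

lemma fold_circle_in [simp]: "fold_circle l z \<in> circle" and run_circle_in [simp]: "run_circle z \<in> circle"
  by (simp_all add: fold_circle_def run_circle_def)

lemma fold_circle_continuous: "continuous_on circle (fold_circle l)"
  unfolding fold_circle_def by (intro continuous_intros continuous_circle_angle)

lemma run_circle_continuous: "continuous_on circle run_circle"
  unfolding run_circle_def by (intro continuous_intros continuous_circle_angle)

lemma fold_circle_special [simp]:
  "fold_circle l 1 = 1" "fold_circle 1 (-1) = -1" "fold_circle (-1) (-1) = -1" "fold_circle 0 z = 1"
proof -
  show "fold_circle (-1) (-1) = -1"
    by (simp add: fold_circle_def complex_eq_iff)
qed (simp_all add: fold_circle_def)

lemma run_circle_special [simp]: "run_circle 1 = 1" "run_circle (-1) = -1"
  by (simp_all add: run_circle_def)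

lemma circle_angle_fold:
  assumes "z \<in> circle" shows "circle_angle (fold_circle 1 z) = circle_angle z"
  using circle_angle_bounds[OF assms] by (simp add: fold_circle_def circle_angle_cis)

lemma fold_circle_fold: "z \<in> circle \<Longrightarrow> fold_circle l (fold_circle 1 z) = fold_circle l z"
  unfolding fold_circle_def[of l] by (simp only: circle_angle_fold)

lemma run_circle_fold: "z \<in> circle \<Longrightarrow> run_circle (fold_circle 1 z) = run_circle z"
  unfolding run_circle_def by (simp only: circle_angle_fold)

lemma Im_fold_circle:
  assumes "z \<in> circle" shows "0 \<le> Im (fold_circle 1 z)" "Im (fold_circle (-1) z) \<le> 0"
  using circle_angle_bounds[OF assms] sin_ge_zero[of "circle_angle z"] by (simp_all add: fold_circle_def)

lemma circle_Im_0:
  assumes "z \<in> circle" "Im z = 0" shows "z = 1 \<or> z = -1"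
proof -
  have "(Re z)\<^sup>2 = 1" using assms cmod_power2[of z] by simp
  then have "Re z = 1 \<or> Re z = -1" by (simp add: power2_eq_1_iff)
  then show ?thesis using assms(2) by (auto simp: complex_eq_iff)
qed

lemma circle_const_comp: "s ` circle \<subseteq> circle \<Longrightarrow> circle_comp s (circle_const x) = circle_const x"
  by (auto simp: circle_comp_def circle_const_def fun_eq_iff restrict_def image_subset_iff simp del: mem_sphere_0)

lemma circle_push_const: "circle_push h (circle_const x) = circle_const (h x)"
  by (auto simp: circle_push_def circle_const_def fun_eq_iff restrict_def)

lemma circle_push_comp: "s ` circle \<subseteq> circle \<Longrightarrow> circle_push h (circle_comp s g) = circle_comp s (circle_push h g)"
  by (auto simp: circle_comp_def circle_push_def fun_eq_iff restrict_def image_subset_iff simp del: mem_sphere_0)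

abbreviation ev_mat :: "nat \<Rightarrow> complex \<Rightarrow> (nat \<times> nat \<Rightarrow> complex \<Rightarrow> 'a) \<Rightarrow> nat \<times> nat \<Rightarrow> 'a" where
  "ev_mat n z \<equiv> mat_map n (\<lambda>g. g z)"

abbreviation ev_vec :: "nat \<Rightarrow> complex \<Rightarrow> (nat \<Rightarrow> complex \<Rightarrow> 'a) \<Rightarrow> nat \<Rightarrow> 'a" where
  "ev_vec n z \<equiv> vec_map n (\<lambda>g. g z)"

lemma ev_mat_comp: "z \<in> circle \<Longrightarrow> ev_mat n z (mat_map n (circle_comp s) p) = ev_mat n (s z) p"
  unfolding mat_map_comp by (rule mat_map_pointwise) (rule circle_map_apply)

lemma ev_mat_push: "z \<in> circle \<Longrightarrow> ev_mat n z (mat_map n (circle_push h) p) = mat_map n h (ev_mat n z p)"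
  unfolding mat_map_comp by (rule mat_map_pointwise) (rule circle_map_apply)

lemma ev_vec_const:
  assumes "z \<in> circle" "v \<in> vecs A n" shows "ev_vec n z (vec_map n circle_const v) = v"
proof -
  have "ev_vec n z (vec_map n circle_const v) = vec_map n (\<lambda>a. a) v"
    unfolding vec_map_comp by (rule vec_map_pointwise) (rule circle_map_apply(3)[OF assms(1)])
  then show ?thesis using assms(2) by (simp add: vec_map_def PiE_restrict)
qed

section \<open>Unwinding a loop of unimodular vectors\<close>

text \<open>At each unsigned angle this is the inverse of \<open>g\<close> at the lower point, times
  \<open>g\<close> at the upper point, times \<open>q\<close>. If \<open>g\<close> moves the orbit
  loop to the constant \<open>d\<close>, then \<open>g\<close> after \<open>q\<close> fixes
  \<open>d\<close> at the upper point, and \<open>g\<close> alone fixes \<open>d\<close> at the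
  lower point, where the loop rests; hence the product fixes \<open>d\<close>. At 1 and -1 the two
  points coincide, \<open>g\<close> cancels, and the ends of \<open>q\<close> remain.\<close>

definition unwind :: "('a, 'm) cstar_alg_scheme \<Rightarrow> nat \<Rightarrow> (nat \<times> nat \<Rightarrow> complex \<Rightarrow> 'a) \<Rightarrow>
    (nat \<times> nat \<Rightarrow> complex \<Rightarrow> 'a) \<Rightarrow> nat \<times> nat \<Rightarrow> complex \<Rightarrow> 'a" where
  "unwind A n g q = inv\<^bsub>mat_ring (circle_tensor A) n\<^esub> (mat_map n (circle_comp (fold_circle (-1))) g)
     \<otimes>\<^bsub>mat_ring (circle_tensor A) n\<^esub> mat_map n (circle_comp (fold_circle 1)) g
     \<otimes>\<^bsub>mat_ring (circle_tensor A) n\<^esub> mat_map n (circle_comp run_circle) q"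

context unital_cstar_algebra
begin

lemma fold_hom: "coeff_hom CT CT (circle_comp (fold_circle l))"
  by (intro comp_hom fold_circle_continuous image_subsetI fold_circle_in)

lemma run_hom: "coeff_hom CT CT (circle_comp run_circle)"
  by (intro comp_hom run_circle_continuous image_subsetI run_circle_in)

lemma unwind_GL:
  assumes "g \<in> GL CT n" "q \<in> GL CT n" shows "unwind A n g q \<in> GL CT n"
proof -
  interpret F: coeff_hom CT CT "circle_comp (fold_circle (-1))" by (rule fold_hom)
  interpret G: coeff_hom CT CT "circle_comp (fold_circle 1)" by (rule fold_hom)
  interpret H: coeff_hom CT CT "circle_comp run_circle" by (rule run_hom)
  show ?thesis unfolding unwind_def using assms by simp
qed

lemma ev_unwind:
  assumes gq: "g \<in> GL CT n" "q \<in> GL CT n" and z: "z \<in> circle"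
  shows "ev_mat n z (unwind A n g q) = inv\<^bsub>mat_ring A n\<^esub> (ev_mat n (fold_circle (-1) z) g)
    \<otimes>\<^bsub>mat_ring A n\<^esub> ev_mat n (fold_circle 1 z) g \<otimes>\<^bsub>mat_ring A n\<^esub> ev_mat n (run_circle z) q"
proof -
  interpret E: coeff_hom CT A "\<lambda>g. g z" by (rule ev_hom[OF z])
  interpret F: coeff_hom CT CT "circle_comp (fold_circle (-1))" by (rule fold_hom)
  interpret G: coeff_hom CT CT "circle_comp (fold_circle 1)" by (rule fold_hom)
  interpret H: coeff_hom CT CT "circle_comp run_circle" by (rule run_hom)
  show ?thesis unfolding unwind_def using gq
    by (simp add: E.mat_map_mult E.mat_map_inv ev_mat_comp[OF z])
qed

lemma unwind_ends:
  assumes gq: "g \<in> GL CT n" "q \<in> GL CT n"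
  shows "ev_mat n 1 (unwind A n g q) = ev_mat n 1 q" "ev_mat n (-1) (unwind A n g q) = ev_mat n (-1) q"
proof -
  interpret Mn: ring "mat_ring A n" by (rule ring_mat)
  interpret E: coeff_hom CT A "\<lambda>g. g 1" by (rule ev_hom) simp
  interpret F: coeff_hom CT A "\<lambda>g. g (-1)" by (rule ev_hom) simp
  show "ev_mat n 1 (unwind A n g q) = ev_mat n 1 q" "ev_mat n (-1) (unwind A n g q) = ev_mat n (-1) q"
    using gq by (simp_all add: ev_unwind)
qed

text \<open>All three factors depend on the unsigned angle only. \<open>stabilizer_path_lift\<close>
  takes this as a hypothesis, to contract the path to its starting point.\<close>

lemma unwind_fold:
  assumes gq: "g \<in> GL CT n" "q \<in> GL CT n"
  shows "mat_map n (circle_comp (fold_circle 1)) (unwind A n g q) = unwind A n g q"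
proof (rule mat_CT_eqI)
  interpret G: coeff_hom CT CT "circle_comp (fold_circle 1)" by (rule fold_hom)
  show "unwind A n g q \<in> mats CT n" using unwind_GL[OF gq] by (rule G.A.GL_closed)
  then show "mat_map n (circle_comp (fold_circle 1)) (unwind A n g q) \<in> mats CT n"
    by (rule G.mat_map_closed)
  show "ev_mat n z (mat_map n (circle_comp (fold_circle 1)) (unwind A n g q)) = ev_mat n z (unwind A n g q)"
    if "z \<in> circle" for z
    unfolding ev_mat_comp[OF that] ev_unwind[OF gq that] ev_unwind[OF gq fold_circle_in]
    by (simp only: fold_circle_fold[OF that] run_circle_fold[OF that])
qed

text \<open>The closed upper and lower half circles meet in 1 and -1 only.\<close>

lemma ccont_glue:
  assumes f: "ccont f" and g: "ccont g" and e: "f 1 = g 1" "f (-1) = g (-1)"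
  shows "ccont (\<lambda>z\<in>circle. if 0 \<le> Im z then f z else g z)"
proof -
  have "continuous_map (top_of_set circle) (cstar_topology A) (\<lambda>z. if 0 \<le> Im z then f z else g z)"
  proof (rule continuous_map_cases_le)
    show "continuous_map (subtopology (top_of_set circle) {z \<in> topspace (top_of_set circle). 0 \<le> Im z}) (cstar_topology A) f"
      "continuous_map (subtopology (top_of_set circle) {z \<in> topspace (top_of_set circle). Im z \<le> 0}) (cstar_topology A) g"
      using f g unfolding ccont_iff by (simp_all add: continuous_map_from_subtopology)
    show "f z = g z" if "z \<in> topspace (top_of_set circle)" "0 = Im z" for z
      using circle_Im_0[of z] that e by auto
  qed (auto intro: continuous_intros)
  then have "continuous_map (top_of_set circle) (cstar_topology A) (\<lambda>z\<in>circle. if 0 \<le> Im z then f z else g z)"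
    by (rule continuous_map_eq) simp
  then show ?thesis unfolding ccont_iff by simp
qed

text \<open>A path \<open>q\<close> in \<open>GL\<^sub>n(A)\<close> from \<open>1\<close> into the stabilizer of \<open>d\<close> gives the loop \<open>q d\<close>. It is run
  through on the first quarter of the circle and is constant on the rest, so that a left inverse of
  \<open>q d\<close> can be deformed to a left inverse of \<open>d\<close> on the second quarter.\<close>

definition orbit_loop :: "nat \<Rightarrow> (nat \<times> nat \<Rightarrow> complex \<Rightarrow> 'a) \<Rightarrow> (nat \<Rightarrow> 'a) \<Rightarrow> nat \<Rightarrow> complex \<Rightarrow> 'a" where
  "orbit_loop n q d = (\<lambda>i\<in>{..<n}. \<lambda>z\<in>circle. if 0 \<le> Im z then mat_vec A n (ev_mat n (run_circle z) q) d i else d i)"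

lemma orbit_loop_ev:
  assumes d: "d \<in> vecs A n" and q: "q \<in> GL CT n" and z: "z \<in> circle"
  shows "ev_vec n z (orbit_loop n q d) = (if 0 \<le> Im z then mat_vec A n (ev_mat n (run_circle z) q) d else d)"
proof (rule vec_ext[where A = A and n = n])
  interpret E: coeff_hom CT A "\<lambda>g. g (run_circle z)" by (rule ev_hom[OF run_circle_in])
  show v: "(if 0 \<le> Im z then mat_vec A n (ev_mat n (run_circle z) q) d else d) \<in> vecs A n"
    using d q by simp
  have e: "ev_vec n z (orbit_loop n q d) i = (if 0 \<le> Im z then mat_vec A n (ev_mat n (run_circle z) q) d else d) i"
    if "i < n" for i
    using that z by (simp add: orbit_loop_def del: mem_sphere_0)
  show "\<And>i. i < n \<Longrightarrow> ev_vec n z (orbit_loop n q d) i = (if 0 \<le> Im z then mat_vec A n (ev_mat n (run_circle z) q) d else d) i"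
    by (rule e)
  have "ev_vec n z (orbit_loop n q d) i \<in> carrier A" if "i < n" for i
    unfolding e[OF that] using PiE_mem[OF v, of i] that by (simp only: lessThan_iff)
  then show "ev_vec n z (orbit_loop n q d) \<in> vecs A n"
    by (intro PiE_I) (simp_all add: vec_map_def)
qed

lemma orbit_loop_Lg:
  assumes d: "d \<in> Lg A n" and q: "q \<in> GL CT n"
    and q1: "ev_mat n 1 q = \<one>\<^bsub>mat_ring A n\<^esub>" and qd: "mat_vec A n (ev_mat n (-1) q) d = d"
  shows "orbit_loop n q d \<in> Lg CT n"
proof -
  interpret H: coeff_hom CT CT "circle_comp run_circle" by (rule run_hom)
  interpret K: coeff_hom A CT circle_const by (rule const_hom)
  obtain a where dv: "d \<in> vecs A n" and av: "a \<in> vecs A n" and ad: "lin_comb A n a d = \<one>"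
    using d unfolding Lg_iff by (elim conjE bexE)
  note dc = PiE_mem[OF dv] note ac = PiE_mem[OF av]
  let ?d = "vec_map n circle_const d" and ?a = "vec_map n circle_const a"
  have dv': "?d \<in> vecs CT n" and av': "?a \<in> vecs CT n" using dv av by simp_all
  have ad': "lin_comb CT n ?a ?d = \<one>\<^bsub>CT\<^esub>"
  proof -
    have "lin_comb CT n ?a ?d = lin_comb CT n (\<lambda>k. circle_const (a k)) (\<lambda>k. circle_const (d k))"
      using dc ac by (intro H.A.lin_comb_cong) simp_all
    also have "\<dots> = \<one>\<^bsub>CT\<^esub>" using dc ac by (subst K.h_lin_comb[symmetric]) (simp_all add: ad)
    finally show ?thesis .
  qed
  define Q where "Q = mat_map n (circle_comp run_circle) q"
  have Q: "Q \<in> GL CT n" using q by (simp add: Q_def)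
  define v where "v = mat_vec CT n Q ?d"
  have vv: "v \<in> vecs CT n" using Q dv' by (simp add: v_def)
  define P where "P = inv\<^bsub>mat_ring CT n\<^esub> Q"
  have P: "P \<in> GL CT n" using Q by (simp add: P_def)
  have Pv: "mat_vec CT n P v = ?d" using Q dv' by (simp add: P_def v_def H.A.mat_vec_inv)
  note Pc = mat_carrierD[OF H.A.GL_closed[OF P]]
  note vc = PiE_mem[OF vv] note ac' = PiE_mem[OF av'] note dc' = PiE_mem[OF dv']
  \<comment> \<open>\<open>b\<close> is the row \<open>a P\<close>, a left inverse of
    \<open>v = Q d\<close>. At 1 it equals \<open>a\<close>; at -1 it is \<open>a\<close> times the
    inverse of the end of \<open>q\<close>, possibly another left inverse of \<open>d\<close>, so it
    may fail to match the constant row \<open>a\<close> on the lower half circle.\<close>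
  define b where "b i = lin_comb CT n ?a (\<lambda>k. P (k, i))" for i
  have bc: "b i \<in> carrier CT" if "i < n" for i using that Pc ac' by (simp add: b_def)
  have bv: "lin_comb CT n b v = \<one>\<^bsub>CT\<^esub>"
  proof -
    have "lin_comb CT n b v = lin_comb CT n ?a (\<lambda>k. lin_comb CT n (\<lambda>i. P (k, i)) v)"
      unfolding b_def[abs_def] using Pc ac' vc by (intro H.A.lin_comb_assoc) simp_all
    also have "\<dots> = lin_comb CT n ?a ?d"
    proof (rule H.A.lin_comb_cong)
      fix k assume k: "k < n"
      show "lin_comb CT n (\<lambda>i. P (k, i)) v = ?d k" using fun_cong[OF Pv, of k] k by (simp add: mat_vec_apply)
    qed (use Pc ac' vc in simp_all)
    finally show ?thesis using ad' by simp
  qed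
  \<comment> \<open>\<open>t\<close> vanishes for angles up to \<open>pi / 2\<close> and rises to 1
    at -1. Where it is nonzero, \<open>run_circle\<close> rests at -1 and \<open>v\<close> equals
    \<open>d\<close>, so that \<open>a\<close> and \<open>b\<close> are both left inverses of
    \<open>v\<close> there. Hence the combination \<open>r\<close> of \<open>b\<close> and
    \<open>a\<close> with weights \<open>1 - t\<close> and \<open>t\<close> is a left inverse of
    \<open>v\<close> everywhere, and it ends in \<open>a\<close>.\<close>
  define t where "t z = max 0 (2 * circle_angle z / pi - 1)" for z
  have tcont: "continuous_on circle t" "continuous_on circle (\<lambda>z. 1 - t z)"
    unfolding t_def[abs_def] by (auto intro!: continuous_intros continuous_circle_angle simp del: mem_sphere_0)
  have run: "run_circle z = -1" if "t z \<noteq> 0" for z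
  proof -
    have "2 * circle_angle z / pi > 1" using that unfolding t_def by (auto simp: max_def split: if_splits)
    then have "2 * circle_angle z > pi" by (simp add: field_simps)
    then show ?thesis by (simp add: run_circle_def min_def)
  qed
  define s where "s x = (\<lambda>z\<in>circle. complex_of_real (x z) \<odot> \<one>)" for x
  have sc: "s t \<in> carrier CT" "s (\<lambda>z. 1 - t z) \<in> carrier CT"
    using ccont_scale[OF tcont(1) one_closed] ccont_scale[OF tcont(2) one_closed]
    unfolding s_def CT_simps(1) by simp_all
  have se: "s x z = complex_of_real (x z) \<odot> \<one>" if "z \<in> circle" for x z
    unfolding s_def by (rule restrict_apply'[OF that])
  define r where "r i = s (\<lambda>z. 1 - t z) \<otimes>\<^bsub>CT\<^esub> b i \<oplus>\<^bsub>CT\<^esub> s t \<otimes>\<^bsub>CT\<^esub> ?a i" for i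
  have rc: "r i \<in> carrier CT" if "i < n" for i
    using that sc bc ac' by (simp add: r_def)
  have re: "r i z = (complex_of_real (1 - t z) \<odot> \<one>) \<otimes> b i z \<oplus> (complex_of_real (t z) \<odot> \<one>) \<otimes> a i"
    if "i < n" "z \<in> circle" for i z
    unfolding r_def CT_apply[OF that(2)] se[OF that(2)] using that by (simp add: circle_map_apply del: mem_sphere_0)
  have ct: "g z \<in> carrier A" if "g \<in> carrier CT" "z \<in> circle" for g z
    using that ccontD by (simp only: CT_simps(1) mem_Collect_eq)
  have vz: "v i z = mat_vec A n (ev_mat n (run_circle z) q) d i" if i: "i < n" and z: "z \<in> circle" for i z
  proof -
    interpret E: coeff_hom CT A "\<lambda>g. g z" by (rule ev_hom[OF z])
    have "ev_vec n z v = mat_vec A n (ev_mat n (run_circle z) q) d"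
      unfolding v_def using Q dv' by (simp add: E.vec_map_mat_vec ev_vec_const[OF z dv] Q_def ev_mat_comp[OF z])
    from fun_cong[OF this, of i] show ?thesis using i by simp
  qed
  have q1d: "mat_vec A n (ev_mat n 1 q) d = d" unfolding q1 using dv by (rule mat_vec_one)
  have vd: "v i 1 = d i" "v i (-1) = d i" if "i < n" for i
    using that by (simp_all add: vz q1d qd)
  have b1: "b i 1 = a i" if i: "i < n" for i
  proof -
    interpret E: coeff_hom CT A "\<lambda>g. g 1" by (rule ev_hom) simp
    have e1: "ev_mat n 1 P = \<one>\<^bsub>mat_ring A n\<^esub>"
    proof -
      interpret Mn: ring "mat_ring A n" by (rule ring_mat)
      have "ev_mat n 1 Q = \<one>\<^bsub>mat_ring A n\<^esub>" unfolding Q_def by (simp add: ev_mat_comp q1)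
      then show ?thesis unfolding P_def using Q by (simp add: E.mat_map_inv)
    qed
    have P1: "P (k, i) 1 = (if k = i then \<one> else \<zero>)" if "k < n" for k
      using fun_cong[OF e1, of "(k, i)"] that i by (simp add: mat_entries)
    have "b i 1 = lin_comb A n (\<lambda>k. ?a k 1) (\<lambda>k. P (k, i) 1)"
      unfolding b_def using Pc ac' i by (intro E.h_lin_comb) simp_all
    also have "\<dots> = lin_comb A n a (\<lambda>k. if k = i then \<one> else \<zero>)"
      using ac P1 by (intro lin_comb_cong) (simp_all add: circle_map_apply)
    also have "\<dots> = a i" using ac i by (simp add: lin_comb_delta_right)
    finally show ?thesis .
  qed
  have glue_r: "ccont (\<lambda>z\<in>circle. if 0 \<le> Im z then r i z else circle_const (a i) z)" if i: "i < n" for i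
  proof (rule ccont_glue)
    show "ccont (r i)" using rc[OF i] by (simp only: CT_simps(1) mem_Collect_eq)
    show "ccont (circle_const (a i))" using K.h_simps(1)[of "a i"] ac i by (simp add: CT_simps(1))
    have t1: "t 1 = 0" "t (-1) = 1" by (simp_all add: t_def)
    have c1: "b i 1 \<in> carrier A" "b i (-1) \<in> carrier A" using bc[OF i] by (simp_all add: ct)
    have ai: "a i \<in> carrier A" using ac i by simp
    show "r i 1 = circle_const (a i) 1"
      using re[OF i, of 1] i ai smult_l_null[OF one_closed] by (simp add: t1 b1 circle_map_apply)
    show "r i (-1) = circle_const (a i) (-1)"
      using re[OF i, of "-1"] i ai c1 smult_l_null[OF one_closed] by (simp add: t1 circle_map_apply)
  qed
  have glue_v: "ccont (\<lambda>z\<in>circle. if 0 \<le> Im z then v i z else circle_const (d i) z)" if i: "i < n" for i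
  proof (rule ccont_glue)
    show "ccont (v i)" using vc[of i] i by (simp add: CT_simps(1))
    show "ccont (circle_const (d i))" using K.h_simps(1)[of "d i"] dc i by (simp add: CT_simps(1))
    show "v i 1 = circle_const (d i) 1" "v i (-1) = circle_const (d i) (-1)"
      using vd[OF i] by (simp_all add: circle_map_apply)
  qed
  let ?l = "orbit_loop n q d"
  have lv: "?l i = (\<lambda>z\<in>circle. if 0 \<le> Im z then v i z else circle_const (d i) z)" if "i < n" for i
    unfolding orbit_loop_def using that
    by (auto simp: vz circle_map_apply fun_eq_iff restrict_def simp del: mem_sphere_0)
  have lc: "?l i \<in> carrier CT" if "i < n" for i
    unfolding lv[OF that] CT_simps(1) using glue_v[OF that] by simp
  have lvec: "?l \<in> vecs CT n"
    by (rule PiE_I) (simp add: lc, simp add: orbit_loop_def)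
  define R where "R = (\<lambda>i\<in>{..<n}. \<lambda>z\<in>circle. if 0 \<le> Im z then r i z else circle_const (a i) z)"
  have Rc: "R i \<in> carrier CT" if "i < n" for i
    using glue_r[OF that] that by (simp add: R_def CT_simps(1))
  have Rvec: "R \<in> vecs CT n"
    by (rule PiE_I) (simp add: Rc, simp add: R_def)
  have "lin_comb CT n R ?l = \<one>\<^bsub>CT\<^esub>"
  proof (rule ccont_ext)
    have "lin_comb CT n R ?l \<in> carrier CT" using Rc lc by simp
    then show "ccont (lin_comb CT n R ?l)" by (simp add: CT_simps(1))
    fix z :: complex assume z: "z \<in> circle"
    interpret E: coeff_hom CT A "\<lambda>g. g z" by (rule ev_hom[OF z])
    have 1: "lin_comb CT n R ?l z = lin_comb A n (\<lambda>k. R k z) (\<lambda>k. ?l k z)"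
      using Rc lc by (intro E.h_lin_comb)
    have "lin_comb A n (\<lambda>k. R k z) (\<lambda>k. ?l k z) = \<one>"
    proof (cases "0 \<le> Im z")
      case True
      have bz: "b i z \<in> carrier A" if "i < n" for i using ct[OF bc[OF that] z] .
      have vzc: "v i z \<in> carrier A" if "i < n" for i using vc[of i] that z by (simp add: ct del: mem_sphere_0)
      have aic: "a i \<in> carrier A" if "i < n" for i using ac that by simp
      have bvz: "lin_comb A n (\<lambda>k. b k z) (\<lambda>k. v k z) = \<one>"
        using E.h_lin_comb[of n b v] bc vc arg_cong[OF bv, of "\<lambda>g. g z"] CT_apply(5)[OF z] by simp
      have avz: "(complex_of_real (t z) \<odot> \<one>) \<otimes> lin_comb A n a (\<lambda>k. v k z) = complex_of_real (t z) \<odot> \<one>"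
      proof (cases "t z = 0")
        case True
        then show ?thesis using smult_l_null[OF one_closed] aic vzc by simp
      next
        case False
        have "lin_comb A n a (\<lambda>k. v k z) = lin_comb A n a d"
          using aic vzc vz[OF _ z] by (intro lin_comb_cong) (simp_all add: run[OF False] qd)
        then show ?thesis using ad by simp
      qed
      have "lin_comb A n (\<lambda>k. R k z) (\<lambda>k. ?l k z)
          = lin_comb A n (\<lambda>k. (complex_of_real (1 - t z) \<odot> \<one>) \<otimes> b k z \<oplus> (complex_of_real (t z) \<odot> \<one>) \<otimes> a k) (\<lambda>k. v k z)"
        using True z bz vzc aic
        by (intro lin_comb_cong) (simp_all add: R_def lv re ct[OF Rc z] ct[OF lc z] del: mem_sphere_0)
      also have "\<dots> = (complex_of_real (1 - t z) \<odot> \<one>) \<otimes> lin_comb A n (\<lambda>k. b k z) (\<lambda>k. v k z)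
          \<oplus> (complex_of_real (t z) \<odot> \<one>) \<otimes> lin_comb A n a (\<lambda>k. v k z)"
        using bz vzc aic by (subst lin_comb_add_left) (simp_all add: lin_comb_mult_left)
      also have "\<dots> = complex_of_real (1 - t z) \<odot> \<one> \<oplus> complex_of_real (t z) \<odot> \<one>"
        unfolding bvz avz by simp
      also have "\<dots> = \<one>" using smult_add_left[OF one_closed, of "complex_of_real (1 - t z)" "complex_of_real (t z)"] by simp
      finally show ?thesis .
    next
      case False
      have "lin_comb A n (\<lambda>k. R k z) (\<lambda>k. ?l k z) = lin_comb A n a d"
        using False z ct[OF Rc z] ct[OF lc z]
        by (intro lin_comb_cong) (simp_all add: R_def lv circle_map_apply del: mem_sphere_0)
      then show ?thesis using ad by simp
    qed
    then show "lin_comb CT n R ?l z = \<one>\<^bsub>CT\<^esub> z" unfolding 1 CT_apply(5)[OF z] .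
  qed (rule CT_const_closed(1))
  then show ?thesis unfolding H.A.Lg_iff using lvec Rvec by (intro conjI bexI[of _ R])
qed

text \<open>\<open>H\<close> is \<open>GL\<close> for the general stable rank and \<open>GL0\<close>
  for the connected one. That \<open>g\<close> lies in \<open>H\<close> belongs to the conclusion
  because in the second case \<open>g\<close> itself has to be lifted.\<close>

lemma unwind_fixes:
  assumes d: "d \<in> Lg A n" and q: "q \<in> GL CT n"
    and q1: "ev_mat n 1 q = \<one>\<^bsub>mat_ring A n\<^esub>" and qd: "mat_vec A n (ev_mat n (-1) q) d = d"
    and trans: "transitive_on_Lg CT n H" and H: "H \<subseteq> GL CT n"
  shows "\<exists>g\<in>H. mat_vec CT n (unwind A n g q) (vec_map n circle_const d) = vec_map n circle_const d"
proof -
  interpret K: coeff_hom A CT circle_const by (rule const_hom)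
  have dv: "d \<in> vecs A n" using d by (simp add: Lg_def)
  have dv': "vec_map n circle_const d \<in> vecs CT n" using dv by simp
  have l: "orbit_loop n q d \<in> Lg CT n" by (rule orbit_loop_Lg[OF d q q1 qd])
  then have lv: "orbit_loop n q d \<in> vecs CT n" by (simp add: Lg_def)
  have "vec_map n circle_const d \<in> Lg CT n" using d by simp
  then obtain g where g: "g \<in> H" "mat_vec CT n g (orbit_loop n q d) = vec_map n circle_const d"
    using trans l unfolding transitive_on_Lg_def by blast
  have gG: "g \<in> GL CT n" using g H by blast
  have q1d: "mat_vec A n (ev_mat n 1 q) d = d" unfolding q1 using dv by (rule mat_vec_one)
  have gw: "mat_vec A n (ev_mat n w g) (if 0 \<le> Im w then mat_vec A n (ev_mat n (run_circle w) q) d else d) = d"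
    if w: "w \<in> circle" for w
  proof -
    interpret E: coeff_hom CT A "\<lambda>g. g w" by (rule ev_hom[OF w])
    have "ev_vec n w (mat_vec CT n g (orbit_loop n q d)) = mat_vec A n (ev_mat n w g) (ev_vec n w (orbit_loop n q d))"
      using gG lv by (intro E.vec_map_mat_vec) simp_all
    then show ?thesis unfolding g(2) ev_vec_const[OF w dv] orbit_loop_ev[OF dv q w] by simp
  qed
  have "mat_vec CT n (unwind A n g q) (vec_map n circle_const d) = vec_map n circle_const d"
  proof (rule vec_CT_eqI)
    have u: "unwind A n g q \<in> GL CT n" by (rule unwind_GL[OF gG q])
    show "mat_vec CT n (unwind A n g q) (vec_map n circle_const d) \<in> vecs CT n"
      using u dv' by simp
    fix z :: complex assume z: "z \<in> circle"
    interpret E: coeff_hom CT A "\<lambda>g. g z" by (rule ev_hom[OF z])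
    interpret E1: coeff_hom CT A "\<lambda>g. g (fold_circle 1 z)" by (rule ev_hom[OF fold_circle_in])
    interpret E2: coeff_hom CT A "\<lambda>g. g (fold_circle (-1) z)" by (rule ev_hom[OF fold_circle_in])
    interpret E3: coeff_hom CT A "\<lambda>g. g (run_circle z)" by (rule ev_hom[OF run_circle_in])
    let ?x = "ev_mat n (fold_circle 1 z) g" and ?y = "ev_mat n (fold_circle (-1) z) g" and ?w = "ev_mat n (run_circle z) q"
    have G: "?x \<in> GL A n" "?y \<in> GL A n" "?w \<in> GL A n" using gG q by simp_all
    have 1: "mat_vec A n ?x (mat_vec A n ?w d) = d"
      using gw[OF fold_circle_in[of 1 z]] Im_fold_circle(1)[OF z] by (simp add: run_circle_fold[OF z] del: mem_sphere_0)
    \<comment> \<open>The lower point either has negative imaginary part, where the orbit loop is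
      \<open>d\<close> by definition, or is 1 or -1, where it is \<open>d\<close> because the ends
      of \<open>q\<close> fix \<open>d\<close>.\<close>
    have 2: "mat_vec A n ?y d = d"
    proof (cases "0 \<le> Im (fold_circle (-1) z)")
      case True
      then have "Im (fold_circle (-1) z) = 0" using Im_fold_circle(2)[OF z] by simp
      then have "fold_circle (-1) z = 1 \<or> fold_circle (-1) z = -1" by (rule circle_Im_0[OF fold_circle_in])
      then have "mat_vec A n (ev_mat n (run_circle (fold_circle (-1) z)) q) d = d"
        by (elim disjE) (simp_all only: run_circle_special q1d qd)
      then have "(if 0 \<le> Im (fold_circle (-1) z) then mat_vec A n (ev_mat n (run_circle (fold_circle (-1) z)) q) d else d) = d"
        by (simp only: if_cancel)
      then show ?thesis using gw[OF fold_circle_in[of "-1" z]] by (simp only:)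
    next
      case False
      then show ?thesis using gw[OF fold_circle_in[of "-1" z]] by simp
    qed
    have "ev_vec n z (mat_vec CT n (unwind A n g q) (vec_map n circle_const d))
        = mat_vec A n (inv\<^bsub>mat_ring A n\<^esub> ?y \<otimes>\<^bsub>mat_ring A n\<^esub> ?x \<otimes>\<^bsub>mat_ring A n\<^esub> ?w) d"
      using u dv' by (simp add: E.vec_map_mat_vec ev_vec_const[OF z dv] ev_unwind[OF gG q z])
    also have "\<dots> = mat_vec A n (inv\<^bsub>mat_ring A n\<^esub> ?y) (mat_vec A n ?x (mat_vec A n ?w d))"
      using G dv by (simp add: mat_vec_mult)
    also have "\<dots> = d" unfolding 1 using mat_vec_inv[OF G(2) dv 2] .
    also have "\<dots> = ev_vec n z (vec_map n circle_const d)" by (rule ev_vec_const[OF z dv, symmetric])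
    finally show "ev_vec n z (mat_vec CT n (unwind A n g q) (vec_map n circle_const d)) = ev_vec n z (vec_map n circle_const d)" .
  qed (rule dv')
  then show ?thesis using g(1) by blast
qed

end

section \<open>Lifting along a surjection\<close>

context unital_cstar_algebra
begin

lemma mat_CT_uniformly:
  assumes s: "s \<in> mats CT n" and e: "e > 0"
  shows "\<exists>d>0. \<forall>z\<in>circle. \<forall>w\<in>circle. dist z w < d \<longrightarrow>
    (\<forall>i<n. \<forall>j<n. nrm A (s (i, j) z \<ominus> s (i, j) w) < e)"
proof -
  have "\<exists>d>0. \<forall>z\<in>circle. \<forall>w\<in>circle. dist z w < d \<longrightarrow> nrm A (s p z \<ominus> s p w) < e"
    if "p \<in> {..<n} \<times> {..<n}" for p
    using that s e by (intro ccont_uniformly) (auto simp: mat_carrier CT_simps(1) Pi_iff PiE_iff)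
  then obtain d where d: "\<And>p. p \<in> {..<n} \<times> {..<n} \<Longrightarrow> d p > 0"
    "\<And>p z w. \<lbrakk>p \<in> {..<n} \<times> {..<n}; z \<in> circle; w \<in> circle; dist z w < d p\<rbrakk> \<Longrightarrow> nrm A (s p z \<ominus> s p w) < e"
    by metis
  \<comment> \<open>The inserted 1 keeps the set nonempty for \<open>n = 0\<close>.\<close>
  define D where "D = Min (insert 1 (d ` ({..<n} \<times> {..<n})))"
  have "D > 0" unfolding D_def using d(1) by (subst Min_gr_iff) auto
  moreover have Dle: "D \<le> d p" if "p \<in> {..<n} \<times> {..<n}" for p
    unfolding D_def using that by (intro Min_le) auto
  moreover have "nrm A (s (i, j) z \<ominus> s (i, j) w) < e"
    if "z \<in> circle" "w \<in> circle" "dist z w < D" "i < n" "j < n" for z w i j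
    using d(2)[of "(i, j)" z w] Dle[of "(i, j)"] that by (simp del: mem_sphere_0)
  ultimately show ?thesis by blast
qed

end

text \<open>Angles are at most \<open>pi\<close>, so two scaled angles differ by at most
  \<open>pi\<close> times the difference of the parameters, whatever \<open>z\<close> is;
  \<open>cis\<close> is uniformly continuous on the compact interval that contains them.\<close>

lemma fold_circle_uniformly:
  assumes "d > 0"
  shows "\<exists>e>0. \<forall>z\<in>circle. \<forall>l\<in>{0..1}. \<forall>m\<in>{0..1}. \<bar>l - m\<bar> < e \<longrightarrow> dist (fold_circle l z) (fold_circle m z) < d"
proof -
  have "uniformly_continuous_on {0..pi} cis"
    by (intro compact_uniformly_continuous continuous_intros) simp
  then obtain r where r: "r > 0" "\<And>a b. \<lbrakk>a \<in> {0..pi}; b \<in> {0..pi}; dist a b < r\<rbrakk> \<Longrightarrow> dist (cis a) (cis b) < d"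
    unfolding uniformly_continuous_on_def using assms by metis
  have "dist (fold_circle l z) (fold_circle m z) < d"
    if z: "z \<in> circle" and lm: "l \<in> {0..1}" "m \<in> {0..1}" "\<bar>l - m\<bar> < r / pi" for z l m
  proof -
    note a = circle_angle_bounds[OF z]
    have "l * circle_angle z \<in> {0..pi}" "m * circle_angle z \<in> {0..pi}"
      using lm a mult_left_le_one_le[of "circle_angle z" l] mult_left_le_one_le[of "circle_angle z" m] by auto
    moreover have "dist (l * circle_angle z) (m * circle_angle z) = \<bar>l - m\<bar> * circle_angle z"
      using a by (simp add: dist_real_def abs_mult flip: left_diff_distrib)
    moreover have "\<bar>l - m\<bar> * circle_angle z \<le> \<bar>l - m\<bar> * pi" using a by (intro mult_left_mono) simp_all
    moreover have "\<bar>l - m\<bar> * pi < r" using lm(3) by (simp add: field_simps)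
    ultimately show ?thesis unfolding fold_circle_def by (intro r(2)) simp_all
  qed
  then show ?thesis using r(1) by (intro exI[of _ "r / pi"]) auto
qed

context cstar_morphism
begin

text \<open>A path \<open>s\<close> from \<open>1\<close> in a stabilizer is the product of the quotients of neighbouring members of
  the family \<open>z \<mapsto> s (l \<theta>(z))\<close>, \<open>0 \<le> l \<le> 1\<close>, and each of these is close to \<open>1\<close>.\<close>

lemma stabilizer_path_lift:
  assumes surj: "h ` carrier A = carrier B" and c: "c \<in> Lg A n"
    and s: "s \<in> GL (circle_tensor B) n" and s1: "ev_mat n 1 s = \<one>\<^bsub>mat_ring B n\<^esub>"
    and fold: "mat_map n (circle_comp (fold_circle 1)) s = s"
    and sd: "mat_vec (circle_tensor B) n s (vec_map n circle_const (vec_map n h c)) = vec_map n circle_const (vec_map n h c)"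
  shows "\<exists>t\<in>GL (circle_tensor A) n. mat_map n (circle_push h) t = s \<and>
    mat_vec (circle_tensor A) n t (vec_map n circle_const c) = vec_map n circle_const c"
proof -
  let ?X = "circle_tensor A" and ?Y = "circle_tensor B"
  interpret T: cstar_morphism ?X ?Y "circle_push h" by (rule push_morphism)
  interpret K: coeff_hom A ?X circle_const by (rule A.const_hom)
  interpret KB: coeff_hom B ?Y circle_const by (rule B.const_hom)
  interpret Mn: complete_normed_ring "mat_ring ?Y n" "mat_nrm ?Y n" by (rule T.B.mat_complete_normed_ring)
  define c' where "c' = vec_map n circle_const c"
  define d' where "d' = vec_map n circle_const (vec_map n h c)"
  have "c' \<in> Lg ?X n" using c by (simp add: c'_def)
  then obtain a where c'v: "c' \<in> vecs ?X n" and av: "a \<in> vecs ?X n" and ac: "lin_comb ?X n a c' = \<one>\<^bsub>?X\<^esub>"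
    unfolding T.A.Lg_iff by (elim conjE bexE)
  have hc: "vec_map n (circle_push h) c' = d'"
    unfolding c'_def d'_def vec_map_comp by (rule vec_map_pointwise) (rule circle_push_const)
  have d'v: "d' \<in> vecs ?Y n" using T.vec_map_closed[OF c'v] by (simp add: hc)
  have "\<exists>e>0. \<forall>x\<in>mats ?Y n.
    mat_nrm ?Y n (x \<ominus>\<^bsub>mat_ring ?Y n\<^esub> \<one>\<^bsub>mat_ring ?Y n\<^esub>) < e \<longrightarrow> mat_vec ?Y n x (vec_map n (circle_push h) c') = vec_map n (circle_push h) c' \<longrightarrow>
    (\<exists>y\<in>GL ?X n. mat_map n (circle_push h) y = x \<and> mat_vec ?X n y c' = c')"
    by (rule T.near_one_lift[OF push_surj[OF surj] c'v av]) (use PiE_mem[OF c'v] in \<open>simp add: ac\<close>)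
  then obtain e where e: "e > 0" and lift: "\<And>x. \<lbrakk>x \<in> mats ?Y n;
      mat_nrm ?Y n (x \<ominus>\<^bsub>mat_ring ?Y n\<^esub> \<one>\<^bsub>mat_ring ?Y n\<^esub>) < e; mat_vec ?Y n x d' = d'\<rbrakk>
    \<Longrightarrow> \<exists>y\<in>GL ?X n. mat_map n (circle_push h) y = x \<and> mat_vec ?X n y c' = c'"
    unfolding hc by blast
  \<comment> \<open>The path \<open>s\<close> stopped at the fraction \<open>l\<close> of each
    angle: \<open>f 0\<close> is constant, \<open>f 1\<close> is \<open>s\<close>, and every
    \<open>f l\<close> stays in the stabilizer.\<close>
  define f where "f l = mat_map n (circle_comp (fold_circle l)) s" for l
  have fG: "f l \<in> GL ?Y n" for l
  proof -
    interpret F: coeff_hom ?Y ?Y "circle_comp (fold_circle l)" by (rule B.fold_hom)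
    show ?thesis using s by (simp add: f_def)
  qed
  have fd: "mat_vec ?Y n (f l) d' = d'" for l
  proof -
    interpret F: coeff_hom ?Y ?Y "circle_comp (fold_circle l)" by (rule B.fold_hom)
    have cd: "vec_map n (circle_comp (fold_circle l)) d' = d'"
      unfolding d'_def vec_map_comp[of n "circle_comp (fold_circle l)"]
      by (rule vec_map_pointwise) (rule circle_const_comp, intro image_subsetI fold_circle_in)
    have "vec_map n (circle_comp (fold_circle l)) (mat_vec ?Y n s d')
        = mat_vec ?Y n (f l) (vec_map n (circle_comp (fold_circle l)) d')"
      unfolding f_def using s d'v by (intro F.vec_map_mat_vec) simp_all
    then show ?thesis using sd unfolding d'_def[symmetric] by (simp add: cd)
  qed
  have f0: "f 0 = \<one>\<^bsub>mat_ring ?Y n\<^esub>"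
  proof (rule B.mat_CT_eqI)
    show "ev_mat n z (f 0) = ev_mat n z \<one>\<^bsub>mat_ring ?Y n\<^esub>" if z: "z \<in> circle" for z
    proof -
      interpret E: coeff_hom ?Y B "\<lambda>g. g z" by (rule B.ev_hom[OF z])
      show ?thesis unfolding f_def ev_mat_comp[OF z] E.mat_map_one by (simp add: s1)
    qed
  qed (use fG in simp_all)
  have f1: "f 1 = s" unfolding f_def by (rule fold)
  define m where "m = mat_nrm ?Y n (inv\<^bsub>mat_ring ?Y n\<^esub> s)"
  have m: "0 \<le> m" unfolding m_def using s by (intro Mn.N_nonneg) simp
  \<comment> \<open>Reparametrizing the inverse of \<open>s\<close> produces no new values, so the
    inverses of all \<open>f l\<close> share one bound.\<close>
  have finv: "mat_nrm ?Y n (inv\<^bsub>mat_ring ?Y n\<^esub> (f l)) \<le> real n * real n * m" for l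
  proof (rule T.B.mat_nrm_bound)
    fix i j assume ij: "i < n" "j < n"
    interpret F: coeff_hom ?Y ?Y "circle_comp (fold_circle l)" by (rule B.fold_hom)
    have i: "inv\<^bsub>mat_ring ?Y n\<^esub> s \<in> mats ?Y n" using s by simp
    have "B.ccont ((inv\<^bsub>mat_ring ?Y n\<^esub> s) (i, j))" using mat_carrierD[OF i ij] by (simp add: B.CT_simps(1))
    note le = B.nrm_CT_le[OF this]
    have "nrm ?Y ((inv\<^bsub>mat_ring ?Y n\<^esub> (f l)) (i, j)) \<le> nrm ?Y ((inv\<^bsub>mat_ring ?Y n\<^esub> s) (i, j))"
    proof (rule B.nrm_CT_leI)
      fix z :: complex assume z: "z \<in> circle"
      have "(inv\<^bsub>mat_ring ?Y n\<^esub> (f l)) (i, j) z = (inv\<^bsub>mat_ring ?Y n\<^esub> s) (i, j) (fold_circle l z)"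
        using ij z s by (simp add: f_def circle_map_apply flip: F.mat_map_inv del: mem_sphere_0)
      then show "nrm B ((inv\<^bsub>mat_ring ?Y n\<^esub> (f l)) (i, j) z) \<le> nrm ?Y ((inv\<^bsub>mat_ring ?Y n\<^esub> s) (i, j))"
        using le[OF fold_circle_in] by simp
    qed
    also have "\<dots> \<le> m" unfolding m_def by (rule T.B.nrm_entry_le[OF i ij])
    finally show "nrm ?Y ((inv\<^bsub>mat_ring ?Y n\<^esub> (f l)) (i, j)) \<le> m" .
  qed
  \<comment> \<open>The quotient of \<open>f l\<close> and \<open>f k\<close> differs from \<one> by
    the inverse of \<open>f l\<close> times \<open>f k - f l\<close>. The first factor has norm at
    most \<open>real n * real n * m\<close>, the second at most
    \<open>real n * real n * r\<close>.\<close>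
  define L where "L = real n * real n * m * (real n * real n)"
  have L: "0 \<le> L" using m by (simp add: L_def)
  define r where "r = e / (L + 1)"
  have r: "r > 0" "L * r < e" using e L by (simp_all add: r_def field_simps)
  obtain d where d: "d > 0" "\<And>z w i j. \<lbrakk>z \<in> circle; w \<in> circle; dist z w < d; i < n; j < n\<rbrakk>
      \<Longrightarrow> nrm B (s (i, j) z \<ominus>\<^bsub>B\<^esub> s (i, j) w) < r"
    using B.mat_CT_uniformly[OF T.B.GL_closed[OF s] r(1)] by blast
  obtain b where b: "b > 0" "\<And>z l m. \<lbrakk>z \<in> circle; l \<in> {0..1}; m \<in> {0..1}; \<bar>l - m\<bar> < b\<rbrakk>
      \<Longrightarrow> dist (fold_circle l z) (fold_circle m z) < d"
    using fold_circle_uniformly[OF d(1)] by blast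
  have step: "\<exists>y\<in>GL ?X n. mat_map n (circle_push h) y = inv\<^bsub>mat_ring ?Y n\<^esub> (f l) \<otimes>\<^bsub>mat_ring ?Y n\<^esub> f k \<and> mat_vec ?X n y c' = c'"
    if lk: "l \<in> {0..1}" "k \<in> {0..1}" "\<bar>k - l\<bar> < b" for l k
  proof (rule lift)
    note fc = T.B.GL_closed[OF fG]
    note ic = T.B.GL_closed[OF T.B.GL_inv[OF fG]]
    show "inv\<^bsub>mat_ring ?Y n\<^esub> (f l) \<otimes>\<^bsub>mat_ring ?Y n\<^esub> f k \<in> mats ?Y n" using fc ic by simp
    show "mat_vec ?Y n (inv\<^bsub>mat_ring ?Y n\<^esub> (f l) \<otimes>\<^bsub>mat_ring ?Y n\<^esub> f k) d' = d'"
      using fc ic d'v fd T.B.mat_vec_inv[OF fG d'v fd] by (intro T.B.mat_vec_fix_mult) simp_all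
    have "mat_nrm ?Y n (f k \<ominus>\<^bsub>mat_ring ?Y n\<^esub> f l) \<le> real n * real n * r"
    proof (rule T.B.mat_nrm_bound)
      fix i j assume ij: "i < n" "j < n"
      have cc: "B.ccont (f k (i, j))" "B.ccont (f l (i, j))"
        using mat_carrierD[OF fc ij] by (simp_all add: B.CT_simps(1))
      have "nrm ?Y (f k (i, j) \<ominus>\<^bsub>?Y\<^esub> f l (i, j)) \<le> r"
      proof (rule B.nrm_CT_leI)
        fix z :: complex assume z: "z \<in> circle"
        have "f k (i, j) z = s (i, j) (fold_circle k z)" "f l (i, j) z = s (i, j) (fold_circle l z)"
          using ij z by (simp_all add: f_def circle_map_apply del: mem_sphere_0)
        then show "nrm B ((f k (i, j) \<ominus>\<^bsub>?Y\<^esub> f l (i, j)) z) \<le> r"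
          unfolding B.CT_minus[OF cc z] using d(2)[OF fold_circle_in fold_circle_in b(2)[OF z lk(2,1,3)] ij] by simp
      qed
      then show "nrm ?Y ((f k \<ominus>\<^bsub>mat_ring ?Y n\<^esub> f l) (i, j)) \<le> r"
        by (simp add: T.B.mat_minus[OF fc fc ij])
    qed
    then have "mat_nrm ?Y n (inv\<^bsub>mat_ring ?Y n\<^esub> (f l)) * mat_nrm ?Y n (f k \<ominus>\<^bsub>mat_ring ?Y n\<^esub> f l) \<le> real n * real n * m * (real n * real n * r)"
      using finv m fc by (intro mult_mono) (simp_all add: Mn.N_nonneg)
    also have "\<dots> < e" using r(2) by (simp add: L_def mult.assoc)
    finally have 1: "mat_nrm ?Y n (inv\<^bsub>mat_ring ?Y n\<^esub> (f l)) * mat_nrm ?Y n (f k \<ominus>\<^bsub>mat_ring ?Y n\<^esub> f l) < e" .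
    have "inv\<^bsub>mat_ring ?Y n\<^esub> (f l) \<otimes>\<^bsub>mat_ring ?Y n\<^esub> f k \<ominus>\<^bsub>mat_ring ?Y n\<^esub> \<one>\<^bsub>mat_ring ?Y n\<^esub>
        = inv\<^bsub>mat_ring ?Y n\<^esub> (f l) \<otimes>\<^bsub>mat_ring ?Y n\<^esub> (f k \<ominus>\<^bsub>mat_ring ?Y n\<^esub> f l)"
      using fc ic fG by (simp add: Mn.mult_minus_distrib)
    then show "mat_nrm ?Y n (inv\<^bsub>mat_ring ?Y n\<^esub> (f l) \<otimes>\<^bsub>mat_ring ?Y n\<^esub> f k \<ominus>\<^bsub>mat_ring ?Y n\<^esub> \<one>\<^bsub>mat_ring ?Y n\<^esub>) < e"
      using Mn.N_mult[OF ic Mn.minus_closed[OF fc fc], of l k l] 1 by simp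
  qed
  obtain N :: nat where N: "N > 0" "1 / real N < b"
    using reals_Archimedean[OF b(1)] by (metis inverse_eq_divide zero_less_Suc)
  \<comment> \<open>The quotients between neighbouring multiples of \<open>1 / N\<close> telescope,
    so the product of their lifts is a lift of \<open>f 1\<close>.\<close>
  have "\<exists>y\<in>GL ?X n. mat_map n (circle_push h) y = f (real k / real N) \<and> mat_vec ?X n y c' = c'" if "k \<le> N" for k
    using that
  proof (induction k)
    case 0
    show ?case
      by (rule bexI[of _ "\<one>\<^bsub>mat_ring ?X n\<^esub>"]) (simp_all add: f0 T.mat_map_one T.A.mat_vec_one[OF c'v])
  next
    case (Suc k)
    then obtain y where y: "y \<in> GL ?X n" "mat_map n (circle_push h) y = f (real k / real N)" "mat_vec ?X n y c' = c'"
      by auto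
    have diff: "real (Suc k) / real N - real k / real N = 1 / real N" by (simp add: diff_divide_distrib[symmetric])
    have "\<exists>w\<in>GL ?X n. mat_map n (circle_push h) w = inv\<^bsub>mat_ring ?Y n\<^esub> (f (real k / real N)) \<otimes>\<^bsub>mat_ring ?Y n\<^esub> f (real (Suc k) / real N) \<and> mat_vec ?X n w c' = c'"
    proof (rule step)
      show "real k / real N \<in> {0..1}" "real (Suc k) / real N \<in> {0..1}" using Suc.prems N(1) by simp_all
      show "\<bar>real (Suc k) / real N - real k / real N\<bar> < b" unfolding diff using N by simp
    qed
    then obtain w where w: "w \<in> GL ?X n" "mat_vec ?X n w c' = c'"
      "mat_map n (circle_push h) w = inv\<^bsub>mat_ring ?Y n\<^esub> (f (real k / real N)) \<otimes>\<^bsub>mat_ring ?Y n\<^esub> f (real (Suc k) / real N)"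
      by blast
    show ?case
    proof (intro bexI[of _ "y \<otimes>\<^bsub>mat_ring ?X n\<^esub> w"] conjI)
      show "mat_map n (circle_push h) (y \<otimes>\<^bsub>mat_ring ?X n\<^esub> w) = f (real (Suc k) / real N)"
        using y(1) w(1) T.B.GL_cancel(2)[OF fG T.B.GL_closed[OF fG]]
        by (subst T.mat_map_mult) (simp_all only: T.A.GL_closed y(2) w(3))
      show "mat_vec ?X n (y \<otimes>\<^bsub>mat_ring ?X n\<^esub> w) c' = c'"
        using y w c'v by (intro T.A.mat_vec_fix_mult) simp_all
    qed (use y w in simp)
  qed
  from this[of N] show ?thesis using N(1) by (simp add: f1 c'_def)
qed

text \<open>The quotient of \<open>h k\<close> by \<open>u\<close> fixes the image of
  \<open>c'\<close> and is the end of a path. After unwinding, the path lies in the stabilizer and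
  lifts to a path \<open>t\<close> that fixes \<open>c'\<close>. Dividing \<open>k\<close> by the
  end of \<open>t\<close> still sends \<open>c\<close> to \<open>c'\<close> and changes the image to
  \<open>u\<close>.\<close>

lemma lift_gsr:
  assumes surj: "h ` carrier A = carrier B" and trans: "transitive_on_Lg (circle_tensor B) n (GL (circle_tensor B) n)"
    and u: "u \<in> GL B n" and k: "k \<in> GL A n"
    and c: "c \<in> Lg A n" and c': "c' \<in> Lg A n" and kc: "mat_vec A n k c = c'"
    and uc: "mat_vec B n u (vec_map n h c) = vec_map n h c'"
    and q: "B.loop n q (mat_map n h k \<otimes>\<^bsub>mat_ring B n\<^esub> inv\<^bsub>mat_ring B n\<^esub> u)"
  shows "\<exists>k'\<in>GL A n. mat_vec A n k' c = c' \<and> mat_map n h k' = u"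
proof -
  let ?X = "circle_tensor A" and ?Y = "circle_tensor B"
  interpret T: cstar_morphism ?X ?Y "circle_push h" by (rule push_morphism)
  interpret MA: ring "mat_ring A n" by (rule A.ring_mat)
  interpret MB: ring "mat_ring B n" by (rule B.ring_mat)
  interpret E: coeff_hom ?X A "\<lambda>g. g (-1)" by (rule A.ev_hom) simp
  have cv: "c \<in> vecs A n" and c'v: "c' \<in> vecs A n" using c c' by (simp_all add: Lg_def)
  have qG: "q \<in> GL ?Y n" and q1: "ev_mat n 1 q = \<one>\<^bsub>mat_ring B n\<^esub>"
    and qe: "ev_mat n (-1) q = mat_map n h k \<otimes>\<^bsub>mat_ring B n\<^esub> inv\<^bsub>mat_ring B n\<^esub> u"
    using q by (simp_all add: B.loop_def)
  have hk: "mat_map n h k \<in> GL B n" using k by simp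
  have "mat_vec B n (inv\<^bsub>mat_ring B n\<^esub> u) (vec_map n h c') = vec_map n h c"
    using u cv uc by (intro B.mat_vec_inv) simp_all
  then have qd: "mat_vec B n (ev_mat n (-1) q) (vec_map n h c') = vec_map n h c'"
    unfolding qe using hk u cv c'v k by (simp add: B.mat_vec_mult vec_map_mat_vec[symmetric] kc)
  obtain g where g: "g \<in> GL ?Y n"
    "mat_vec ?Y n (unwind B n g q) (vec_map n circle_const (vec_map n h c')) = vec_map n circle_const (vec_map n h c')"
    using B.unwind_fixes[OF vec_map_Lg[OF c'] qG q1 qd trans] by blast
  define s where "s = unwind B n g q"
  have s: "s \<in> GL ?Y n" unfolding s_def by (rule B.unwind_GL[OF g(1) qG])
  obtain t where t: "t \<in> GL ?X n" "mat_map n (circle_push h) t = s"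
    "mat_vec ?X n t (vec_map n circle_const c') = vec_map n circle_const c'"
    using stabilizer_path_lift[OF surj c' s] g B.unwind_ends(1)[OF g(1) qG] q1 B.unwind_fold[OF g(1) qG]
    unfolding s_def by auto
  let ?t = "ev_mat n (-1) t"
  have tG: "?t \<in> GL A n" using t(1) by simp
  have tc: "mat_vec A n ?t c' = c'"
  proof -
    interpret K: coeff_hom A ?X circle_const by (rule A.const_hom)
    have "ev_vec n (-1) (mat_vec ?X n t (vec_map n circle_const c')) = mat_vec A n ?t (ev_vec n (-1) (vec_map n circle_const c'))"
      using t(1) c'v by (intro E.vec_map_mat_vec) simp_all
    then show ?thesis unfolding t(3) by (simp add: ev_vec_const[OF _ c'v])
  qed
  have ht: "mat_map n h ?t = mat_map n h k \<otimes>\<^bsub>mat_ring B n\<^esub> inv\<^bsub>mat_ring B n\<^esub> u"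
    using ev_mat_push[of "-1" n h t] B.unwind_ends(2)[OF g(1) qG] by (simp add: t(2) s_def qe)
  define k' where "k' = inv\<^bsub>mat_ring A n\<^esub> ?t \<otimes>\<^bsub>mat_ring A n\<^esub> k"
  have "k' \<in> GL A n" using tG k by (simp add: k'_def)
  moreover have "mat_vec A n k' c = c'"
    unfolding k'_def using tG k cv A.mat_vec_inv[OF tG c'v tc] by (simp add: A.mat_vec_mult kc)
  moreover have "mat_map n h k' = u"
  proof -
    let ?q = "mat_map n h k \<otimes>\<^bsub>mat_ring B n\<^esub> inv\<^bsub>mat_ring B n\<^esub> u"
    have qq: "?q \<in> GL B n" using hk u by simp
    have "mat_map n h k' = inv\<^bsub>mat_ring B n\<^esub> ?q \<otimes>\<^bsub>mat_ring B n\<^esub> mat_map n h k"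
      unfolding k'_def using tG k by (simp add: mat_map_mult mat_map_inv ht)
    also have "\<dots> = inv\<^bsub>mat_ring B n\<^esub> ?q \<otimes>\<^bsub>mat_ring B n\<^esub> (?q \<otimes>\<^bsub>mat_ring B n\<^esub> u)"
      using hk u by (simp only: B.GL_cancel(4) B.GL_closed)
    also have "\<dots> = u" using qq u by (simp only: B.GL_cancel(1) B.GL_closed)
    finally show ?thesis .
  qed
  ultimately show ?thesis by blast
qed

text \<open>Unlike in \<open>lift_gsr\<close>, a whole path over \<open>A\<close> has to lie above a
  path over \<open>B\<close>, so the deformation must be repeated over \<open>A\<close>. This works
  because \<open>g\<close> lies in \<open>GL0\<close> and lifts to \<open>G\<close>, along which
  \<open>k\<close> is unwound. The path below is \<open>u\<close> after \<open>run_circle\<close>,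
  since \<open>unwind\<close> reparametrizes its last factor in this way.\<close>

lemma lift_csr:
  assumes surj: "h ` carrier A = carrier B" and trans: "transitive_on_Lg (circle_tensor B) n (GL0 (circle_tensor B) n)"
    and u: "B.loop n u u1" and k: "A.loop n k k1"
    and c: "c \<in> Lg A n" and c': "c' \<in> Lg A n" and kc: "mat_vec A n k1 c = c'"
    and uc: "mat_vec B n u1 (vec_map n h c) = vec_map n h c'"
  shows "\<exists>k' k2. A.loop n k' k2 \<and> mat_vec A n k2 c = c' \<and>
    mat_map n (circle_push h) k' = mat_map n (circle_comp run_circle) u"
proof -
  let ?X = "circle_tensor A" and ?Y = "circle_tensor B"
  interpret T: cstar_morphism ?X ?Y "circle_push h" by (rule push_morphism)
  interpret MA: ring "mat_ring A n" by (rule A.ring_mat)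
  interpret MB: ring "mat_ring B n" by (rule B.ring_mat)
  interpret E: coeff_hom ?X A "\<lambda>g. g (-1)" by (rule A.ev_hom) simp
  interpret F: coeff_hom ?X A "\<lambda>g. g 1" by (rule A.ev_hom) simp
  interpret EB: coeff_hom ?Y B "\<lambda>g. g (-1)" by (rule B.ev_hom) simp
  interpret FB: coeff_hom ?Y B "\<lambda>g. g 1" by (rule B.ev_hom) simp
  interpret K: coeff_hom A ?X circle_const by (rule A.const_hom)
  interpret RB: coeff_hom ?Y ?Y "circle_comp run_circle" by (rule B.run_hom)
  interpret RA: coeff_hom ?X ?X "circle_comp run_circle" by (rule A.run_hom)
  interpret MX: ring "mat_ring ?X n" by (rule T.A.ring_mat)
  interpret MY: ring "mat_ring ?Y n" by (rule T.B.ring_mat)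
  have cv: "c \<in> vecs A n" and c'v: "c' \<in> vecs A n" using c c' by (simp_all add: Lg_def)
  have uG: "u \<in> GL ?Y n" and u_ends: "ev_mat n 1 u = \<one>\<^bsub>mat_ring B n\<^esub>" "ev_mat n (-1) u = u1"
    using u by (simp_all add: B.loop_def)
  have kG: "k \<in> GL ?X n" and k_ends: "ev_mat n 1 k = \<one>\<^bsub>mat_ring A n\<^esub>" "ev_mat n (-1) k = k1"
    using k by (simp_all add: A.loop_def)
  have u1: "u1 \<in> GL B n" and k1: "k1 \<in> GL A n" using B.loop_GL[OF u] A.loop_GL[OF k] by simp_all
  define pk where "pk = mat_map n (circle_push h) k"
  have pk: "pk \<in> GL ?Y n" using kG by (simp add: pk_def)
  have pk_ends: "ev_mat n 1 pk = \<one>\<^bsub>mat_ring B n\<^esub>" "ev_mat n (-1) pk = mat_map n h k1"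
    unfolding pk_def by (simp_all add: ev_mat_push k_ends mat_map_one)
  define q where "q = pk \<otimes>\<^bsub>mat_ring ?Y n\<^esub> inv\<^bsub>mat_ring ?Y n\<^esub> u"
  have qG: "q \<in> GL ?Y n" using pk uG by (simp add: q_def)
  have q1: "ev_mat n 1 q = \<one>\<^bsub>mat_ring B n\<^esub>"
    unfolding q_def using pk uG by (simp add: FB.mat_map_mult FB.mat_map_inv pk_ends u_ends)
  have qe: "ev_mat n (-1) q = mat_map n h k1 \<otimes>\<^bsub>mat_ring B n\<^esub> inv\<^bsub>mat_ring B n\<^esub> u1"
    unfolding q_def using pk uG by (simp add: EB.mat_map_mult EB.mat_map_inv pk_ends u_ends)
  have "mat_vec B n (inv\<^bsub>mat_ring B n\<^esub> u1) (vec_map n h c') = vec_map n h c"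
    using u1 cv uc by (intro B.mat_vec_inv) simp_all
  then have qd: "mat_vec B n (ev_mat n (-1) q) (vec_map n h c') = vec_map n h c'"
    unfolding qe using k1 u1 cv c'v by (simp add: B.mat_vec_mult vec_map_mat_vec[symmetric] kc)
  obtain g where g0: "g \<in> GL0 ?Y n" and
    gd: "mat_vec ?Y n (unwind B n g q) (vec_map n circle_const (vec_map n h c')) = vec_map n circle_const (vec_map n h c')"
    using B.unwind_fixes[OF vec_map_Lg[OF c'] qG q1 qd trans] T.B.GL0_subset_GL by blast
  have g: "g \<in> GL ?Y n" using g0 T.B.GL0_subset_GL by blast
  obtain G where G: "G \<in> GL ?X n" "mat_map n (circle_push h) G = g"
    using T.GL0_lift[OF push_surj[OF surj] g0] by blast
  define s where "s = unwind B n g q"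
  have s: "s \<in> GL ?Y n" unfolding s_def by (rule B.unwind_GL[OF g qG])
  have s1: "ev_mat n 1 s = \<one>\<^bsub>mat_ring B n\<^esub>" unfolding s_def using B.unwind_ends(1)[OF g qG] q1 by simp
  obtain t where t: "t \<in> GL ?X n" "mat_map n (circle_push h) t = s"
    "mat_vec ?X n t (vec_map n circle_const c') = vec_map n circle_const c'"
    using stabilizer_path_lift[OF surj c' s s1] gd B.unwind_fold[OF g qG]
    unfolding s_def by auto
  have tfix: "mat_vec A n (ev_mat n z t) c' = c'" if z: "z \<in> circle" for z
  proof -
    interpret Z: coeff_hom ?X A "\<lambda>g. g z" by (rule A.ev_hom[OF z])
    have "ev_vec n z (mat_vec ?X n t (vec_map n circle_const c')) = mat_vec A n (ev_mat n z t) (ev_vec n z (vec_map n circle_const c'))"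
      using t(1) c'v by (intro Z.vec_map_mat_vec) simp_all
    then show ?thesis unfolding t(3) by (simp add: ev_vec_const[OF z c'v] del: mem_sphere_0)
  qed
  then have tf: "mat_vec A n (ev_mat n 1 t) c' = c'" "mat_vec A n (ev_mat n (-1) t) c' = c'" by simp_all
  have tz: "ev_mat n 1 t \<in> GL A n" "ev_mat n (-1) t \<in> GL A n" using t(1) by simp_all
  \<comment> \<open>\<open>t\<close> lifts a path that starts at \<one>, but may itself start at
    another matrix above \<one>. The constant path \<open>j\<close> corrects the start of the final
    path and maps to \<one>.\<close>
  define j where "j = mat_map n circle_const (ev_mat n 1 t)"
  have j: "j \<in> GL ?X n" using tz by (simp add: j_def)
  have j_ev: "ev_mat n z j = ev_mat n 1 t" if "z \<in> circle" for z
  proof -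
    have "ev_mat n z j = mat_map n (\<lambda>a. a) (ev_mat n 1 t)"
      unfolding j_def mat_map_comp[of n "\<lambda>g. g z"] by (rule mat_map_pointwise) (rule circle_map_apply(3)[OF that])
    also have "\<dots> = ev_mat n 1 t"
      using tz(1) by (intro mat_map_id[where A = A] A.GL_closed)
    finally show ?thesis .
  qed
  have pj: "mat_map n (circle_push h) j = \<one>\<^bsub>mat_ring ?Y n\<^esub>"
  proof (rule B.mat_CT_eqI)
    show "ev_mat n z (mat_map n (circle_push h) j) = ev_mat n z \<one>\<^bsub>mat_ring ?Y n\<^esub>" if z: "z \<in> circle" for z
    proof -
      interpret Z: coeff_hom ?Y B "\<lambda>g. g z" by (rule B.ev_hom[OF z])
      show ?thesis using ev_mat_push[of 1 n h t]
        by (simp add: ev_mat_push[OF z] j_ev[OF z] Z.mat_map_one t(2) s1 del: mem_sphere_0)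
    qed
  qed (use j in simp_all)
  define W where "W = unwind A n G k"
  have W: "W \<in> GL ?X n" unfolding W_def by (rule A.unwind_GL[OF G(1) kG])
  define k' where "k' = j \<otimes>\<^bsub>mat_ring ?X n\<^esub> inv\<^bsub>mat_ring ?X n\<^esub> t \<otimes>\<^bsub>mat_ring ?X n\<^esub> W"
  have k': "k' \<in> GL ?X n" using j t(1) W by (simp add: k'_def)
  have "ev_mat n 1 k' = \<one>\<^bsub>mat_ring A n\<^esub>"
    unfolding k'_def using j t(1) W tz A.unwind_ends(1)[OF G(1) kG]
    by (simp add: F.mat_map_mult F.mat_map_inv j_ev W_def[symmetric] k_ends)
  moreover
  define k2 where "k2 = ev_mat n 1 t \<otimes>\<^bsub>mat_ring A n\<^esub> inv\<^bsub>mat_ring A n\<^esub> (ev_mat n (-1) t) \<otimes>\<^bsub>mat_ring A n\<^esub> k1"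
  have "ev_mat n (-1) k' = k2"
    unfolding k'_def k2_def using j t(1) W A.unwind_ends(2)[OF G(1) kG]
    by (simp add: E.mat_map_mult E.mat_map_inv j_ev W_def[symmetric] k_ends)
  ultimately have "A.loop n k' k2" using k' by (simp add: A.loop_def)
  moreover have "mat_vec A n k2 c = c'"
    unfolding k2_def using tz k1 cv c'v A.mat_vec_inv[OF tz(2) c'v tf(2)]
    by (simp add: A.mat_vec_mult kc tf(1))
  moreover have "mat_map n (circle_push h) k' = mat_map n (circle_comp run_circle) u"
  proof -
    let ?r = "mat_map n (circle_comp run_circle)"
    define Z where "Z = inv\<^bsub>mat_ring ?Y n\<^esub> (mat_map n (circle_comp (fold_circle (-1))) g)
     \<otimes>\<^bsub>mat_ring ?Y n\<^esub> mat_map n (circle_comp (fold_circle 1)) g"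
    have Z: "Z \<in> GL ?Y n"
    proof -
      interpret Fm: coeff_hom ?Y ?Y "circle_comp (fold_circle (-1))" by (rule B.fold_hom)
      interpret Fp: coeff_hom ?Y ?Y "circle_comp (fold_circle 1)" by (rule B.fold_hom)
      show ?thesis using g by (simp add: Z_def)
    qed
    have comm: "mat_map n (circle_push h) (mat_map n (circle_comp f) x) = mat_map n (circle_comp f) (mat_map n (circle_push h) x)"
      if "f ` circle \<subseteq> circle" for f x
      unfolding mat_map_comp by (rule mat_map_pointwise) (rule circle_push_comp[OF that])
    have ims: "fold_circle l ` circle \<subseteq> circle" "run_circle ` circle \<subseteq> circle" for l
      by (intro image_subsetI fold_circle_in run_circle_in)+
    have pW: "mat_map n (circle_push h) W = Z \<otimes>\<^bsub>mat_ring ?Y n\<^esub> ?r pk"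
    proof -
      interpret Fm: coeff_hom ?X ?X "circle_comp (fold_circle (-1))" by (rule A.fold_hom)
      interpret Fp: coeff_hom ?X ?X "circle_comp (fold_circle 1)" by (rule A.fold_hom)
      show ?thesis unfolding W_def unwind_def Z_def pk_def using G(1) kG
        by (simp add: T.mat_map_mult T.mat_map_inv comm[OF ims(1)] comm[OF ims(2)] G(2))
    qed
    \<comment> \<open>Combines \<open>s = Z (?r q)\<close> with \<open>q u = pk\<close>; dividing by
      \<open>s\<close> then leaves \<open>?r u\<close>.\<close>
    have su: "s \<otimes>\<^bsub>mat_ring ?Y n\<^esub> ?r u = Z \<otimes>\<^bsub>mat_ring ?Y n\<^esub> ?r pk"
    proof -
      have "?r q \<otimes>\<^bsub>mat_ring ?Y n\<^esub> ?r u = ?r (q \<otimes>\<^bsub>mat_ring ?Y n\<^esub> u)"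
        using qG uG by (simp add: RB.mat_map_mult)
      also have "q \<otimes>\<^bsub>mat_ring ?Y n\<^esub> u = pk" unfolding q_def using pk uG by (simp add: T.B.GL_cancel(4))
      finally have "?r q \<otimes>\<^bsub>mat_ring ?Y n\<^esub> ?r u = ?r pk" .
      moreover have "s = Z \<otimes>\<^bsub>mat_ring ?Y n\<^esub> ?r q" unfolding s_def unwind_def Z_def ..
      ultimately show ?thesis using Z qG uG by (simp add: MY.m_assoc)
    qed
    have "mat_map n (circle_push h) k' = inv\<^bsub>mat_ring ?Y n\<^esub> s \<otimes>\<^bsub>mat_ring ?Y n\<^esub> (s \<otimes>\<^bsub>mat_ring ?Y n\<^esub> ?r u)"
      unfolding k'_def su using j t(1) W s by (simp add: T.mat_map_mult T.mat_map_inv pj t(2) pW)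
    also have "\<dots> = ?r u" using s uG by (simp add: T.B.GL_cancel(1))
    finally show ?thesis .
  qed
  ultimately show ?thesis by blast
qed

end

section \<open>Pullbacks\<close>

lemma (in cstar_morphism) loop_push:
  assumes "A.loop n p x" shows "B.loop n (mat_map n (circle_push h) p) (mat_map n h x)"
proof -
  interpret T: cstar_morphism "circle_tensor A" "circle_tensor B" "circle_push h" by (rule push_morphism)
  show ?thesis using assms unfolding A.loop_def B.loop_def by (auto simp: ev_mat_push mat_map_one)
qed

text \<open>Both ends survive the reparametrization, so a path can be matched with the partner that
  \<open>lift_csr\<close> provides for it.\<close>

lemma (in unital_cstar_algebra) loop_run:
  assumes "loop n p x" shows "loop n (mat_map n (circle_comp run_circle) p) x"
proof -
  interpret H: coeff_hom CT CT "circle_comp run_circle" by (rule run_hom)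
  show ?thesis using assms unfolding loop_def by (simp add: ev_mat_comp)
qed

lemma pullback_simps:
  "carrier (cstar_pullback B C \<delta> \<gamma>) = {x. fst x \<in> carrier B \<and> snd x \<in> carrier C \<and> \<delta> (fst x) = \<gamma> (snd x)}"
  "x \<otimes>\<^bsub>cstar_pullback B C \<delta> \<gamma>\<^esub> y = (fst x \<otimes>\<^bsub>B\<^esub> fst y, snd x \<otimes>\<^bsub>C\<^esub> snd y)"
  "x \<oplus>\<^bsub>cstar_pullback B C \<delta> \<gamma>\<^esub> y = (fst x \<oplus>\<^bsub>B\<^esub> fst y, snd x \<oplus>\<^bsub>C\<^esub> snd y)"
  "\<one>\<^bsub>cstar_pullback B C \<delta> \<gamma>\<^esub> = (\<one>\<^bsub>B\<^esub>, \<one>\<^bsub>C\<^esub>)" "\<zero>\<^bsub>cstar_pullback B C \<delta> \<gamma>\<^esub> = (\<zero>\<^bsub>B\<^esub>, \<zero>\<^bsub>C\<^esub>)"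
  "nrm (cstar_pullback B C \<delta> \<gamma>) x = max (nrm B (fst x)) (nrm C (snd x))"
  by (auto simp: cstar_pullback_def cstar_sum_def split: prod.splits)

section \<open>The pullback as a ring and as a metric space\<close>

locale cstar_pullback_diagram = d: cstar_morphism B D \<delta> + g: cstar_morphism C D \<gamma>
  for B :: "'b cstar_alg" and C :: "'c cstar_alg" and D :: "'d cstar_alg" and \<delta> \<gamma>
begin

abbreviation "P \<equiv> cstar_pullback B C \<delta> \<gamma>"

lemma ring_pullback: "ring P"
proof (rule ringI)
  show "abelian_group P"
  proof (rule abelian_groupI)
    fix x assume x: "x \<in> carrier P"
    let ?y = "((-1) \<odot>\<^bsub>B\<^esub> fst x, (-1) \<odot>\<^bsub>C\<^esub> snd x)"
    have "(-1) \<odot>\<^bsub>B\<^esub> b \<oplus>\<^bsub>B\<^esub> b = \<zero>\<^bsub>B\<^esub>" if "b \<in> carrier B" for b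
      using that by (simp add: d.A.smult_m1 d.A.l_neg)
    moreover have "(-1) \<odot>\<^bsub>C\<^esub> c \<oplus>\<^bsub>C\<^esub> c = \<zero>\<^bsub>C\<^esub>" if "c \<in> carrier C" for c
      using that by (simp add: g.A.smult_m1 g.A.l_neg)
    ultimately show "\<exists>y\<in>carrier P. y \<oplus>\<^bsub>P\<^esub> x = \<zero>\<^bsub>P\<^esub>"
      using x by (intro bexI[of _ ?y]) (simp_all add: pullback_simps)
  qed (auto simp: pullback_simps d.A.a_ac g.A.a_ac)
  show "Group.monoid P"
    by (rule monoidI) (auto simp: pullback_simps d.A.m_assoc g.A.m_assoc)
qed (auto simp: pullback_simps d.A.l_distr g.A.l_distr d.A.r_distr g.A.r_distr)

lemma coeff_ring_pullback: "coeff_ring P"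
  by (rule coeff_ring.intro[OF ring_pullback])

lemma fst_hom: "coeff_hom P B fst" and snd_hom: "coeff_hom P C snd"
  by (rule coeff_homI[OF coeff_ring_pullback d.A.coeff_ring_axioms ring_hom_memI]; simp add: pullback_simps)
    (rule coeff_homI[OF coeff_ring_pullback g.A.coeff_ring_axioms ring_hom_memI]; simp add: pullback_simps)

definition mat_pair :: "nat \<Rightarrow> (nat \<times> nat \<Rightarrow> 'b) \<Rightarrow> (nat \<times> nat \<Rightarrow> 'c) \<Rightarrow> nat \<times> nat \<Rightarrow> 'b \<times> 'c" where
  "mat_pair n x y = (\<lambda>p\<in>{..<n} \<times> {..<n}. (x p, y p))"

lemma mat_pair_closed:
  assumes "x \<in> mats B n" "y \<in> mats C n" "mat_map n \<delta> x = mat_map n \<gamma> y"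
  shows "mat_pair n x y \<in> mats P n" "mat_map n fst (mat_pair n x y) = x" "mat_map n snd (mat_pair n x y) = y"
proof -
  have "\<delta> (x p) = \<gamma> (y p)" if "p \<in> {..<n} \<times> {..<n}" for p
    using fun_cong[OF assms(3), of p] that by (auto simp: mat_map_def)
  then show c: "mat_pair n x y \<in> mats P n"
    using assms(1,2) by (auto simp: mat_pair_def mat_carrier pullback_simps PiE_iff)
  interpret F: coeff_hom P B fst by (rule fst_hom)
  interpret S: coeff_hom P C snd by (rule snd_hom)
  show "mat_map n fst (mat_pair n x y) = x"
    by (rule mat_ext[where A = B and n = n]) (use c assms(1) in simp_all, simp add: mat_pair_def)
  show "mat_map n snd (mat_pair n x y) = y"
    by (rule mat_ext[where A = C and n = n]) (use c assms(2) in simp_all, simp add: mat_pair_def)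
qed

lemma pullback_mat_eqI:
  assumes "x \<in> mats P n" "y \<in> mats P n"
    "mat_map n fst x = mat_map n fst y" "mat_map n snd x = mat_map n snd y"
  shows "x = y"
proof (rule mat_ext[OF assms(1,2)])
  fix i j assume "i < n" "j < n"
  then show "x (i, j) = y (i, j)"
    using fun_cong[OF assms(3), of "(i, j)"] fun_cong[OF assms(4), of "(i, j)"] by (simp add: prod_eq_iff)
qed

text \<open>Homomorphisms preserve inverses, so the inverses of a compatible pair are compatible as
  well.\<close>

lemma mat_pair_GL:
  assumes x: "x \<in> GL B n" and y: "y \<in> GL C n" and e: "mat_map n \<delta> x = mat_map n \<gamma> y"
  shows "mat_pair n x y \<in> GL P n"
proof -
  interpret F: coeff_hom P B fst by (rule fst_hom)
  interpret S: coeff_hom P C snd by (rule snd_hom)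
  let ?x = "inv\<^bsub>mat_ring B n\<^esub> x" and ?y = "inv\<^bsub>mat_ring C n\<^esub> y"
  have e': "mat_map n \<delta> ?x = mat_map n \<gamma> ?y" using x y e by (simp add: d.mat_map_inv g.mat_map_inv)
  have c: "x \<in> mats B n" "y \<in> mats C n" "?x \<in> mats B n" "?y \<in> mats C n"
    using x y by simp_all
  note p = mat_pair_closed[OF c(1,2) e] note q = mat_pair_closed[OF c(3,4) e']
  show ?thesis
  proof (rule F.A.GL_I[OF p(1) q(1)])
    show "mat_pair n x y \<otimes>\<^bsub>mat_ring P n\<^esub> mat_pair n ?x ?y = \<one>\<^bsub>mat_ring P n\<^esub>"
      using p q x y by (intro pullback_mat_eqI[where n = n]) (simp_all add: F.mat_map_mult S.mat_map_mult F.mat_map_one S.mat_map_one)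
    show "mat_pair n ?x ?y \<otimes>\<^bsub>mat_ring P n\<^esub> mat_pair n x y = \<one>\<^bsub>mat_ring P n\<^esub>"
      using p q x y by (intro pullback_mat_eqI[where n = n]) (simp_all add: F.mat_map_mult S.mat_map_mult F.mat_map_one S.mat_map_one)
  qed
qed

lemma mat_pair_vec:
  assumes x: "x \<in> GL B n" and y: "y \<in> GL C n" and e: "mat_map n \<delta> x = mat_map n \<gamma> y"
    and v: "v \<in> vecs P n" and w: "w \<in> vecs P n"
    and "mat_vec B n x (vec_map n fst v) = vec_map n fst w" "mat_vec C n y (vec_map n snd v) = vec_map n snd w"
  shows "mat_vec P n (mat_pair n x y) v = w"
proof -
  interpret F: coeff_hom P B fst by (rule fst_hom)
  interpret S: coeff_hom P C snd by (rule snd_hom)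
  note p = mat_pair_closed[OF d.A.GL_closed[OF x] g.A.GL_closed[OF y] e]
  have f: "vec_map n fst (mat_vec P n (mat_pair n x y) v) = vec_map n fst w"
    "vec_map n snd (mat_vec P n (mat_pair n x y) v) = vec_map n snd w"
    using p v assms(6,7) by (simp_all add: F.vec_map_mat_vec S.vec_map_mat_vec)
  show ?thesis
  proof (rule vec_ext[where A = P and n = n])
    fix i assume "i < n"
    then show "mat_vec P n (mat_pair n x y) v i = w i"
      using fun_cong[OF f(1), of i] fun_cong[OF f(2), of i] by (simp add: prod_eq_iff)
  qed (use p v w in simp_all)
qed

lemma vec_square: "v \<in> vecs P n \<Longrightarrow> vec_map n \<delta> (vec_map n fst v) = vec_map n \<gamma> (vec_map n snd v)"
  unfolding vec_map_comp by (rule vec_map_cong[where A = P]) (simp_all add: pullback_simps)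

text \<open>The topology of \<open>GL P n\<close> is built from this distance. As it is the maximum
  of the two component distances, continuity into \<open>P\<close> can be checked in the
  components.\<close>

lemma Metric_space_pullback: "Metric_space (carrier P) (cstar_dist P)"
  and cstar_dist_pullback: "\<lbrakk>x \<in> carrier P; y \<in> carrier P\<rbrakk> \<Longrightarrow>
    cstar_dist P x y = max (cstar_dist B (fst x) (fst y)) (cstar_dist C (snd x) (snd y))"
proof -
  interpret F: coeff_hom P B fst by (rule fst_hom)
  interpret S: coeff_hom P C snd by (rule snd_hom)
  have e: "cstar_dist P x y = (if x \<in> carrier P \<and> y \<in> carrier P
      then max (cstar_dist B (fst x) (fst y)) (cstar_dist C (snd x) (snd y)) else 0)" for x y
  proof (cases "x \<in> carrier P \<and> y \<in> carrier P")
    case True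
    then have c: "x \<in> carrier P" "y \<in> carrier P" by blast+
    note m = F.h_minus[OF c] S.h_minus[OF c] and f = F.h_simps(1)[OF c(1)] F.h_simps(1)[OF c(2)]
      S.h_simps(1)[OF c(1)] S.h_simps(1)[OF c(2)]
    show ?thesis by (simp only: cstar_dist_def c f m pullback_simps(6) if_True simp_thms)
  next
    case False
    then show ?thesis by (simp only: cstar_dist_def if_False)
  qed
  then show "\<lbrakk>x \<in> carrier P; y \<in> carrier P\<rbrakk> \<Longrightarrow>
    cstar_dist P x y = max (cstar_dist B (fst x) (fst y)) (cstar_dist C (snd x) (snd y))" for x y by simp
  show "Metric_space (carrier P) (cstar_dist P)"
  proof
    show "0 \<le> cstar_dist P x y" for x y by (simp add: e le_max_iff_disj)
    show "cstar_dist P x y = cstar_dist P y x" for x y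
      by (simp add: e d.A.metric.commute g.A.metric.commute)
    show "cstar_dist P x y = 0 \<longleftrightarrow> x = y" if xy: "x \<in> carrier P" "y \<in> carrier P" for x y
    proof -
      note f = F.h_simps(1)[OF xy(1)] F.h_simps(1)[OF xy(2)] and s = S.h_simps(1)[OF xy(1)] S.h_simps(1)[OF xy(2)]
      have "cstar_dist P x y = max (cstar_dist B (fst x) (fst y)) (cstar_dist C (snd x) (snd y))"
        by (simp only: e xy if_True simp_thms)
      also have "\<dots> = 0 \<longleftrightarrow> cstar_dist B (fst x) (fst y) = 0 \<and> cstar_dist C (snd x) (snd y) = 0"
        using d.A.metric.nonneg[of "fst x" "fst y"] g.A.metric.nonneg[of "snd x" "snd y"]
        by (auto simp only: max_def split: if_splits)
      also have "\<dots> \<longleftrightarrow> x = y"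
        unfolding d.A.metric.zero[OF f] g.A.metric.zero[OF s] by (rule prod_eq_iff[symmetric])
      finally show ?thesis .
    qed
    show "cstar_dist P x z \<le> cstar_dist P x y + cstar_dist P y z"
      if xyz: "x \<in> carrier P" "y \<in> carrier P" "z \<in> carrier P" for x y z
    proof -
      have m: "max a b \<le> max a' b' + max a'' b''" if "a \<le> a' + a''" "b \<le> b' + b''" for a b a' b' a'' b'' :: real
        using that by linarith
      note f = xyz[THEN F.h_simps(1)] and s = xyz[THEN S.h_simps(1)]
      show ?thesis
        unfolding e using m[OF d.A.metric.triangle[OF f] g.A.metric.triangle[OF s]]
        by (simp only: xyz if_True simp_thms)
    qed
  qed
qed

text \<open>The two paths agree over \<open>D\<close> at every point of the circle, so their pairs
  form a continuous image of the circle in \<open>GL P n\<close>. This image is connected and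
  contains \<one> and the pair of ends.\<close>

lemma mat_pair_GL0:
  assumes p: "d.A.loop n p x" and q: "g.A.loop n q y"
    and e: "mat_map n (circle_push \<delta>) p = mat_map n (circle_push \<gamma>) q"
  shows "mat_pair n x y \<in> GL0 P n"
proof -
  interpret R: coeff_ring P by (rule coeff_ring_pullback)
  interpret met: Metric_space "carrier P" "cstar_dist P" by (rule Metric_space_pullback)
  have pG: "p \<in> GL (circle_tensor B) n" and qG: "q \<in> GL (circle_tensor C) n"
    using p q by (simp_all add: d.A.loop_def g.A.loop_def)
  define F where "F z = mat_pair n (ev_mat n z p) (ev_mat n z q)" for z
  have zG: "ev_mat n z p \<in> GL B n" "ev_mat n z q \<in> GL C n" if z: "z \<in> circle" for z
  proof -
    interpret Z: coeff_hom "circle_tensor B" B "\<lambda>g. g z" by (rule d.A.ev_hom[OF z])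
    interpret W: coeff_hom "circle_tensor C" C "\<lambda>g. g z" by (rule g.A.ev_hom[OF z])
    show "ev_mat n z p \<in> GL B n" "ev_mat n z q \<in> GL C n" using pG qG by simp_all
  qed
  have ze: "mat_map n \<delta> (ev_mat n z p) = mat_map n \<gamma> (ev_mat n z q)" if z: "z \<in> circle" for z
    using ev_mat_push[OF z, of n \<delta> p] ev_mat_push[OF z, of n \<gamma> q] e by simp
  have FG: "F z \<in> GL P n" if "z \<in> circle" for z
    unfolding F_def by (rule mat_pair_GL[OF zG[OF that] ze[OF that]])
  have F1: "F 1 = \<one>\<^bsub>mat_ring P n\<^esub>"
    using p q by (auto simp: F_def mat_pair_def d.A.loop_def g.A.loop_def mat_ring_def pullback_simps fun_eq_iff)
  have Fm: "F (-1) = mat_pair n x y"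
    using p q by (simp add: F_def d.A.loop_def g.A.loop_def)
  have comp: "continuous_map (top_of_set circle) (cstar_topology P) (\<lambda>z. F z (i, j))" if ij: "i < n" "j < n" for i j
    unfolding cstar_topology_def met.continuous_map_to_metric
  proof (intro ballI allI impI)
    fix z :: complex and r :: real assume "z \<in> topspace (top_of_set circle)" and r: "r > 0"
    then have z: "z \<in> circle" by simp
    have "d.A.ccont (p (i, j))" "g.A.ccont (q (i, j))"
    proof -
      interpret TB: unital_cstar_algebra "circle_tensor B" by (rule d.A.unital_cstar_algebra_circle_tensor)
      interpret TC: unital_cstar_algebra "circle_tensor C" by (rule g.A.unital_cstar_algebra_circle_tensor)
      show "d.A.ccont (p (i, j))" using mat_carrierD[OF TB.GL_closed[OF pG] ij] by (simp add: d.A.CT_simps(1))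
      show "g.A.ccont (q (i, j))" using mat_carrierD[OF TC.GL_closed[OF qG] ij] by (simp add: g.A.CT_simps(1))
    qed
    then have "continuous_map (top_of_set circle) d.A.metric.mtopology (p (i, j))"
      "continuous_map (top_of_set circle) g.A.metric.mtopology (q (i, j))"
      by (simp_all add: d.A.ccont_iff g.A.ccont_iff cstar_topology_def)
    then obtain U V where U: "openin (top_of_set circle) U" "z \<in> U" "\<And>w. w \<in> U \<Longrightarrow> p (i, j) w \<in> d.A.metric.mball (p (i, j) z) r"
      and V: "openin (top_of_set circle) V" "z \<in> V" "\<And>w. w \<in> V \<Longrightarrow> q (i, j) w \<in> g.A.metric.mball (q (i, j) z) r"
      unfolding d.A.metric.continuous_map_to_metric g.A.metric.continuous_map_to_metric
      using z r by (metis topspace_euclidean_subtopology)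
    have Fe: "F w (i, j) = (p (i, j) w, q (i, j) w)" for w using ij by (simp add: F_def mat_pair_def)
    have Fc: "F w (i, j) \<in> carrier P" if "w \<in> circle" for w
      using mat_carrierD[OF R.GL_closed[OF FG[OF that]] ij] .
    have "F w (i, j) \<in> met.mball (F z (i, j)) r" if w: "w \<in> U \<inter> V" for w
    proof -
      have "w \<in> circle" using openin_subset[OF U(1)] w by auto
      then show ?thesis
        using w U(3)[of w] V(3)[of w] Fc[OF z] Fc[of w]
        by (simp add: met.in_mball cstar_dist_pullback d.A.metric.in_mball g.A.metric.in_mball Fe del: mem_sphere_0)
    qed
    then show "\<exists>U. openin (top_of_set circle) U \<and> z \<in> U \<and> (\<forall>w\<in>U. F w (i, j) \<in> met.mball (F z (i, j)) r)"
      using U V by (intro exI[of _ "U \<inter> V"]) auto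
  qed
  have sub: "GL P n \<subseteq> topspace (product_topology (\<lambda>_. cstar_topology P) ({..<n} \<times> {..<n}))"
    using R.GL_closed by (auto simp: cstar_topology_def mat_carrier)
  have "continuous_map (top_of_set circle) (GL_topology P n) F"
    unfolding GL_topology_def continuous_map_in_subtopology continuous_map_componentwise
  proof (intro conjI)
    show "F ` topspace (top_of_set circle) \<subseteq> extensional ({..<n} \<times> {..<n})"
      by (auto simp: F_def mat_pair_def)
    show "\<forall>k\<in>{..<n} \<times> {..<n}. continuous_map (top_of_set circle) (cstar_topology P) (\<lambda>z. F z k)"
      using comp by auto
    show "F \<in> topspace (top_of_set circle) \<rightarrow> GL P n" using FG by auto
  qed
  then have "connectedin (GL_topology P n) (F ` circle)"
    by (rule connectedin_continuous_map_image) (simp add: connected_sphere)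
  moreover have "F 1 \<in> F ` circle" "F (-1) \<in> F ` circle" by auto
  ultimately show ?thesis
    unfolding GL0_def one_mat_monoid connected_component_of_def F1[symmetric] Fm[symmetric] by blast
qed

text \<open>\<open>HB\<close> and \<open>HC\<close> are the identity components in the first bound
  and the full groups in the case of trivial \<open>K\<^sub>1(D)\<close>. The two cases differ in
  the source of the paths, which is therefore an assumption; it comes in both orders because either
  map may be the surjective one.\<close>

lemma transitive_GL:
  assumes surj: "\<gamma> ` carrier C = carrier D \<or> \<delta> ` carrier B = carrier D"
    and D: "transitive_on_Lg (circle_tensor D) n (GL (circle_tensor D) n)"
    and B: "transitive_on_Lg B n HB" "HB \<subseteq> GL B n" and C: "transitive_on_Lg C n HC" "HC \<subseteq> GL C n"
    and loops: "\<And>x y. \<lbrakk>x \<in> HB; y \<in> HC\<rbrakk> \<Longrightarrow>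
      \<exists>q. d.B.loop n q (mat_map n \<delta> x \<otimes>\<^bsub>mat_ring D n\<^esub> inv\<^bsub>mat_ring D n\<^esub> (mat_map n \<gamma> y))"
      "\<And>x y. \<lbrakk>x \<in> HB; y \<in> HC\<rbrakk> \<Longrightarrow>
      \<exists>q. d.B.loop n q (mat_map n \<gamma> y \<otimes>\<^bsub>mat_ring D n\<^esub> inv\<^bsub>mat_ring D n\<^esub> (mat_map n \<delta> x))"
  shows "transitive_on_Lg P n (GL P n)"
  unfolding transitive_on_Lg_def
proof (intro ballI)
  interpret F: coeff_hom P B fst by (rule fst_hom)
  interpret S: coeff_hom P C snd by (rule snd_hom)
  fix v w assume v: "v \<in> Lg P n" and w: "w \<in> Lg P n"
  then have vv: "v \<in> vecs P n" and wv: "w \<in> vecs P n" by (simp_all add: Lg_def)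
  have L: "vec_map n fst v \<in> Lg B n" "vec_map n fst w \<in> Lg B n" "vec_map n snd v \<in> Lg C n" "vec_map n snd w \<in> Lg C n"
    using v w by simp_all
  obtain x where x: "x \<in> HB" "mat_vec B n x (vec_map n fst v) = vec_map n fst w"
    using B(1) L unfolding transitive_on_Lg_def by blast
  obtain y where y: "y \<in> HC" "mat_vec C n y (vec_map n snd v) = vec_map n snd w"
    using C(1) L unfolding transitive_on_Lg_def by blast
  have xG: "x \<in> GL B n" and yG: "y \<in> GL C n" using x y B C by blast+
  have xv: "vec_map n fst v \<in> vecs B n" and yv: "vec_map n snd v \<in> vecs C n" using vv by simp_all
  have dx: "mat_vec D n (mat_map n \<delta> x) (vec_map n \<delta> (vec_map n fst v)) = vec_map n \<delta> (vec_map n fst w)"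
    using xG xv x(2) by (simp add: d.vec_map_mat_vec[symmetric])
  have gy: "mat_vec D n (mat_map n \<gamma> y) (vec_map n \<gamma> (vec_map n snd v)) = vec_map n \<gamma> (vec_map n snd w)"
    using yG yv y(2) by (simp add: g.vec_map_mat_vec[symmetric])
  from surj show "\<exists>g\<in>GL P n. mat_vec P n g v = w"
  proof
    assume s: "\<gamma> ` carrier C = carrier D"
    obtain q where q: "d.B.loop n q (mat_map n \<gamma> y \<otimes>\<^bsub>mat_ring D n\<^esub> inv\<^bsub>mat_ring D n\<^esub> (mat_map n \<delta> x))"
      using loops(2)[OF x(1) y(1)] by blast
    have "\<exists>k\<in>GL C n. mat_vec C n k (vec_map n snd v) = vec_map n snd w \<and> mat_map n \<gamma> k = mat_map n \<delta> x"
      by (rule g.lift_gsr[OF s D _ yG L(3,4) y(2) _ q]) (use xG dx in \<open>simp_all add: vec_square[OF vv] vec_square[OF wv]\<close>)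
    then obtain k where k: "k \<in> GL C n" "mat_vec C n k (vec_map n snd v) = vec_map n snd w" "mat_map n \<delta> x = mat_map n \<gamma> k"
      by auto
    show ?thesis
      using mat_pair_GL[OF xG k(1,3)] mat_pair_vec[OF xG k(1,3) vv wv x(2) k(2)] by blast
  next
    assume s: "\<delta> ` carrier B = carrier D"
    obtain q where q: "d.B.loop n q (mat_map n \<delta> x \<otimes>\<^bsub>mat_ring D n\<^esub> inv\<^bsub>mat_ring D n\<^esub> (mat_map n \<gamma> y))"
      using loops(1)[OF x(1) y(1)] by blast
    have "\<exists>k\<in>GL B n. mat_vec B n k (vec_map n fst v) = vec_map n fst w \<and> mat_map n \<delta> k = mat_map n \<gamma> y"
      by (rule d.lift_gsr[OF s D _ xG L(1,2) x(2) _ q]) (use yG gy in \<open>simp_all add: vec_square[OF vv] vec_square[OF wv]\<close>)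
    then obtain k where k: "k \<in> GL B n" "mat_vec B n k (vec_map n fst v) = vec_map n fst w" "mat_map n \<delta> k = mat_map n \<gamma> y"
      by auto
    show ?thesis
      using mat_pair_GL[OF k(1) yG k(3)] mat_pair_vec[OF k(1) yG k(3) vv wv k(2) y(2)] by blast
  qed
qed

text \<open>The result has to lie in the component of \<one>, so the matrices over \<open>B\<close>
  and \<open>C\<close> must be ends of paths that agree over \<open>D\<close> throughout; agreement
  at the end alone is not enough.\<close>

lemma transitive_GL0:
  assumes surj: "\<gamma> ` carrier C = carrier D \<or> \<delta> ` carrier B = carrier D"
    and D: "transitive_on_Lg (circle_tensor D) n (GL0 (circle_tensor D) n)"
    and B: "transitive_on_Lg B n (GL0 B n)" and C: "transitive_on_Lg C n (GL0 C n)"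
  shows "transitive_on_Lg P n (GL0 P n)"
  unfolding transitive_on_Lg_def
proof (intro ballI)
  interpret F: coeff_hom P B fst by (rule fst_hom)
  interpret S: coeff_hom P C snd by (rule snd_hom)
  fix v w assume v: "v \<in> Lg P n" and w: "w \<in> Lg P n"
  then have vv: "v \<in> vecs P n" and wv: "w \<in> vecs P n" by (simp_all add: Lg_def)
  have L: "vec_map n fst v \<in> Lg B n" "vec_map n fst w \<in> Lg B n" "vec_map n snd v \<in> Lg C n" "vec_map n snd w \<in> Lg C n"
    using v w by simp_all
  obtain x p where x: "d.A.loop n p x" "mat_vec B n x (vec_map n fst v) = vec_map n fst w"
    using B L d.A.GL0_loop unfolding transitive_on_Lg_def by blast
  obtain y q where y: "g.A.loop n q y" "mat_vec C n y (vec_map n snd v) = vec_map n snd w"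
    using C L g.A.GL0_loop unfolding transitive_on_Lg_def by blast
  have xG: "x \<in> GL B n" and yG: "y \<in> GL C n" using x y d.A.loop_GL g.A.loop_GL by blast+
  have xv: "vec_map n fst v \<in> vecs B n" and yv: "vec_map n snd v \<in> vecs C n" using vv by simp_all
  have dx: "mat_vec D n (mat_map n \<delta> x) (vec_map n \<delta> (vec_map n fst v)) = vec_map n \<delta> (vec_map n fst w)"
    using xG xv x(2) by (simp add: d.vec_map_mat_vec[symmetric])
  have gy: "mat_vec D n (mat_map n \<gamma> y) (vec_map n \<gamma> (vec_map n snd v)) = vec_map n \<gamma> (vec_map n snd w)"
    using yG yv y(2) by (simp add: g.vec_map_mat_vec[symmetric])
  have comm: "mat_map n (circle_comp run_circle) (mat_map n (circle_push f) p) = mat_map n (circle_push f) (mat_map n (circle_comp run_circle) p)"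
    for f p
    unfolding mat_map_comp by (rule mat_map_pointwise) (rule circle_push_comp[symmetric], intro image_subsetI run_circle_in)
  have ends: "mat_map n \<delta> x' = mat_map n \<gamma> y'"
    if "d.A.loop n p' x'" "g.A.loop n q' y'" "mat_map n (circle_push \<delta>) p' = mat_map n (circle_push \<gamma>) q'" for p' q' x' y'
    using d.loop_push[OF that(1)] g.loop_push[OF that(2)] that(3) unfolding d.B.loop_def by simp
  have fin: "\<exists>g\<in>GL0 P n. mat_vec P n g v = w"
    if l: "d.A.loop n p' x'" "g.A.loop n q' y'" "mat_map n (circle_push \<delta>) p' = mat_map n (circle_push \<gamma>) q'"
      and m: "mat_vec B n x' (vec_map n fst v) = vec_map n fst w" "mat_vec C n y' (vec_map n snd v) = vec_map n snd w"
    for p' q' x' y'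
    using mat_pair_GL0[OF l] mat_pair_vec[OF d.A.loop_GL[OF l(1)] g.A.loop_GL[OF l(2)] ends[OF l] vv wv m] by blast
  from surj show "\<exists>g\<in>GL0 P n. mat_vec P n g v = w"
  proof
    assume s: "\<gamma> ` carrier C = carrier D"
    have "\<exists>k' k2. g.A.loop n k' k2 \<and> mat_vec C n k2 (vec_map n snd v) = vec_map n snd w \<and>
        mat_map n (circle_push \<gamma>) k' = mat_map n (circle_comp run_circle) (mat_map n (circle_push \<delta>) p)"
      by (rule g.lift_csr[OF s D d.loop_push[OF x(1)] y(1) L(3,4) y(2)])
        (use dx in \<open>simp add: vec_square[OF vv] vec_square[OF wv]\<close>)
    then obtain k' k2 where k: "g.A.loop n k' k2" "mat_vec C n k2 (vec_map n snd v) = vec_map n snd w"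
      "mat_map n (circle_push \<gamma>) k' = mat_map n (circle_comp run_circle) (mat_map n (circle_push \<delta>) p)" by blast
    \<comment> \<open>\<open>lift_csr\<close> meets the path over \<open>B\<close> after
      \<open>run_circle\<close>, so \<open>p\<close> is reparametrized too before the two are
      paired.\<close>
    show ?thesis
      by (rule fin[OF d.A.loop_run[OF x(1)] k(1) _ x(2) k(2)]) (simp only: k(3) comm)
  next
    assume s: "\<delta> ` carrier B = carrier D"
    have "\<exists>k' k2. d.A.loop n k' k2 \<and> mat_vec B n k2 (vec_map n fst v) = vec_map n fst w \<and>
        mat_map n (circle_push \<delta>) k' = mat_map n (circle_comp run_circle) (mat_map n (circle_push \<gamma>) q)"
      by (rule d.lift_csr[OF s D g.loop_push[OF y(1)] x(1) L(1,2) x(2)])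
        (use gy in \<open>simp add: vec_square[OF vv] vec_square[OF wv]\<close>)
    then obtain k' k2 where k: "d.A.loop n k' k2" "mat_vec B n k2 (vec_map n fst v) = vec_map n fst w"
      "mat_map n (circle_push \<delta>) k' = mat_map n (circle_comp run_circle) (mat_map n (circle_push \<gamma>) q)" by blast
    show ?thesis
      by (rule fin[OF k(1) g.A.loop_run[OF y(1)] _ k(2) y(2)]) (simp only: k(3) comm)
  qed
qed

end

section \<open>Triviality of \<open>K\<^sub>1\<close>\<close>

abbreviation mat_cut :: "nat \<Rightarrow> (nat \<times> nat \<Rightarrow> 'a) \<Rightarrow> nat \<times> nat \<Rightarrow> 'a" where
  "mat_cut k \<equiv> mat_map k (\<lambda>a. a)"

text \<open>One step of the stabilization \<open>x \<mapsto> diag(x, 1)\<close>, kept within finite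
  matrices so that it also applies to paths.\<close>

definition mat_pad :: "('a, 'm) cstar_alg_scheme \<Rightarrow> nat \<Rightarrow> (nat \<times> nat \<Rightarrow> 'a) \<Rightarrow> nat \<times> nat \<Rightarrow> 'a" where
  "mat_pad A k x = (\<lambda>(i, j)\<in>{..<Suc k} \<times> {..<Suc k}. if i < k \<and> j < k then x (i, j)
     else if i = j then \<one>\<^bsub>A\<^esub> else \<zero>\<^bsub>A\<^esub>)"

context coeff_ring
begin

abbreviation "last_unit k \<equiv> (\<lambda>i\<in>{..<Suc k}. if i = k then \<one> else \<zero>)"

text \<open>The last column of a matrix is its value at the last unit vector. Matrices that fix this
  vector are block lower triangular, and on these \<open>mat_cut\<close> is multiplicative although
  their last row is arbitrary off the diagonal.\<close>

lemma fixes_last_unit: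
  assumes x: "x \<in> mats A (Suc k)" and "mat_vec A (Suc k) x (last_unit k) = last_unit k" and i: "i < k"
  shows "x (i, k) = \<zero>"
proof -
  have xi: "x (i, j) \<in> carrier A" if "j < Suc k" for j using mat_carrierD[OF x _ that] i by simp
  have "mat_vec A (Suc k) x (last_unit k) i = lin_comb A (Suc k) (\<lambda>j. x (i, j)) (\<lambda>j. if j = k then \<one> else \<zero>)"
    using i xi by (subst mat_vec_apply) (auto intro!: lin_comb_cong)
  also have "\<dots> = x (i, k)" using xi by (subst lin_comb_delta_right) simp_all
  finally show ?thesis using assms(2) i by simp
qed

lemma mat_cut_closed [simp]:
  assumes "x \<in> mats A (Suc k)" shows "mat_cut k x \<in> mats A k"
  unfolding mat_carrier by (rule PiE_I) (use mat_carrierD[OF assms] in \<open>auto simp: mat_map_def\<close>)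

lemma mat_cut_one: "mat_cut k \<one>\<^bsub>mat_ring A (Suc k)\<^esub> = \<one>\<^bsub>mat_ring A k\<^esub>"
  by (rule mat_ext[where A = A and n = k]) (simp_all add: mat_entries)

lemma mat_cut_mult:
  assumes x: "x \<in> mats A (Suc k)" and y: "y \<in> mats A (Suc k)"
    and z: "\<And>i. i < k \<Longrightarrow> x (i, k) = \<zero>"
  shows "mat_cut k (x \<otimes>\<^bsub>mat_ring A (Suc k)\<^esub> y) = mat_cut k x \<otimes>\<^bsub>mat_ring A k\<^esub> mat_cut k y"
proof (rule mat_ext[where A = A and n = k])
  fix i j assume ij: "i < k" "j < k"
  have xi: "x (i, l) \<in> carrier A" and yj: "y (l, j) \<in> carrier A" if "l \<le> k" for l
    using mat_carrierD[OF x, of i l] mat_carrierD[OF y, of l j] that ij by simp_all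
  have "mat_cut k (x \<otimes>\<^bsub>mat_ring A (Suc k)\<^esub> y) (i, j) = lin_comb A (Suc k) (\<lambda>l. x (i, l)) (\<lambda>l. y (l, j))"
    using ij by (simp add: mat_entries)
  also have "\<dots> = lin_comb A k (\<lambda>l. x (i, l)) (\<lambda>l. y (l, j)) \<oplus> \<zero> \<otimes> y (k, j)"
    using xi yj z[OF ij(1)] by (subst lin_comb_Suc) simp_all
  also have "\<dots> = lin_comb A k (\<lambda>l. x (i, l)) (\<lambda>l. y (l, j))" using xi yj by simp
  also have "\<dots> = (mat_cut k x \<otimes>\<^bsub>mat_ring A k\<^esub> mat_cut k y) (i, j)"
    unfolding mat_entries(1)[OF ij] using ij xi yj by (intro lin_comb_cong) simp_all
  finally show "mat_cut k (x \<otimes>\<^bsub>mat_ring A (Suc k)\<^esub> y) (i, j) = (mat_cut k x \<otimes>\<^bsub>mat_ring A k\<^esub> mat_cut k y) (i, j)" .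
qed (use x y in simp_all)

text \<open>The inverse fixes the last unit vector too, so both products of the two cuts are cuts of
  \<one>.\<close>

lemma mat_cut_GL:
  assumes x: "x \<in> GL A (Suc k)" and e: "mat_vec A (Suc k) x (last_unit k) = last_unit k"
  shows "mat_cut k x \<in> GL A k"
proof (rule GL_I)
  let ?y = "inv\<^bsub>mat_ring A (Suc k)\<^esub> x"
  have y: "?y \<in> GL A (Suc k)" using x by simp
  have ev: "last_unit k \<in> vecs A (Suc k)" by (rule PiE_I) auto
  have ye: "mat_vec A (Suc k) ?y (last_unit k) = last_unit k" using mat_vec_inv[OF x ev e] .
  show "mat_cut k x \<otimes>\<^bsub>mat_ring A k\<^esub> mat_cut k ?y = \<one>\<^bsub>mat_ring A k\<^esub>"
    using x y fixes_last_unit[OF _ e] by (simp flip: mat_cut_mult add: mat_cut_one)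
  show "mat_cut k ?y \<otimes>\<^bsub>mat_ring A k\<^esub> mat_cut k x = \<one>\<^bsub>mat_ring A k\<^esub>"
    using x y fixes_last_unit[OF _ ye] by (simp flip: mat_cut_mult add: mat_cut_one)
  show "mat_cut k x \<in> mats A k" "mat_cut k ?y \<in> mats A k" using x y by simp_all
qed

lemma mat_pad_apply:
  "\<lbrakk>i < Suc k; j < Suc k\<rbrakk> \<Longrightarrow> mat_pad A k x (i, j) = (if i < k \<and> j < k then x (i, j) else if i = j then \<one> else \<zero>)"
  by (simp add: mat_pad_def)

lemma mat_pad_closed [simp]:
  assumes "x \<in> mats A k" shows "mat_pad A k x \<in> mats A (Suc k)"
  unfolding mat_carrier by (rule PiE_I) (use mat_carrierD[OF assms] in \<open>auto simp: mat_pad_def\<close>)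

lemma mat_pad_one: "mat_pad A k \<one>\<^bsub>mat_ring A k\<^esub> = \<one>\<^bsub>mat_ring A (Suc k)\<^esub>"
  by (rule mat_ext[where A = A and n = "Suc k"]) (simp_all add: mat_entries mat_pad_apply)

lemma mat_pad_mult:
  assumes x: "x \<in> mats A k" and y: "y \<in> mats A k"
  shows "mat_pad A k (x \<otimes>\<^bsub>mat_ring A k\<^esub> y) = mat_pad A k x \<otimes>\<^bsub>mat_ring A (Suc k)\<^esub> mat_pad A k y"
proof (rule mat_ext[where A = A and n = "Suc k"])
  fix i j assume ij: "i < Suc k" "j < Suc k"
  let ?x = "mat_pad A k x" and ?y = "mat_pad A k y"
  have c: "?x (i, l) \<in> carrier A" "?y (l, j) \<in> carrier A" if "l \<le> k" for l
    using mat_carrierD[OF mat_pad_closed[OF x], of i l] mat_carrierD[OF mat_pad_closed[OF y], of l j] that ij by simp_all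
  have e: "(?x \<otimes>\<^bsub>mat_ring A (Suc k)\<^esub> ?y) (i, j) = lin_comb A k (\<lambda>l. ?x (i, l)) (\<lambda>l. ?y (l, j)) \<oplus> ?x (i, k) \<otimes> ?y (k, j)"
    unfolding mat_entries(1)[OF ij] using c by (intro lin_comb_Suc)
  show "mat_pad A k (x \<otimes>\<^bsub>mat_ring A k\<^esub> y) (i, j) = (?x \<otimes>\<^bsub>mat_ring A (Suc k)\<^esub> ?y) (i, j)"
  proof (cases "i < k")
    case i: True
    have xi: "x (i, l) \<in> carrier A" if "l < k" for l using mat_carrierD[OF x i that] .
    show ?thesis
    proof (cases "j < k")
      case j: True
      have yj: "y (l, j) \<in> carrier A" if "l < k" for l using mat_carrierD[OF y that j] .
      have "lin_comb A k (\<lambda>l. ?x (i, l)) (\<lambda>l. ?y (l, j)) = lin_comb A k (\<lambda>l. x (i, l)) (\<lambda>l. y (l, j))"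
        using i j xi yj by (intro lin_comb_cong) (simp_all add: mat_pad_apply)
      then show ?thesis unfolding e using i j xi yj by (simp add: mat_pad_apply mat_entries)
    next
      case False
      then have j: "j = k" using ij by simp
      have "lin_comb A k (\<lambda>l. ?x (i, l)) (\<lambda>l. ?y (l, j)) = lin_comb A k (\<lambda>l. x (i, l)) (\<lambda>l. \<zero>)"
        using i j xi by (intro lin_comb_cong) (simp_all add: mat_pad_apply)
      then show ?thesis unfolding e using i j xi by (simp add: mat_pad_apply lin_comb_zero_right)
    qed
  next
    case False
    then have i: "i = k" using ij by simp
    have yl: "?y (l, j) \<in> carrier A" if "l < k" for l using c(2)[of l] that by simp
    have "lin_comb A k (\<lambda>l. ?x (i, l)) (\<lambda>l. ?y (l, j)) = lin_comb A k (\<lambda>l. \<zero>) (\<lambda>l. ?y (l, j))"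
      using i yl by (intro lin_comb_cong) (simp_all add: mat_pad_apply)
    then have "(?x \<otimes>\<^bsub>mat_ring A (Suc k)\<^esub> ?y) (i, j) = ?y (k, j)"
      unfolding e using i yl c(2)[of k] by (simp add: lin_comb_zero_left mat_pad_apply[of k k k])
    then show ?thesis using i ij by (simp add: mat_pad_apply)
  qed
qed (use x y in simp_all)

lemma mat_pad_GL:
  assumes x: "x \<in> GL A k" shows "mat_pad A k x \<in> GL A (Suc k)"
  by (rule GL_I[where h = "mat_pad A k (inv\<^bsub>mat_ring A k\<^esub> x)"])
    (use x in \<open>simp_all flip: mat_pad_mult add: mat_pad_one\<close>)

end

context unital_cstar_algebra
begin

text \<open>A trivial quotient has \<open>GL_inf0\<close> as its only coset. The coset of the
  stabilized \<open>h\<close> contains that matrix, which therefore lies in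
  \<open>GL_inf0\<close>.\<close>

lemma K1_trivial_stable:
  assumes K1: "trivial_group (K1 A)" and n: "n \<ge> 1" and h: "h \<in> GL A n"
  shows "\<exists>m. \<exists>y\<in>GL0 A m. stabilize A n h = stabilize A m y"
proof -
  let ?x = "stabilize A n h" and ?e = "\<one>\<^bsub>GL_inf A\<^esub>"
  have "?x \<in> carrier (GL_inf A)" using n h by (auto simp: GL_inf_def)
  then have "GL_inf0 A #>\<^bsub>GL_inf A\<^esub> ?x \<in> carrier (K1 A)"
    unfolding K1_def carrier_FactGroup by blast
  also have "carrier (K1 A) = {GL_inf0 A}"
    using K1 unfolding trivial_group_def K1_def FactGroup_def by simp
  finally have eq: "GL_inf0 A #>\<^bsub>GL_inf A\<^esub> ?x = GL_inf0 A" by simp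
  have e: "?e = stabilize A 1 \<one>\<^bsub>mat_ring A 1\<^esub>"
    by (auto simp: GL_inf_def stabilize_def fun_eq_iff mat_entries)
  have "?e \<in> GL_inf0 A"
    unfolding GL_inf0_def e by (rule UN_I[of 1], simp, rule imageI, rule one_GL0)
  then have "?e \<otimes>\<^bsub>GL_inf A\<^esub> ?x \<in> GL_inf0 A #>\<^bsub>GL_inf A\<^esub> ?x" unfolding r_coset_def by blast
  then have "?e \<otimes>\<^bsub>GL_inf A\<^esub> ?x \<in> GL_inf0 A" by (simp only: eq)
  moreover have "?e \<otimes>\<^bsub>GL_inf A\<^esub> ?x = ?x"
  proof (rule ext)
    fix p :: "nat \<times> nat"
    obtain i j where p: "p = (i, j)" by (cases p)
    have xc: "?x (k, j) \<in> carrier A" for k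
      using mat_carrierD[OF GL_closed[OF h]] by (simp add: stabilize_def)
    have *: "(?e \<otimes>\<^bsub>GL_inf A\<^esub> ?x) (i, j) = (\<Oplus>k\<in>{k. (if i = k then \<one> else \<zero>) \<noteq> \<zero>}. (if i = k then \<one> else \<zero>) \<otimes> ?x (k, j))"
      by (simp add: GL_inf_def)
    show "(?e \<otimes>\<^bsub>GL_inf A\<^esub> ?x) p = ?x p"
    \<comment> \<open>In the zero algebra the index set of the sum is empty; the claim holds there
      because every entry is \<zero>.\<close>
    proof (cases "\<one> = \<zero>")
      case True
      have "?x (i, j) = \<one> \<otimes> ?x (i, j)" using xc by simp
      also have "\<dots> = \<zero>" unfolding True using xc by simp
      finally show ?thesis unfolding p * using True by simp
    next
      case False
      then have "{k. (if i = k then \<one> else \<zero>) \<noteq> \<zero>} = {i}" by auto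
      then show ?thesis unfolding p * using xc by simp
    qed
  qed
  ultimately have "?x \<in> GL_inf0 A" by simp
  then show ?thesis unfolding GL_inf0_def by blast
qed

text \<open>All blocks are cut from one infinite matrix \<open>S\<close>, which stabilizes both
  \<open>h\<close> and some \<open>y\<close> in an identity component. The second description serves
  to enlarge blocks, the first to shrink them. Each shrinking step from size \<open>k + 1\<close> to
  \<open>k\<close> uses transitivity at size \<open>k + 1\<close> with \<open>k \<ge> n\<close>: it
  makes the path fix the last unit vector, so that its cut is again invertible.\<close>

lemma K1_trivial_loop:
  assumes K1: "trivial_group (K1 A)" and n: "n \<ge> 1" and h: "h \<in> GL A n"
    and trans: "\<And>m. m \<ge> n \<Longrightarrow> transitive_on_Lg CT m (GL CT m)"
  shows "\<exists>p. loop n p h"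
proof -
  interpret T: coeff_ring CT by (rule CT_coeff_ring)
  define S where "S = stabilize A n h"
  obtain m y where y: "y \<in> GL0 A m" "S = stabilize A m y"
    using K1_trivial_stable[OF K1 n h] unfolding S_def by blast
  have tr: "mat_cut k (stabilize A k x) = x" if "x \<in> mats A k" for k x
  proof (rule mat_ext[where A = A and n = k])
    show "mat_cut k (stabilize A k x) \<in> mats A k"
      unfolding mat_carrier by (rule PiE_I) (use mat_carrierD[OF that] in \<open>auto simp: mat_map_def stabilize_def\<close>)
  qed (use that in \<open>simp_all add: stabilize_def\<close>)
  have base: "\<exists>p. loop m p (mat_cut m S)"
    unfolding y(2) tr[OF GL_closed[OF subsetD[OF GL0_subset_GL y(1)]]] by (rule GL0_loop[OF y(1)])
  have up: "\<exists>p. loop (Suc k) p (mat_cut (Suc k) S)" if k: "k \<ge> m" and ex: "\<exists>p. loop k p (mat_cut k S)" for k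
  proof -
    from ex obtain p where p: "loop k p (mat_cut k S)" by blast
    have pG: "p \<in> GL CT k" using p by (simp add: loop_def)
    have ev: "ev_mat (Suc k) z (mat_pad CT k p) = mat_pad A k (ev_mat k z p)" if z: "z \<in> circle" for z
      by (auto simp: mat_map_def mat_pad_def fun_eq_iff CT_apply(5,6)[OF z])
    have "mat_pad A k (mat_cut k S) = mat_cut (Suc k) S"
      unfolding y(2) using k by (auto simp: mat_pad_def mat_map_def stabilize_def fun_eq_iff)
    then have "loop (Suc k) (mat_pad CT k p) (mat_cut (Suc k) S)"
      using p T.mat_pad_GL[OF pG] unfolding loop_def by (simp add: ev mat_pad_one)
    then show ?thesis by blast
  qed
  have down: "\<exists>p. loop k p (mat_cut k S)" if k: "k \<ge> n" and ex: "\<exists>p. loop (Suc k) p (mat_cut (Suc k) S)" for k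
  proof -
    from ex obtain p where p: "loop (Suc k) p (mat_cut (Suc k) S)" by blast
    have pG: "p \<in> GL CT (Suc k)" and p1: "ev_mat (Suc k) 1 p = \<one>\<^bsub>mat_ring A (Suc k)\<^esub>"
      and pm: "ev_mat (Suc k) (-1) p = mat_cut (Suc k) S" using p by (simp_all add: loop_def)
    have e: "last_unit k \<in> Lg A (Suc k)" by (rule delta_Lg) simp
    have Sc: "mat_cut (Suc k) S \<in> mats A (Suc k)" using loop_GL[OF p] by simp
    have "mat_vec A (Suc k) (mat_cut (Suc k) S) (last_unit k) = last_unit k"
    proof (rule vec_ext[where A = A and n = "Suc k"])
      fix i assume i: "i < Suc k"
      have "mat_vec A (Suc k) (mat_cut (Suc k) S) (last_unit k) i
          = lin_comb A (Suc k) (\<lambda>j. mat_cut (Suc k) S (i, j)) (\<lambda>j. if j = k then \<one> else \<zero>)"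
        using i mat_carrierD[OF Sc i] by (subst mat_vec_apply) (auto intro!: lin_comb_cong)
      also have "\<dots> = mat_cut (Suc k) S (i, k)" using mat_carrierD[OF Sc i] by (subst lin_comb_delta_right) simp_all
      \<comment> \<open>From column \<open>n\<close> on, \<open>S\<close> agrees with the identity
        matrix.\<close>
      also have "\<dots> = last_unit k i" using i k by (auto simp: S_def stabilize_def)
      finally show "mat_vec A (Suc k) (mat_cut (Suc k) S) (last_unit k) i = last_unit k i" .
    qed (use e Sc in \<open>simp_all add: Lg_def\<close>)
    then obtain g where g: "g \<in> GL CT (Suc k)"
      "mat_vec CT (Suc k) (unwind A (Suc k) g p) (vec_map (Suc k) circle_const (last_unit k)) = vec_map (Suc k) circle_const (last_unit k)"
      using unwind_fixes[OF e pG p1 _ trans[of "Suc k"]] k unfolding pm by auto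
    let ?s = "unwind A (Suc k) g p"
    have s: "?s \<in> GL CT (Suc k)" by (rule unwind_GL[OF g(1) pG])
    have "vec_map (Suc k) circle_const (last_unit k) = T.last_unit k"
      by (auto simp: vec_map_def circle_const_def CT_simps(4,5) fun_eq_iff restrict_def)
    then have c: "mat_cut k ?s \<in> GL CT k" using T.mat_cut_GL[OF s] g(2) by simp
    have ev: "ev_mat k z (mat_cut k ?s) = mat_cut k (ev_mat (Suc k) z ?s)" for z
      by (auto simp: mat_map_def fun_eq_iff)
    have "mat_cut k (mat_cut (Suc k) S) = mat_cut k S" by (auto simp: mat_map_def fun_eq_iff)
    then have "loop k (mat_cut k ?s) (mat_cut k S)"
      using c unfolding loop_def ev unwind_ends[OF g(1) pG] p1 pm mat_cut_one by simp
    then show ?thesis by blast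
  qed
  define E where "E k \<longleftrightarrow> (\<exists>p. loop k p (mat_cut k S))" for k
  have "E (m + j)" for j
    by (induction j) (use base up in \<open>simp_all add: E_def\<close>)
  \<comment> \<open>\<open>m\<close> may lie on either side of \<open>n\<close>: the size goes up to
    the maximum and then down to \<open>n\<close>.\<close>
  moreover have "m + (max m n - m) = n + (max m n - n)" by simp
  ultimately have "E (n + (max m n - n))" by metis
  moreover have "E (n + j) \<Longrightarrow> E n" for j
  proof (induction j)
    case (Suc j)
    have "E (n + j)" unfolding E_def by (rule down) (use Suc.prems in \<open>simp_all add: E_def\<close>)
    then show ?case by (rule Suc.IH)
  qed simp
  ultimately have "E n" by blast
  then have "\<exists>p. loop n p (mat_cut n S)" by (simp only: E_def)
  then show ?thesis using tr[OF GL_closed[OF h]] by (simp add: S_def)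
qed

end

section \<open>Stable ranks of pullbacks\<close>

text \<open>The set is closed upwards, and a nonempty set in \<open>enat\<close> attains its
  infimum; hence the bound by \<open>N\<close> amounts to membership of \<open>N\<close>.\<close>

lemma Inf_enat_le_iff:
  "Inf {enat n | n. n \<ge> 1 \<and> (\<forall>m\<ge>n. Q m)} \<le> enat N \<longleftrightarrow> N \<ge> 1 \<and> (\<forall>m\<ge>N. Q m)" (is "Inf ?S \<le> _ \<longleftrightarrow> _")
proof
  assume le: "Inf ?S \<le> enat N"
  then have "?S \<noteq> {}" by (auto simp: Inf_enat_def split: if_splits)
  then have "Inf ?S \<in> ?S" unfolding Inf_enat_def by (auto intro: LeastI)
  with le show "N \<ge> 1 \<and> (\<forall>m\<ge>N. Q m)" by auto
qed (auto intro!: Inf_lower)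

lemma gsr_le_iff: "gsr A \<le> enat N \<longleftrightarrow> N \<ge> 1 \<and> (\<forall>m\<ge>N. transitive_on_Lg A m (GL A m))"
  unfolding gsr_def by (rule Inf_enat_le_iff)

lemma csr_le_iff: "csr A \<le> enat N \<longleftrightarrow> N \<ge> 1 \<and> (\<forall>m\<ge>N. transitive_on_Lg A m (GL0 A m))"
  unfolding csr_def by (rule Inf_enat_le_iff)

lemma le_Max_enatI:
  assumes "\<And>N. \<lbrakk>x \<le> enat N; y \<le> enat N; z \<le> enat N\<rbrakk> \<Longrightarrow> w \<le> enat N"
  shows "w \<le> Max {x, y, z :: enat}"
proof (cases "Max {x, y, z}")
  case (enat N)
  have "x \<le> Max {x, y, z}" "y \<le> Max {x, y, z}" "z \<le> Max {x, y, z}" by (intro Max_ge; simp)+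
  then show ?thesis using assms unfolding enat by simp
qed simp

context cstar_pullback_diagram
begin

text \<open>Bounds on \<open>csr\<close> provide matrices in the identity components. Their images
  over \<open>D\<close> are ends of paths, and so are the quotients of these images.\<close>

lemma gsr_pullback_le:
  assumes surj: "\<gamma> ` carrier C = carrier D \<or> \<delta> ` carrier B = carrier D"
  shows "gsr P \<le> Max {csr B, csr C, gsr (circle_tensor D)}"
proof (rule le_Max_enatI)
  fix N assume le: "csr B \<le> enat N" "csr C \<le> enat N" "gsr (circle_tensor D) \<le> enat N"
  have "transitive_on_Lg P m (GL P m)" if m: "m \<ge> N" for m
  proof (rule transitive_GL[OF surj])
    show "transitive_on_Lg (circle_tensor D) m (GL (circle_tensor D) m)"
      "transitive_on_Lg B m (GL0 B m)" "transitive_on_Lg C m (GL0 C m)"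
      using le m by (simp_all add: gsr_le_iff csr_le_iff)
    show "GL0 B m \<subseteq> GL B m" "GL0 C m \<subseteq> GL C m" by (rule d.A.GL0_subset_GL g.A.GL0_subset_GL)+
    fix x y assume "x \<in> GL0 B m" "y \<in> GL0 C m"
    then obtain p q where "d.A.loop m p x" "g.A.loop m q y" using d.A.GL0_loop g.A.GL0_loop by blast
    then have l: "d.B.loop m (mat_map m (circle_push \<delta>) p) (mat_map m \<delta> x)" "d.B.loop m (mat_map m (circle_push \<gamma>) q) (mat_map m \<gamma> y)"
      by (simp_all add: d.loop_push g.loop_push)
    show "\<exists>q. d.B.loop m q (mat_map m \<delta> x \<otimes>\<^bsub>mat_ring D m\<^esub> inv\<^bsub>mat_ring D m\<^esub> (mat_map m \<gamma> y))"
      using d.B.loop_mult[OF l(1) d.B.loop_inv[OF l(2)]] by blast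
    show "\<exists>q. d.B.loop m q (mat_map m \<gamma> y \<otimes>\<^bsub>mat_ring D m\<^esub> inv\<^bsub>mat_ring D m\<^esub> (mat_map m \<delta> x))"
      using d.B.loop_mult[OF l(2) d.B.loop_inv[OF l(1)]] by blast
  qed
  then show "gsr P \<le> enat N" using le by (simp add: gsr_le_iff csr_le_iff)
qed

lemma csr_pullback_le:
  assumes surj: "\<gamma> ` carrier C = carrier D \<or> \<delta> ` carrier B = carrier D"
  shows "csr P \<le> Max {csr B, csr C, csr (circle_tensor D)}"
  by (rule le_Max_enatI) (simp add: csr_le_iff transitive_GL0[OF surj])

text \<open>Under bounds on \<open>gsr\<close> the matrices over \<open>B\<close> and
  \<open>C\<close> may lie outside the identity components. The bound on the circle algebra lets
  \<open>K1_trivial_loop\<close> make every element of \<open>GL D m\<close> with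
  \<open>m \<ge> N\<close> the end of a path.\<close>

lemma gsr_pullback_le_of_trivial_K1:
  assumes surj: "\<gamma> ` carrier C = carrier D \<or> \<delta> ` carrier B = carrier D"
    and K1: "trivial_group (K1 D)"
  shows "gsr P \<le> Max {gsr B, gsr C, gsr (circle_tensor D)}"
proof (rule le_Max_enatI)
  fix N assume le: "gsr B \<le> enat N" "gsr C \<le> enat N" "gsr (circle_tensor D) \<le> enat N"
  have "transitive_on_Lg P m (GL P m)" if m: "m \<ge> N" for m
  proof (rule transitive_GL[OF surj])
    show "transitive_on_Lg (circle_tensor D) m (GL (circle_tensor D) m)"
      "transitive_on_Lg B m (GL B m)" "transitive_on_Lg C m (GL C m)"
      using le m by (simp_all add: gsr_le_iff)
    have loop: "\<exists>q. d.B.loop m q u" if "u \<in> GL D m" for u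
      using le m that by (intro d.B.K1_trivial_loop[OF K1]) (simp_all add: gsr_le_iff)
    fix x y assume "x \<in> GL B m" "y \<in> GL C m"
    then have "mat_map m \<delta> x \<in> GL D m" "mat_map m \<gamma> y \<in> GL D m" by simp_all
    then show "\<exists>q. d.B.loop m q (mat_map m \<delta> x \<otimes>\<^bsub>mat_ring D m\<^esub> inv\<^bsub>mat_ring D m\<^esub> (mat_map m \<gamma> y))"
      "\<exists>q. d.B.loop m q (mat_map m \<gamma> y \<otimes>\<^bsub>mat_ring D m\<^esub> inv\<^bsub>mat_ring D m\<^esub> (mat_map m \<delta> x))"
      by (auto intro!: loop)
  qed auto
  then show "gsr P \<le> enat N" using le by (simp add: gsr_le_iff)
qed

end

theorem theorem0p1:
  fixes B :: "'b cstar_alg" and C :: "'c cstar_alg" and D :: "'d cstar_alg"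
    and \<delta> :: "'b \<Rightarrow> 'd" and \<gamma> :: "'c \<Rightarrow> 'd"
  assumes "unital_cstar_algebra B" and "unital_cstar_algebra C" and "unital_cstar_algebra D"
    and "\<delta> \<in> cstar_hom B D" and "\<gamma> \<in> cstar_hom C D"
    and "\<gamma> ` carrier C = carrier D \<or> \<delta> ` carrier B = carrier D"
  shows "gsr (cstar_pullback B C \<delta> \<gamma>) \<le> Max {csr B, csr C, gsr (circle_tensor D)} \<and>
    csr (cstar_pullback B C \<delta> \<gamma>) \<le> Max {csr B, csr C, csr (circle_tensor D)} \<and>
    (trivial_group (K1 D) \<longrightarrow>
      gsr (cstar_pullback B C \<delta> \<gamma>) \<le> Max {gsr B, gsr C, gsr (circle_tensor D)})"
proof -
  interpret cstar_pullback_diagram B C D \<delta> \<gamma>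
    using assms(1-5) by (simp add: cstar_pullback_diagram_def cstar_morphism_def cstar_morphism_axioms_def)
  show ?thesis
    using gsr_pullback_le csr_pullback_le gsr_pullback_le_of_trivial_K1 assms(6) by simp
qed

end
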